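(* Let $\Sigma$ be a well-posed system with transfer function in $\mathcal S_{U,Y}$ and assume that $\mathbf W_c^\bigstar$ is densely defined. Then the available storage $S_a$ and the $L^2$-regularized required supply $\underline S_r$ are $L^2$-regular storage functions for $\Sigma$.
   Context: All Hilbert spaces are complex; $U,X,Y$ are separable Hilbert spaces. $\mathbb R^+=[0,\infty)$, $\mathbb R^-=(-\infty,0)$. For a Hilbert space $K$: $L^2_K=L^2(\mathbb R;K)$, $L^{2\pm}_K=L^2(\mathbb R^\pm;K)$; for an interval $J$, $L^2(J;K)$ is regarded as a subspace of $L^2_K$ by zero extension. $L^2_{loc,K}$: measurable $K$-valued functions on $\mathbb R$ that are square integrable on bounded intervals; $L^{2+}_{loc,K}$: those supported in $\mathbb R^+$. A subscript $\ell$ indicates support bounded to the left (e.g. $L^2_{\ell,K}$, $L^2_{\ell,loc,K}$, $L^{2-}_{\ell,K}$). Convergence $z_k\to z$ in $L^2_{\ell,loc,K}$ means that all supports lie in a common $(L,\infty)$ and $\pi_{[L,T]}z_k\to\pi_{[L,T]}z$ in $L^2_K$ for all $T>L$; $L^{2-}_{\ell,K}$ and $L^{2+}_{loc,K}$ inherit this topology. $(\tau^tu)(s)=u(t+s)$; $\pi_J$ is multiplication by the indicator function of $J$; $\pi_\pm=\pi_{\mathbb R^\pm}$; $\tau_+^t=\pi_+\tau^t$, $\tau_-^t=\tau^t\pi_-$ for $t\ge0$. A well-posed system $\Sigma=\begin{bmatrix}\mathfrak A&\mathfrak B\\ \mathfrak C&\mathfrak D\end{bmatrix}$ (input space $U$,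 state space $X$, output space $Y$): $t\mapsto\mathfrak A^t$ is a $C_0$-semigroup on $X$; $\mathfrak B:L^{2-}_{\ell,U}\to X$, $\mathfrak C:X\to L^{2+}_{loc,Y}$, $\mathfrak D:L^2_{\ell,loc,U}\to L^2_{\ell,loc,Y}$ are continuous linear maps with $\mathfrak A^t\mathfrak B=\mathfrak B\tau_-^t$ and $\mathfrak C\mathfrak A^t=\tau_+^t\mathfrak C$ for $t\ge0$, $\tau^t\mathfrak D=\mathfrak D\tau^t$ for $t\in\mathbb R$, $\pi_-\mathfrak D\pi_+=0$ and $\pi_+\mathfrak D\pi_-=\mathfrak C\mathfrak B\pi_-$. For $t\ge0$: $\mathfrak B^t=\mathfrak B\pi_-\tau^t|_{L^2([0,t];U)}$. A trajectory of $\Sigma$ on $\mathbb R^+$ with initial state $x_0$ is a triple $(u,x,y)$ with $u\in L^{2+}_{loc,U}$, $x(t)=\mathfrak A^tx_0+\mathfrak B^t\pi_{[0,t]}u$ for $t\ge0$, and $y=\mathfrak Cx_0+\mathfrak Du$. Transfer function: let $\omega_{\mathfrak A}=\lim_{t\to\infty}\ln\|\mathfrak A^t\|/t$, $\mathbb C_\alpha=\{\mathrm{Re}\,z>\alpha\}$, $\mathbb C^+=\mathbb C_0$. The transfer function is the (unique) analytic $\widehat{\mathfrak D}:\mathbb C_{\omega_{\mathfrak A}}\to\mathcal B(U,Y)$, bounded on $\mathbb C_\omega$ for every $\omega>\omega_{\mathfrak A}$, with $\widehat{\mathfrak Du}(\lambda)=\widehat{\mathfrak D}(\lambda)\widehat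 u(\lambda)$ (Laplace transforms), $\lambda\in\mathbb C_\omega$, for all $u$ supported in $\mathbb R^+$ with $e^{-\omega\cdot}u\in L^{2+}_U$. $\mathcal S_{U,Y}$: analytic $F:\mathbb C^+\to\mathcal B(U,Y)$ with $\|F(\lambda)\|\le1$ on $\mathbb C^+$; $\widehat{\mathfrak D}\in\mathcal S_{U,Y}$ means that $\widehat{\mathfrak D}$ restricted to $\mathbb C_{\omega_{\mathfrak A}}\cap\mathbb C^+$ extends to a function in $\mathcal S_{U,Y}$. Adjoint $L^2$-input map $\mathbf W_c^\bigstar:X\supset\mathrm{dom}(\mathbf W_c^\bigstar)\to L^{2-}_U$: $\mathrm{dom}(\mathbf W_c^\bigstar)$ consists of those $x\in X$ for which there is a (unique) $v\in L^{2-}_U$ with $\langle v,u\rangle=\langle x,\mathfrak Bu\rangle_X$ for all $u\in L^{2-}_{\ell,U}$, and $\mathbf W_c^\bigstar x=v$. If it is densely defined, $\mathbf W_c:=(\mathbf W_c^\bigstar)^*$ is the $L^2$-input map, and $\mathbf W_c^{-1}(\{x_0\}):=\{u\in\mathrm{dom}(\mathbf W_c):\mathbf W_cu=x_0\}$. When $\widehat{\mathfrak D}\in\mathcal S_{U,Y}$, $\mathfrak D|_{L^2_{\ell,U}}$ extends uniquely to a contraction $L_\Sigma:L^2_U\to L^2_Y$; set $\widetilde{\mathfrak T}_\Sigma=\pi_-L_\Sigma|_{L^{2-}_U}:L^{2-}_U\to L^{2-}_Y$. For a contraction $T$, $D_T=(I-T^*T)^{1/2}$. Storage function: $S:X\to[0,\infty]$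 with $S(0)=0$ and $S(x(t))+\int_0^t\|y\|^2ds\le S(x(0))+\int_0^t\|u\|^2ds$ for all trajectories on $\mathbb R^+$ and $t>0$. If $\mathbf W_c^\bigstar$ is densely defined, a storage function is $L^2$-regular if it is finite-valued on $\mathrm{ran}\,\mathbf W_c$. Available storage: $S_a(x_0)=\sup_{v\in L^{2+}_{loc,U},\,t>0}\big(\|\pi_{[0,t]}y\|^2-\|\pi_{[0,t]}v\|^2\big)$, where $y=\mathfrak Cx_0+\mathfrak Dv$. $L^2$-regularized required supply: $\underline S_r(x_0)=\inf_{u\in\mathbf W_c^{-1}(\{x_0\})}\|D_{\widetilde{\mathfrak T}_\Sigma}u\|^2_{L^{2-}_U}$, $x_0\in X$ (with $\inf\emptyset=\infty$). *)

theory Defs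
  imports "HOL-Analysis.Analysis"
begin

section \<open>Complex Hilbert spaces\<close>

text \<open>The inner product is linear in its first argument.  No non-triviality is required.\<close>

class complex_hilbert_space = banach +
  fixes scaleC :: "complex \<Rightarrow> 'a \<Rightarrow> 'a" (infixr "*\<^sub>C" 75)
    and cinner :: "'a \<Rightarrow> 'a \<Rightarrow> complex"
  assumes scaleC_add_right: "c *\<^sub>C (x + y) = c *\<^sub>C x + c *\<^sub>C y"
    and scaleC_add_left: "(c + d) *\<^sub>C x = c *\<^sub>C x + d *\<^sub>C x"
    and scaleC_scaleC: "c *\<^sub>C d *\<^sub>C x = (c * d) *\<^sub>C x"
    and scaleR_scaleC: "scaleR r x = complex_of_real r *\<^sub>C x"
    and cinner_commute: "cinner x y = cnj (cinner y x)"
    and cinner_add_left: "cinner (x + y) z = cinner x z + cinner y z"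
    and cinner_scaleC_left: "cinner (c *\<^sub>C x) y = c * cinner x y"
    and cinner_self: "cinner x x = complex_of_real ((norm x)\<^sup>2)"

text \<open>For metric spaces, second countability is the same as separability.\<close>

class separable_hilbert_space = complex_hilbert_space + second_countable_topology

instantiation complex :: separable_hilbert_space
begin

definition scaleC_complex :: "complex \<Rightarrow> complex \<Rightarrow> complex"
  where "scaleC_complex c x = c * x"

definition cinner_complex :: "complex \<Rightarrow> complex \<Rightarrow> complex"
  where "cinner_complex x y = x * cnj y"

instance
proof
  fix x :: complex
  show "cinner x x = complex_of_real ((norm x)\<^sup>2)"
    unfolding cinner_complex_def by (rule complex_norm_square [symmetric])
qed (simp_all add: scaleC_complex_def cinner_complex_def algebra_simps scaleR_conv_of_real)

end

text \<open>
  Elements of \<^typ>\<open>'a \<Rightarrow>\<^sub>L 'b\<close> are only real-linear, so complex homogeneity is an extra condition;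
  the norm is the operator norm.
\<close>

definition complex_homogeneous ::
  "('a::complex_hilbert_space \<Rightarrow>\<^sub>L 'b::complex_hilbert_space) \<Rightarrow> bool"
  where "complex_homogeneous T \<longleftrightarrow> (\<forall>c x. blinfun_apply T (c *\<^sub>C x) = c *\<^sub>C blinfun_apply T x)"

text \<open>
  Analyticity of an operator-valued function: Frechet differentiability with respect to the
  operator norm, with a complex-linear derivative.
\<close>

definition operator_analytic_on ::
  "(complex \<Rightarrow> ('u::complex_hilbert_space \<Rightarrow>\<^sub>L 'y::complex_hilbert_space)) \<Rightarrow> complex set \<Rightarrow> bool"
  where "operator_analytic_on F \<Omega> \<longleftrightarrow>
    (\<forall>z\<in>\<Omega>. complex_homogeneous (F z)) \<and>
    (\<forall>z\<in>\<Omega>. \<exists>D. (F has_derivative D) (at z) \<and>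
       (\<forall>c h u. blinfun_apply (D (c * h)) u = c *\<^sub>C blinfun_apply (D h) u))"

section \<open>Function spaces on the real line\<close>

text \<open>
  Elements of the function spaces are represented by Borel functions on the whole real line, and
  equality of elements is equality almost everywhere, \<open>=\<^sub>a\<close>.  Functions on a subset \<open>J\<close> are
  extended by zero.
\<close>

definition ae_eq :: "(real \<Rightarrow> 'k) \<Rightarrow> (real \<Rightarrow> 'k) \<Rightarrow> bool" (infix "=\<^sub>a" 50)
  where "f =\<^sub>a g \<longleftrightarrow> (AE t in lborel. f t = g t)"

definition supported_in :: "real set \<Rightarrow> (real \<Rightarrow> 'k::zero) \<Rightarrow> bool"
  where "supported_in J f \<longleftrightarrow> (AE t in lborel. t \<notin> J \<longrightarrow> f t = 0)"

definition L2 :: "real set \<Rightarrow> (real \<Rightarrow> 'k::separable_hilbert_space) set"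
  where "L2 J = {f \<in> borel_measurable lborel.
    integrable lborel (\<lambda>t. (norm (f t))\<^sup>2) \<and> supported_in J f}"

definition L2_norm_sq :: "(real \<Rightarrow> 'k::separable_hilbert_space) \<Rightarrow> real"
  where "L2_norm_sq f = (LINT t|lborel. (norm (f t))\<^sup>2)"

definition L2_inner :: "(real \<Rightarrow> 'k::separable_hilbert_space) \<Rightarrow> (real \<Rightarrow> 'k) \<Rightarrow> complex"
  where "L2_inner f g = (LINT t|lborel. cinner (f t) (g t))"

definition L2_loc :: "(real \<Rightarrow> 'k::separable_hilbert_space) set"
  where "L2_loc = {f \<in> borel_measurable lborel.
    \<forall>a b. set_integrable lborel {a..b} (\<lambda>t. (norm (f t))\<^sup>2)}"

definition left_bounded :: "(real \<Rightarrow> 'k::zero) \<Rightarrow> bool"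
  where "left_bounded f \<longleftrightarrow> (\<exists>a. supported_in {a<..} f)"

definition L2_left :: "real set \<Rightarrow> (real \<Rightarrow> 'k::separable_hilbert_space) set"
  where "L2_left J = {f \<in> L2 J. left_bounded f}"

definition L2_left_loc :: "(real \<Rightarrow> 'k::separable_hilbert_space) set"
  where "L2_left_loc = {f \<in> L2_loc. left_bounded f}"

definition L2_plus_loc :: "(real \<Rightarrow> 'k::separable_hilbert_space) set"
  where "L2_plus_loc = {f \<in> L2_loc. supported_in {0..} f}"

definition proj :: "real set \<Rightarrow> (real \<Rightarrow> 'k::real_vector) \<Rightarrow> real \<Rightarrow> 'k"
  where "proj J f = (\<lambda>t. indicator J t *\<^sub>R f t)"

definition shift :: "real \<Rightarrow> (real \<Rightarrow> 'k) \<Rightarrow> real \<Rightarrow> 'k"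
  where "shift t f = (\<lambda>s. f (t + s))"

definition shift_plus :: "real \<Rightarrow> (real \<Rightarrow> 'k::real_vector) \<Rightarrow> real \<Rightarrow> 'k"
  where "shift_plus t f = proj {0..} (shift t f)"

definition shift_minus :: "real \<Rightarrow> (real \<Rightarrow> 'k::real_vector) \<Rightarrow> real \<Rightarrow> 'k"
  where "shift_minus t f = shift t (proj {..<0} f)"

definition converges_left_loc ::
  "(nat \<Rightarrow> real \<Rightarrow> 'k::separable_hilbert_space) \<Rightarrow> (real \<Rightarrow> 'k) \<Rightarrow> bool"
  where "converges_left_loc z z0 \<longleftrightarrow>
    (\<exists>a. (\<forall>k. supported_in {a<..} (z k)) \<and> supported_in {a<..} z0 \<and>
       (\<forall>b>a. (\<lambda>k. L2_norm_sq (proj {a..b} (\<lambda>t. z k t - z0 t))) \<longlonglongrightarrow> 0))"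

section \<open>Well-posed systems\<close>

record (overloaded) ('u, 'x, 'y) system =
  semigroup_op :: "real \<Rightarrow> ('x \<Rightarrow>\<^sub>L 'x)"
  input_map :: "(real \<Rightarrow> 'u) \<Rightarrow> 'x"
  output_map :: "'x \<Rightarrow> real \<Rightarrow> 'y"
  io_map :: "(real \<Rightarrow> 'u) \<Rightarrow> real \<Rightarrow> 'y"

definition C0_semigroup :: "(real \<Rightarrow> ('x::complex_hilbert_space \<Rightarrow>\<^sub>L 'x)) \<Rightarrow> bool"
  where "C0_semigroup A \<longleftrightarrow>
    (\<forall>t\<ge>0. complex_homogeneous (A t)) \<and>
    A 0 = id_blinfun \<and>
    (\<forall>s\<ge>0. \<forall>t\<ge>0. A (s + t) = A s o\<^sub>L A t) \<and>
    (\<forall>x. ((\<lambda>t. blinfun_apply (A t) x) \<longlongrightarrow> x) (at_right 0))"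

text \<open>
  For the spaces of functions with support bounded to the left, continuity is sequential
  continuity with respect to \<^const>\<open>converges_left_loc\<close>.  Since the limit of a sequence is
  only determined up to \<open>=\<^sub>a\<close>, continuity implies that the maps below respect \<open>=\<^sub>a\<close>.
\<close>

definition continuous_linear_input_map ::
  "((real \<Rightarrow> 'u::separable_hilbert_space) \<Rightarrow> 'x::separable_hilbert_space) \<Rightarrow> bool"
  where "continuous_linear_input_map B \<longleftrightarrow>
    (\<forall>u\<in>L2_left {..<0}. \<forall>v\<in>L2_left {..<0}. B (\<lambda>t. u t + v t) = B u + B v) \<and>
    (\<forall>c. \<forall>u\<in>L2_left {..<0}. B (\<lambda>t. c *\<^sub>C u t) = c *\<^sub>C B u) \<and>
    (\<forall>z z0. (\<forall>k. z k \<in> L2_left {..<0}) \<and> z0 \<in> L2_left {..<0} \<and> converges_left_loc z z0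
       \<longrightarrow> (\<lambda>k. B (z k)) \<longlonglongrightarrow> B z0)"

definition continuous_linear_output_map ::
  "('x::separable_hilbert_space \<Rightarrow> real \<Rightarrow> 'y::separable_hilbert_space) \<Rightarrow> bool"
  where "continuous_linear_output_map C \<longleftrightarrow>
    (\<forall>x. C x \<in> L2_plus_loc) \<and>
    (\<forall>x x'. C (x + x') =\<^sub>a (\<lambda>t. C x t + C x' t)) \<and>
    (\<forall>c x. C (c *\<^sub>C x) =\<^sub>a (\<lambda>t. c *\<^sub>C C x t)) \<and>
    (\<forall>z z0. z \<longlonglongrightarrow> z0 \<longrightarrow> converges_left_loc (\<lambda>k. C (z k)) (C z0))"

definition continuous_linear_io_map ::
  "((real \<Rightarrow> 'u::separable_hilbert_space) \<Rightarrow> real \<Rightarrow> 'y::separable_hilbert_space) \<Rightarrow> bool"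
  where "continuous_linear_io_map D \<longleftrightarrow>
    (\<forall>u\<in>L2_left_loc. D u \<in> L2_left_loc) \<and>
    (\<forall>u\<in>L2_left_loc. \<forall>v\<in>L2_left_loc. D (\<lambda>t. u t + v t) =\<^sub>a (\<lambda>t. D u t + D v t)) \<and>
    (\<forall>c. \<forall>u\<in>L2_left_loc. D (\<lambda>t. c *\<^sub>C u t) =\<^sub>a (\<lambda>t. c *\<^sub>C D u t)) \<and>
    (\<forall>z z0. (\<forall>k. z k \<in> L2_left_loc) \<and> z0 \<in> L2_left_loc \<and> converges_left_loc z z0
       \<longrightarrow> converges_left_loc (\<lambda>k. D (z k)) (D z0))"

definition well_posed_system ::
  "('u::separable_hilbert_space, 'x::separable_hilbert_space, 'y::separable_hilbert_space) system
    \<Rightarrow> bool"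
  where "well_posed_system \<Sigma> \<longleftrightarrow>
    C0_semigroup (semigroup_op \<Sigma>) \<and>
    continuous_linear_input_map (input_map \<Sigma>) \<and>
    continuous_linear_output_map (output_map \<Sigma>) \<and>
    continuous_linear_io_map (io_map \<Sigma>) \<and>
    (\<forall>t\<ge>0. \<forall>u\<in>L2_left {..<0}.
       blinfun_apply (semigroup_op \<Sigma> t) (input_map \<Sigma> u) = input_map \<Sigma> (shift_minus t u)) \<and>
    (\<forall>t\<ge>0. \<forall>x.
       output_map \<Sigma> (blinfun_apply (semigroup_op \<Sigma> t) x) =\<^sub>a shift_plus t (output_map \<Sigma> x)) \<and>
    (\<forall>t. \<forall>u\<in>L2_left_loc. shift t (io_map \<Sigma> u) =\<^sub>a io_map \<Sigma> (shift t u)) \<and>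
    (\<forall>u\<in>L2_left_loc. proj {..<0} (io_map \<Sigma> (proj {0..} u)) =\<^sub>a (\<lambda>_. 0)) \<and>
    (\<forall>u\<in>L2_left_loc.
       proj {0..} (io_map \<Sigma> (proj {..<0} u)) =\<^sub>a output_map \<Sigma> (input_map \<Sigma> (proj {..<0} u)))"

definition input_map_upto ::
  "('u::real_vector, 'x, 'y) system \<Rightarrow> real \<Rightarrow> (real \<Rightarrow> 'u) \<Rightarrow> 'x"
  where "input_map_upto \<Sigma> t u = input_map \<Sigma> (proj {..<0} (shift t u))"

text \<open>Trajectory on the positive half-line with initial state \<open>x0\<close>; \<open>x t\<close> is irrelevant for \<open>t < 0\<close>.\<close>

definition trajectory ::
  "('u::separable_hilbert_space, 'x::separable_hilbert_space, 'y::separable_hilbert_space) system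
    \<Rightarrow> 'x \<Rightarrow> (real \<Rightarrow> 'u) \<Rightarrow> (real \<Rightarrow> 'x) \<Rightarrow> (real \<Rightarrow> 'y) \<Rightarrow> bool"
  where "trajectory \<Sigma> x0 u x y \<longleftrightarrow>
    u \<in> L2_plus_loc \<and>
    (\<forall>t\<ge>0. x t = blinfun_apply (semigroup_op \<Sigma> t) x0 + input_map_upto \<Sigma> t (proj {0..t} u)) \<and>
    y \<in> L2_plus_loc \<and>
    y =\<^sub>a (\<lambda>t. output_map \<Sigma> x0 t + io_map \<Sigma> u t)"

section \<open>Transfer functions\<close>

text \<open>
  The growth bound may be \<open>-\<infinity>\<close>.  The case distinction implements \<open>ln 0 = -\<infinity>\<close>,
  whereas \<^term>\<open>ln (0::real) = 0\<close> in the library.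
\<close>

definition growth_bound :: "(real \<Rightarrow> ('x::complex_hilbert_space \<Rightarrow>\<^sub>L 'x)) \<Rightarrow> ereal"
  where "growth_bound A =
    Lim at_top (\<lambda>t. if norm (A t) = 0 then - \<infinity> else ereal (ln (norm (A t)) / t))"

definition right_half_plane :: "ereal \<Rightarrow> complex set"
  where "right_half_plane \<alpha> = {z. \<alpha> < ereal (Re z)}"

definition laplace_integrand ::
  "(real \<Rightarrow> 'k::separable_hilbert_space) \<Rightarrow> complex \<Rightarrow> real \<Rightarrow> 'k"
  where "laplace_integrand f z = (\<lambda>t. exp (- (z * complex_of_real t)) *\<^sub>C f t)"

definition laplace :: "(real \<Rightarrow> 'k::separable_hilbert_space) \<Rightarrow> complex \<Rightarrow> 'k"
  where "laplace f z = (LINT t:{0..}|lborel. laplace_integrand f z t)"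

text \<open>
  The values of \<open>G\<close> outside \<^term>\<open>right_half_plane (growth_bound (semigroup_op \<Sigma>))\<close> are irrelevant.
  Integrability is stated explicitly because the integral of a non-integrable function is \<open>0\<close>;
  for the input it is automatic.
\<close>

definition is_transfer_function ::
  "('u::separable_hilbert_space, 'x::separable_hilbert_space, 'y::separable_hilbert_space) system
    \<Rightarrow> (complex \<Rightarrow> ('u \<Rightarrow>\<^sub>L 'y)) \<Rightarrow> bool"
  where "is_transfer_function \<Sigma> G \<longleftrightarrow>
    operator_analytic_on G (right_half_plane (growth_bound (semigroup_op \<Sigma>))) \<and>
    (\<forall>\<omega>::real. growth_bound (semigroup_op \<Sigma>) < ereal \<omega> \<longrightarrow>
       bounded (G ` right_half_plane (ereal \<omega>)) \<and>
       (\<forall>u. (\<lambda>t. exp (- \<omega> * t) *\<^sub>R u t) \<in> L2 {0..} \<longrightarrow>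
          (\<forall>z\<in>right_half_plane (ereal \<omega>).
             set_integrable lborel {0..} (laplace_integrand (io_map \<Sigma> u) z) \<and>
             laplace (io_map \<Sigma> u) z = blinfun_apply (G z) (laplace u z))))"

definition schur_class ::
  "(complex \<Rightarrow> ('u::complex_hilbert_space \<Rightarrow>\<^sub>L 'y::complex_hilbert_space)) set"
  where "schur_class =
    {F. operator_analytic_on F (right_half_plane 0) \<and> (\<forall>z\<in>right_half_plane 0. norm (F z) \<le> 1)}"

definition transfer_function_in_schur_class ::
  "('u::separable_hilbert_space, 'x::separable_hilbert_space, 'y::separable_hilbert_space) system
    \<Rightarrow> (complex \<Rightarrow> ('u \<Rightarrow>\<^sub>L 'y)) \<Rightarrow> bool"
  where "transfer_function_in_schur_class \<Sigma> G \<longleftrightarrow>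
    (\<exists>F\<in>schur_class. \<forall>z\<in>right_half_plane (growth_bound (semigroup_op \<Sigma>)) \<inter> right_half_plane 0.
       F z = G z)"

section \<open>Bounded operators between spaces of square integrable functions\<close>

definition L2_linear ::
  "real set \<Rightarrow> real set
    \<Rightarrow> ((real \<Rightarrow> 'h::separable_hilbert_space) \<Rightarrow> real \<Rightarrow> 'k::separable_hilbert_space) \<Rightarrow> bool"
  where "L2_linear I J T \<longleftrightarrow>
    (\<forall>f\<in>L2 I. T f \<in> L2 J) \<and>
    (\<forall>f\<in>L2 I. \<forall>g\<in>L2 I. T (\<lambda>t. f t + g t) =\<^sub>a (\<lambda>t. T f t + T g t)) \<and>
    (\<forall>c. \<forall>f\<in>L2 I. T (\<lambda>t. c *\<^sub>C f t) =\<^sub>a (\<lambda>t. c *\<^sub>C T f t))"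

definition L2_bounded_linear ::
  "real set \<Rightarrow> real set
    \<Rightarrow> ((real \<Rightarrow> 'h::separable_hilbert_space) \<Rightarrow> real \<Rightarrow> 'k::separable_hilbert_space) \<Rightarrow> bool"
  where "L2_bounded_linear I J T \<longleftrightarrow>
    L2_linear I J T \<and> (\<exists>M. \<forall>f\<in>L2 I. L2_norm_sq (T f) \<le> M * L2_norm_sq f)"

definition L2_contraction ::
  "real set \<Rightarrow> real set
    \<Rightarrow> ((real \<Rightarrow> 'h::separable_hilbert_space) \<Rightarrow> real \<Rightarrow> 'k::separable_hilbert_space) \<Rightarrow> bool"
  where "L2_contraction I J T \<longleftrightarrow>
    L2_linear I J T \<and> (\<forall>f\<in>L2 I. L2_norm_sq (T f) \<le> L2_norm_sq f)"

text \<open>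
  The adjoint, the positive square root and the extension \<open>L\<^sub>\<Sigma>\<close> below are unique only up to \<open>=\<^sub>a\<close>,
  so they are introduced with the choice operator.
\<close>

definition L2_adjoint ::
  "real set \<Rightarrow> real set
    \<Rightarrow> ((real \<Rightarrow> 'h::separable_hilbert_space) \<Rightarrow> real \<Rightarrow> 'k::separable_hilbert_space)
    \<Rightarrow> (real \<Rightarrow> 'k) \<Rightarrow> real \<Rightarrow> 'h"
  where "L2_adjoint I J T = (SOME S. L2_bounded_linear J I S \<and>
    (\<forall>f\<in>L2 I. \<forall>g\<in>L2 J. L2_inner (T f) g = L2_inner f (S g)))"

definition L2_positive ::
  "real set \<Rightarrow> ((real \<Rightarrow> 'k::separable_hilbert_space) \<Rightarrow> real \<Rightarrow> 'k) \<Rightarrow> bool"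
  where "L2_positive J P \<longleftrightarrow> L2_bounded_linear J J P \<and>
    (\<forall>f\<in>L2 J. Im (L2_inner (P f) f) = 0 \<and> Re (L2_inner (P f) f) \<ge> 0)"

definition L2_sqrt ::
  "real set \<Rightarrow> ((real \<Rightarrow> 'k::separable_hilbert_space) \<Rightarrow> real \<Rightarrow> 'k) \<Rightarrow> (real \<Rightarrow> 'k) \<Rightarrow> real \<Rightarrow> 'k"
  where "L2_sqrt J P = (SOME Q. L2_positive J Q \<and> (\<forall>f\<in>L2 J. Q (Q f) =\<^sub>a P f))"

definition defect_operator ::
  "real set \<Rightarrow> real set
    \<Rightarrow> ((real \<Rightarrow> 'h::separable_hilbert_space) \<Rightarrow> real \<Rightarrow> 'k::separable_hilbert_space)
    \<Rightarrow> (real \<Rightarrow> 'h) \<Rightarrow> real \<Rightarrow> 'h"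
  where "defect_operator I J T = L2_sqrt I (\<lambda>f t. f t - L2_adjoint I J T (T f) t)"

definition L_ext ::
  "('u::separable_hilbert_space, 'x, 'y::separable_hilbert_space) system
    \<Rightarrow> (real \<Rightarrow> 'u) \<Rightarrow> real \<Rightarrow> 'y"
  where "L_ext \<Sigma> = (SOME L. L2_contraction UNIV UNIV L \<and> (\<forall>u\<in>L2_left UNIV. L u =\<^sub>a io_map \<Sigma> u))"

definition T_past ::
  "('u::separable_hilbert_space, 'x, 'y::separable_hilbert_space) system
    \<Rightarrow> (real \<Rightarrow> 'u) \<Rightarrow> real \<Rightarrow> 'y"
  where "T_past \<Sigma> u = proj {..<0} (L_ext \<Sigma> u)"

section \<open>The square integrable input map\<close>

definition is_Wc_star_value ::
  "('u::separable_hilbert_space, 'x::complex_hilbert_space, 'y) system \<Rightarrow> 'x \<Rightarrow> (real \<Rightarrow> 'u) \<Rightarrow> bool"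
  where "is_Wc_star_value \<Sigma> x v \<longleftrightarrow>
    v \<in> L2 {..<0} \<and> (\<forall>u\<in>L2_left {..<0}. L2_inner v u = cinner x (input_map \<Sigma> u))"

definition Wc_star_dom ::
  "('u::separable_hilbert_space, 'x::complex_hilbert_space, 'y) system \<Rightarrow> 'x set"
  where "Wc_star_dom \<Sigma> = {x. \<exists>v. is_Wc_star_value \<Sigma> x v}"

definition Wc_star ::
  "('u::separable_hilbert_space, 'x::complex_hilbert_space, 'y) system \<Rightarrow> 'x \<Rightarrow> real \<Rightarrow> 'u"
  where "Wc_star \<Sigma> x = (SOME v. is_Wc_star_value \<Sigma> x v)"

definition Wc_star_densely_defined ::
  "('u::separable_hilbert_space, 'x::complex_hilbert_space, 'y) system \<Rightarrow> bool"
  where "Wc_star_densely_defined \<Sigma> \<longleftrightarrow> closure (Wc_star_dom \<Sigma>) = UNIV"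

text \<open>\<open>Wc\<close> is the Hilbert space adjoint of the densely defined operator \<^const>\<open>Wc_star\<close>.\<close>

definition is_Wc_value ::
  "('u::separable_hilbert_space, 'x::complex_hilbert_space, 'y) system \<Rightarrow> (real \<Rightarrow> 'u) \<Rightarrow> 'x \<Rightarrow> bool"
  where "is_Wc_value \<Sigma> u z \<longleftrightarrow> (\<forall>x\<in>Wc_star_dom \<Sigma>. L2_inner (Wc_star \<Sigma> x) u = cinner x z)"

definition Wc_dom ::
  "('u::separable_hilbert_space, 'x::complex_hilbert_space, 'y) system \<Rightarrow> (real \<Rightarrow> 'u) set"
  where "Wc_dom \<Sigma> = {u \<in> L2 {..<0}. \<exists>z. is_Wc_value \<Sigma> u z}"

definition Wc ::
  "('u::separable_hilbert_space, 'x::complex_hilbert_space, 'y) system \<Rightarrow> (real \<Rightarrow> 'u) \<Rightarrow> 'x"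
  where "Wc \<Sigma> u = (THE z. is_Wc_value \<Sigma> u z)"

section \<open>Storage functions\<close>

definition storage_function ::
  "('u::separable_hilbert_space, 'x::separable_hilbert_space, 'y::separable_hilbert_space) system
    \<Rightarrow> ('x \<Rightarrow> ereal) \<Rightarrow> bool"
  where "storage_function \<Sigma> S \<longleftrightarrow>
    (\<forall>x. 0 \<le> S x) \<and> S 0 = 0 \<and>
    (\<forall>x0 u x y t. trajectory \<Sigma> x0 u x y \<and> 0 < t \<longrightarrow>
       S (x t) + ereal (LINT s:{0..t}|lborel. (norm (y s))\<^sup>2)
         \<le> S (x 0) + ereal (LINT s:{0..t}|lborel. (norm (u s))\<^sup>2))"

definition L2_regular_storage_function ::
  "('u::separable_hilbert_space, 'x::separable_hilbert_space, 'y::separable_hilbert_space) system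
    \<Rightarrow> ('x \<Rightarrow> ereal) \<Rightarrow> bool"
  where "L2_regular_storage_function \<Sigma> S \<longleftrightarrow>
    storage_function \<Sigma> S \<and> (\<forall>x \<in> Wc \<Sigma> ` Wc_dom \<Sigma>. S x < \<infinity>)"

definition available_storage ::
  "('u::separable_hilbert_space, 'x::separable_hilbert_space, 'y::separable_hilbert_space) system
    \<Rightarrow> 'x \<Rightarrow> ereal"
  where "available_storage \<Sigma> x0 =
    (SUP (v, t) \<in> L2_plus_loc \<times> {0<..}.
       ereal (L2_norm_sq (proj {0..t} (\<lambda>s. output_map \<Sigma> x0 s + io_map \<Sigma> v s))
         - L2_norm_sq (proj {0..t} v)))"

definition regularized_required_supply ::
  "('u::separable_hilbert_space, 'x::separable_hilbert_space, 'y::separable_hilbert_space) system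
    \<Rightarrow> 'x \<Rightarrow> ereal"
  where "regularized_required_supply \<Sigma> x0 =
    (INF u \<in> {u \<in> Wc_dom \<Sigma>. Wc \<Sigma> u = x0}.
       ereal (L2_norm_sq (defect_operator {..<0} {..<0} (T_past \<Sigma>) u)))"

end

theory Submission
  imports Defs "HOL-Complex_Analysis.Cauchy_Integral_Formula"
begin

text \<open>
  The heart of the matter is passivity: \<open>\<parallel>\<pi>\<^bsub>[0,T]\<^esub>\<DD>u\<parallel> \<le> \<parallel>\<pi>\<^bsub>[0,T]\<^esub>u\<parallel>\<close>.  For inputs and test functions
  that are sums of exponentials \<open>e\<^bsup>-kt\<^esup>x\<close>, the pairing \<open>\<langle>\<DD>u, g\<rangle>\<close> only involves values of the
  transfer function at real points, and the bound is a Pick inequality, which follows from the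
  Cauchy formula on circles after a Cayley transform.  Such sums approximate everything else, in
  a weight that absorbs the growth of the system.

  Passivity turns an input on the past followed by an input on \<open>[0,t]\<close> into an energy balance
  between the past and the trajectory that starts from the state \<open>\<BB>u\<close>.  Since \<open>\<parallel>D\<^sub>Tu\<parallel>\<^sup>2 =
  \<parallel>u\<parallel>\<^sup>2 - \<parallel>Tu\<parallel>\<^sup>2\<close> and the input map \<open>W\<^sub>c\<close> is the closure of \<open>\<BB>\<close>, the balance passes to the limit: it
  bounds the available storage at \<open>W\<^sub>cu\<close> by \<open>\<parallel>D\<^sub>Tu\<parallel>\<^sup>2\<close>, and continuing an input \<open>u\<close> with
  \<open>W\<^sub>cu = x\<^sub>0\<close> by an input on \<open>[0,t]\<close> gives the dissipation inequality for the required supply.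
  Concatenation of inputs gives the one for the available storage.
\<close>

section \<open>Complex Hilbert spaces\<close>

text \<open>The Schur hypothesis lives on \<open>Re z > 0\<close>, but Laplace transforms of outputs
  are available only to the right of the growth bound, which may be positive. An output is therefore
  not known to be square integrable, and neither Plancherel nor boundary values on the imaginary
  axis can be used directly. Exponentials circumvent this: pairing \<open>D u\<close> with
  \<open>exp (- a * t)\<close> evaluates a Laplace transform at the real point \<open>a\<close>,
  which converges once \<open>a\<close> is beyond the growth bound. What makes this sufficient is
  that \<open>exp (- a * t)\<close> and \<open>exp (- b * t)\<close> have inner product
  \<open>1 / (a + b)\<close> on the half-line: the Gram matrix of the exponentials is the Szego
  kernel of the half-plane, so the Pick inequality at the points \<open>N + k\<close> is already the
  desired estimate, in the form
  \<open>2 * Re (L2_inner (D u) g) \<le> L2_norm_sq u + L2_norm_sq g\<close>. This form allows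
  limits in \<open>g\<close> while \<open>u\<close> stays fixed.

  Adjoints, square roots and the extension of \<open>D\<close> are picked by \<open>SOME\<close>
  among functions modulo null sets. Their existence is proved in a Hilbert space of classes and
  carried back to functions.\<close>

lemma cinner_add_right: "cinner x (y + z) = cinner x y + cinner x z"
  by (metis cinner_add_left cinner_commute complex_cnj_add)

lemma cinner_scaleC_right: "cinner x (c *\<^sub>C y) = cnj c * cinner x y"
  by (metis cinner_scaleC_left cinner_commute complex_cnj_mult)

lemma cinner_scaleR_left: "cinner (r *\<^sub>R x) y = r *\<^sub>R cinner x y"
  by (simp only: scaleR_scaleC[of r x] cinner_scaleC_left scaleR_conv_of_real)

lemma cinner_scaleR_right: "cinner x (r *\<^sub>R y) = r *\<^sub>R cinner x y"
  by (simp only: scaleR_scaleC[of r y] cinner_scaleC_right scaleR_conv_of_real complex_cnj_complex_of_real)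

lemma cinner_minus_left: "cinner (- x) y = - cinner x y"
  using cinner_scaleR_left[of "-1" x y] by simp

lemma cinner_minus_right: "cinner x (- y) = - cinner x y"
  using cinner_scaleR_right[of x "-1" y] by simp

lemma cinner_diff_left: "cinner (x - y) z = cinner x z - cinner y z"
  using cinner_add_left[of x "-y" z] by (simp add: cinner_minus_left)

lemma cinner_diff_right: "cinner x (y - z) = cinner x y - cinner x z"
  using cinner_add_right[of x y "-z"] by (simp add: cinner_minus_right)

lemma cinner_zero_left [simp]: "cinner 0 y = 0"
  using cinner_scaleR_left[of 0 0 y] by simp

lemma cinner_zero_right [simp]: "cinner y 0 = 0"
  using cinner_scaleR_right[of y 0 0] by simp

lemma Re_cinner_self [simp]: "Re (cinner x x) = (norm x)\<^sup>2"
  by (simp add: cinner_self)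

lemma Re_cinner_commute: "Re (cinner x y) = Re (cinner y x)"
  by (subst cinner_commute) simp

lemma norm_add_sq: "(norm (x + y))\<^sup>2 = (norm x)\<^sup>2 + (norm y)\<^sup>2 + 2 * Re (cinner x y)"
  for x y :: "'a::complex_hilbert_space"
proof -
  have "Re (cinner (x + y) (x + y)) = (norm x)\<^sup>2 + (norm y)\<^sup>2 + 2 * Re (cinner x y)"
    unfolding cinner_add_left cinner_add_right using Re_cinner_commute[of x y] by simp
  then show ?thesis by simp
qed

lemma norm_diff_sq: "(norm (x - y))\<^sup>2 = (norm x)\<^sup>2 + (norm y)\<^sup>2 - 2 * Re (cinner x y)"
  for x y :: "'a::complex_hilbert_space"
  using norm_add_sq[of x "-y"] by (simp add: cinner_minus_right)

lemma norm_scaleC: "norm (c *\<^sub>C x) = cmod c * norm x"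
proof -
  have "Re (cinner (c *\<^sub>C x) (c *\<^sub>C x)) = Re (c * cnj c * cinner x x)"
    by (simp only: cinner_scaleC_left cinner_scaleC_right mult.assoc mult.left_commute)
  also have "\<dots> = (cmod c)\<^sup>2 * (norm x)\<^sup>2"
    by (simp only: complex_norm_square[symmetric] cinner_self of_real_mult[symmetric] Re_complex_of_real)
  finally have "(norm (c *\<^sub>C x))\<^sup>2 = (cmod c * norm x)\<^sup>2"
    by (simp add: power_mult_distrib)
  then show ?thesis by (simp add: power2_eq_iff_nonneg)
qed

lemma two_Re_cinner_le: "2 * Re (cinner x y) \<le> (norm x)\<^sup>2 + (norm y)\<^sup>2"
  using norm_diff_sq[of x y] zero_le_power2[of "norm (x - y)"] by linarith

lemma norm_cinner_le: "cmod (cinner x y) \<le> norm x * norm y"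
proof (cases "y = 0")
  case False
  \<comment> \<open>\<open>c *\<^sub>C y\<close> is the orthogonal projection of \<open>x\<close>
    onto the line through \<open>y\<close>; expanding the squared norm of the remainder gives
    Cauchy-Schwarz.\<close>
  define c where "c = cinner x y / complex_of_real ((norm y)\<^sup>2)"
  have y: "norm y > 0" using False by simp
  have "cinner x (c *\<^sub>C y) = complex_of_real ((cmod (cinner x y))\<^sup>2 / (norm y)\<^sup>2)"
    by (simp add: c_def cinner_scaleC_right complex_norm_square[symmetric] complex_mult_cnj
        mult.commute[of "cnj _"])
  moreover have "(norm (c *\<^sub>C y))\<^sup>2 = (cmod (cinner x y))\<^sup>2 / (norm y)\<^sup>2"
    using y by (simp add: norm_scaleC c_def norm_divide power_mult_distrib power_divide norm_power)
      (simp add: power2_eq_square power4_eq_xxxx field_simps)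
  ultimately have "0 \<le> (norm x)\<^sup>2 - (cmod (cinner x y))\<^sup>2 / (norm y)\<^sup>2"
    using norm_diff_sq[of x "c *\<^sub>C y"] zero_le_power2[of "norm (x - c *\<^sub>C y)"] by simp
  then have "(cmod (cinner x y))\<^sup>2 \<le> (norm x * norm y)\<^sup>2"
    using y by (simp add: divide_le_eq power_mult_distrib)
  then show ?thesis by (simp add: power2_le_iff_abs_le abs_mult)
qed simp

lemma bounded_bilinear_cinner: "bounded_bilinear (cinner :: 'a::complex_hilbert_space \<Rightarrow> 'a \<Rightarrow> complex)"
  by (rule bounded_bilinear.intro)
    (auto simp: cinner_add_left cinner_add_right cinner_scaleR_left cinner_scaleR_right
      intro!: exI[of _ 1] norm_cinner_le)

lemma scaleC_scaleR_commute: "c *\<^sub>C (r *\<^sub>R x) = r *\<^sub>R (c *\<^sub>C x)"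
  by (simp only: scaleR_scaleC scaleC_scaleC mult.commute)

lemma bounded_bilinear_scaleC:
  "bounded_bilinear (scaleC :: complex \<Rightarrow> 'a::complex_hilbert_space \<Rightarrow> 'a)"
proof (rule bounded_bilinear.intro)
  show "(r *\<^sub>R c) *\<^sub>C x = r *\<^sub>R (c *\<^sub>C x)" for r c and x :: 'a
    by (simp only: scaleR_scaleC[of r "c *\<^sub>C x"] scaleC_scaleC scaleR_conv_of_real)
qed (auto simp: scaleC_add_left scaleC_add_right scaleC_scaleR_commute norm_scaleC intro!: exI[of _ 1])

lemma scaleC_zero_left [simp]: "0 *\<^sub>C x = 0"
  by (rule bounded_bilinear.zero_left[OF bounded_bilinear_scaleC])

lemma scaleC_zero_right [simp]: "c *\<^sub>C 0 = 0"
  by (rule bounded_bilinear.zero_right[OF bounded_bilinear_scaleC])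

lemmas cinner_sum_left = bounded_bilinear.sum_left[OF bounded_bilinear_cinner]
  and cinner_sum_right = bounded_bilinear.sum_right[OF bounded_bilinear_cinner]
  and tendsto_cinner = bounded_bilinear.tendsto[OF bounded_bilinear_cinner]
  and tendsto_scaleC = bounded_bilinear.tendsto[OF bounded_bilinear_scaleC]

lemma cinner_eqI: "(\<And>z. cinner x z = cinner y z) \<Longrightarrow> x = y"
proof -
  assume "\<And>z. cinner x z = cinner y z"
  then have "cinner (x - y) (x - y) = 0" by (simp add: cinner_diff_left)
  then show "x = y" by (simp add: cinner_self)
qed

lemma cinner_eqI_right: "(\<And>z. cinner z x = cinner z y) \<Longrightarrow> x = y"
  by (rule cinner_eqI) (metis cinner_commute)

text \<open>The graph of the input map is closed up in such a product: the orthogonal complement of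
  a graph is, up to sign, the graph of the adjoint.\<close>

instantiation prod :: (complex_hilbert_space, complex_hilbert_space) complex_hilbert_space
begin

definition "c *\<^sub>C p = (c *\<^sub>C fst p, c *\<^sub>C snd p)"

definition "cinner p q = cinner (fst p) (fst q) + cinner (snd p) (snd q)"

instance
proof
  fix p q r :: "'a \<times> 'b" and c d :: complex and a :: real
  show "a *\<^sub>R p = complex_of_real a *\<^sub>C p"
    unfolding scaleC_prod_def scaleR_prod_def by (rule arg_cong2[where f = Pair]; rule scaleR_scaleC)
  show "cinner p q = cnj (cinner q p)"
    unfolding cinner_prod_def complex_cnj_add
    by (rule arg_cong2[where f = "(+)"]; rule cinner_commute)
  show "cinner p p = complex_of_real ((norm p)\<^sup>2)"
    by (simp add: cinner_prod_def cinner_self norm_prod_def)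
  show "c *\<^sub>C (p + q) = c *\<^sub>C p + c *\<^sub>C q" "(c + d) *\<^sub>C p = c *\<^sub>C p + d *\<^sub>C p"
    "c *\<^sub>C d *\<^sub>C p = (c * d) *\<^sub>C p"
    by (simp_all only: scaleC_prod_def scaleC_add_right scaleC_add_left scaleC_scaleC fst_add snd_add
        fst_conv snd_conv add_Pair)
  show "cinner (p + q) r = cinner p r + cinner q r"
    by (simp only: cinner_prod_def cinner_add_left fst_add snd_add ac_simps)
  show "cinner (c *\<^sub>C p) q = c * cinner p q"
    by (simp only: cinner_prod_def scaleC_prod_def cinner_scaleC_left fst_conv snd_conv distrib_left)
qed

end

subsection \<open>Orthogonal projection and the Riesz representation\<close>

text \<open>A minimizing sequence is Cauchy by the parallelogram law, and completeness supplies the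
  minimizer.\<close>

lemma closed_subspace_nearest_point:
  fixes M :: "'a::complex_hilbert_space set"
  assumes "closed M" "0 \<in> M" and add: "\<And>x y. x \<in> M \<Longrightarrow> y \<in> M \<Longrightarrow> x + y \<in> M"
    and scale: "\<And>c x. x \<in> M \<Longrightarrow> c *\<^sub>C x \<in> M"
  obtains m where "m \<in> M" "\<And>m'. m' \<in> M \<Longrightarrow> norm (x - m) \<le> norm (x - m')"
proof -
  define d where "d = infdist x M"
  have d_le: "d \<le> norm (x - m)" if "m \<in> M" for m
    using infdist_le[OF that, of x] by (simp add: d_def dist_norm)
  have d0: "0 \<le> d" by (simp add: d_def infdist_nonneg)
  have "\<exists>m\<in>M. norm (x - m) < d + 1 / Suc k" for k
  proof (rule ccontr)
    assume *: "\<not> (\<exists>m\<in>M. norm (x - m) < d + 1 / Suc k)"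
    then have "d + 1 / Suc k \<le> infdist x M"
      using \<open>0 \<in> M\<close> by (subst infdist_notempty) (force intro!: cINF_greatest simp: dist_norm)+
    then show False by (simp add: d_def)
  qed
  then obtain f where f: "\<And>k. f k \<in> M" "\<And>k. norm (x - f k) < d + 1 / Suc k"
    by metis
  \<comment> \<open>Parallelogram law for \<open>x - f i\<close> and \<open>x - f j\<close>: half
    their sum is \<open>x\<close> minus a midpoint that lies in \<open>M\<close>, so its norm is at
    least \<open>d\<close>.\<close>
  have par: "(norm (f i - f j))\<^sup>2 \<le> 2 * (norm (x - f i))\<^sup>2 + 2 * (norm (x - f j))\<^sup>2 - 4 * d\<^sup>2" for i j
  proof -
    define a where "a = x - f i"
    define b where "b = x - f j"
    have "(1/2) *\<^sub>R (f i + f j) \<in> M"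
      using scale[OF add[OF f(1) f(1)]] by (simp add: scaleR_scaleC)
    from d_le[OF this] have "d \<le> norm (x - (1/2) *\<^sub>R (f i + f j))" .
    also have "x - (1/2) *\<^sub>R (f i + f j) = (1/2) *\<^sub>R (a + b)"
      using scaleR_collapse[of "1/2" x] by (simp add: a_def b_def algebra_simps)
    finally have "2 * d \<le> norm (a + b)" by simp
    then have "4 * d\<^sup>2 \<le> (norm (a + b))\<^sup>2"
      using power_mono[of "2 * d" "norm (a + b)" 2] d0 by (simp add: power_mult_distrib)
    moreover have "f i - f j = b - a" by (simp add: a_def b_def)
    moreover have "(norm (b - a))\<^sup>2 + (norm (a + b))\<^sup>2 = 2 * (norm a)\<^sup>2 + 2 * (norm b)\<^sup>2"
      unfolding norm_add_sq norm_diff_sq using Re_cinner_commute[of a b] by simp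
    ultimately show ?thesis by (simp add: a_def b_def)
  qed
  have sq: "(\<lambda>k. (norm (x - f k))\<^sup>2) \<longlonglongrightarrow> d\<^sup>2"
  proof (intro tendsto_power)
    have "(\<lambda>k. d + 1 / real (Suc k)) \<longlonglongrightarrow> d + 0"
      by (intro tendsto_add tendsto_const LIMSEQ_Suc[OF lim_1_over_n])
    then have "(\<lambda>k. d + 1 / real (Suc k)) \<longlonglongrightarrow> d" by simp
    then show "(\<lambda>k. norm (x - f k)) \<longlonglongrightarrow> d"
      by (rule tendsto_sandwich[OF _ _ tendsto_const, rotated 2])
        (auto intro: always_eventually simp del: of_nat_Suc simp: d_le f(1) less_imp_le[OF f(2)])
  qed
  have "Cauchy f"
  proof (rule metric_CauchyI)
    fix e :: real assume "e > 0"
    then have "eventually (\<lambda>k. dist ((norm (x - f k))\<^sup>2) (d\<^sup>2) < e\<^sup>2 / 4) sequentially"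
      using sq by (intro tendstoD) auto
    then obtain N where N': "\<And>k. k \<ge> N \<Longrightarrow> dist ((norm (x - f k))\<^sup>2) (d\<^sup>2) < e\<^sup>2 / 4"
      unfolding eventually_sequentially by blast
    have N: "(norm (x - f k))\<^sup>2 < d\<^sup>2 + e\<^sup>2 / 4" if "k \<ge> N" for k
      using abs_ge_self[of "(norm (x - f k))\<^sup>2 - d\<^sup>2"] N'[OF that] unfolding dist_real_def by linarith
    have "dist (f i) (f j) < e" if "i \<ge> N" "j \<ge> N" for i j
    proof -
      have "(norm (f i - f j))\<^sup>2 < e\<^sup>2" using par[of i j] N[OF that(1)] N[OF that(2)] by linarith
      then show ?thesis using \<open>e > 0\<close> by (simp add: dist_norm power2_less_imp_less)
    qed
    then show "\<exists>N. \<forall>i\<ge>N. \<forall>j\<ge>N. dist (f i) (f j) < e" by blast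
  qed
  then obtain m where m: "f \<longlonglongrightarrow> m" using Cauchy_convergent convergent_def by blast
  have "m \<in> M" using \<open>closed M\<close> f(1) m closed_sequentially by blast
  have "(\<lambda>k. (norm (x - f k))\<^sup>2) \<longlonglongrightarrow> (norm (x - m))\<^sup>2" by (intro tendsto_intros m)
  then have "(norm (x - m))\<^sup>2 = d\<^sup>2" using sq LIMSEQ_unique by blast
  then have "norm (x - m) = d" using d0 by (simp add: power2_eq_iff_nonneg)
  with \<open>m \<in> M\<close> d_le show thesis by (intro that[of m]) auto
qed

text \<open>The residual \<open>n\<close> of the nearest point does it: if \<open>n\<close> were not
  orthogonal to some \<open>m'\<close> in \<open>M\<close>, moving the nearest point by the best
  multiple of \<open>m'\<close> would shorten it. With a kernel as \<open>M\<close> this gives the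
  Riesz theorem; with the closure of a graph it identifies the closure of the input map.\<close>

lemma separating_orthogonal_vector:
  fixes M :: "'a::complex_hilbert_space set"
  assumes "closed M" "0 \<in> M" and add: "\<And>x y. x \<in> M \<Longrightarrow> y \<in> M \<Longrightarrow> x + y \<in> M"
    and scale: "\<And>c x. x \<in> M \<Longrightarrow> c *\<^sub>C x \<in> M" and "x \<notin> M"
  obtains n where "\<And>m. m \<in> M \<Longrightarrow> cinner m n = 0" "cinner x n \<noteq> 0"
proof -
  obtain m where m: "m \<in> M" "\<And>m'. m' \<in> M \<Longrightarrow> norm (x - m) \<le> norm (x - m')"
    using closed_subspace_nearest_point[OF assms(1-4)] by metis
  define n where "n = x - m"
  have n0: "n \<noteq> 0" using m(1) \<open>x \<notin> M\<close> by (auto simp: n_def)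
  have orth: "cinner m' n = 0" if "m' \<in> M" for m'
  proof (cases "m' = 0")
    case False
    define c where "c = cinner n m' / complex_of_real ((norm m')\<^sup>2)"
    have y: "norm m' > 0" using False by simp
    have eq: "cinner n (c *\<^sub>C m') = complex_of_real ((cmod (cinner n m'))\<^sup>2 / (norm m')\<^sup>2)"
      by (simp add: c_def cinner_scaleC_right complex_norm_square[symmetric] complex_mult_cnj
          mult.commute[of "cnj _"])
    have "(norm (c *\<^sub>C m'))\<^sup>2 = (cmod (cinner n m'))\<^sup>2 / (norm m')\<^sup>2"
      using y by (simp add: norm_scaleC c_def norm_divide power_mult_distrib power_divide norm_power)
        (simp add: power2_eq_square power4_eq_xxxx field_simps)
    moreover have "norm n \<le> norm (n - c *\<^sub>C m')"
      using m(2)[OF add[OF m(1) scale[OF that, of c]]] by (simp add: n_def algebra_simps)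
    ultimately have "(cmod (cinner n m'))\<^sup>2 / (norm m')\<^sup>2 \<le> 0"
      using norm_diff_sq[of n "c *\<^sub>C m'"] eq power_mono[of "norm n" "norm (n - c *\<^sub>C m')" 2] by simp
    then have "cinner n m' = 0" using y by (simp add: divide_le_0_iff)
    then show ?thesis by (metis cinner_commute complex_cnj_zero)
  qed simp
  have "cinner x n = cinner m n + cinner n n" by (simp add: n_def cinner_diff_left)
  also have "\<dots> \<noteq> 0" using orth[OF m(1)] n0 by (simp add: cinner_self)
  finally show thesis using that orth by blast
qed

definition bounded_clinear :: "('a::complex_hilbert_space \<Rightarrow> 'b::complex_hilbert_space) \<Rightarrow> bool"
  where "bounded_clinear T \<longleftrightarrow> bounded_linear T \<and> (\<forall>c x. T (c *\<^sub>C x) = c *\<^sub>C T x)"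

lemma bounded_clinearI:
  assumes "\<And>x y. T (x + y) = T x + T y" "\<And>c x. T (c *\<^sub>C x) = c *\<^sub>C T x"
    and "\<And>x. norm (T x) \<le> K * norm x"
  shows "bounded_clinear T"
proof -
  have "bounded_linear T"
  proof (rule bounded_linear_intro[where K = K])
    show "T (r *\<^sub>R x) = r *\<^sub>R T x" for r x
      by (simp only: scaleR_scaleC assms(2))
    show "norm (T x) \<le> norm x * K" for x using assms(3)[of x] by (simp add: mult.commute)
  qed (rule assms)
  then show ?thesis by (simp add: bounded_clinear_def assms)
qed

lemma riesz_representation:
  fixes f :: "'a::complex_hilbert_space \<Rightarrow> complex"
  assumes "bounded_clinear f"
  obtains v where "\<And>x. f x = cinner x v"
proof (cases "\<forall>x. f x = 0")
  case True then show thesis by (intro that[of 0]) auto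
next
  case False
  interpret bounded_linear f using assms by (simp add: bounded_clinear_def)
  have fC: "f (c *\<^sub>C x) = c * f x" for c x
    using assms by (simp add: bounded_clinear_def scaleC_complex_def)
  from False obtain x where x: "f x \<noteq> 0" by blast
  obtain n where n: "\<And>m. f m = 0 \<Longrightarrow> cinner m n = 0" "cinner x n \<noteq> 0"
  proof (rule separating_orthogonal_vector[of "{m. f m = 0}" x])
    show "closed {m. f m = 0}"
      by (intro closed_Collect_eq continuous_on continuous_intros)
  qed (auto simp: add zero x fC)
  show thesis
  proof (rule that)
    fix z
    \<comment> \<open>\<open>f\<close> vanishes only where the pairing with \<open>n\<close> does,
      so the two functionals are proportional, and their values at \<open>x\<close> fix the factor
      \<open>c\<close>. It is conjugated below because the second argument of \<open>cinner\<close>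
      is antilinear.\<close>
    define c where "c = f x / cinner x n"
    have "f (z - (f z / f x) *\<^sub>C x) = 0" using x by (simp add: diff fC)
    from n(1)[OF this] have "cinner z n = (f z / f x) * cinner x n"
      by (simp add: cinner_diff_left cinner_scaleC_left)
    then show "f z = cinner z (cnj c *\<^sub>C n)"
      using x n(2) by (simp add: cinner_scaleC_right c_def field_simps)
  qed
qed

lemma adjoint_exists:
  assumes T: "bounded_clinear (T :: 'a::complex_hilbert_space \<Rightarrow> 'b::complex_hilbert_space)"
  obtains S where "bounded_clinear S" "\<And>x y. cinner (T x) y = cinner x (S y)"
proof -
  interpret T: bounded_linear T using T by (simp add: bounded_clinear_def)
  obtain K where K: "K \<ge> 0" "\<And>x. norm (T x) \<le> norm x * K" using T.nonneg_bounded by blast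
  have bd: "cmod (cinner (T x) y) \<le> norm x * K * norm y" for x y
    by (rule order_trans[OF norm_cinner_le]) (simp add: K mult_right_mono)
  have "\<exists>v. \<forall>x. cinner (T x) y = cinner x v" for y
  proof -
    have "bounded_clinear (\<lambda>x. cinner (T x) y)"
    proof (rule bounded_clinearI[where K = "K * norm y"])
      show "cmod (cinner (T x) y) \<le> K * norm y * norm x" for x
        using bd[of x y] by (simp add: ac_simps)
    qed (use T in \<open>auto simp: T.add cinner_add_left bounded_clinear_def cinner_scaleC_left scaleC_complex_def\<close>)
    then show ?thesis by (metis riesz_representation)
  qed
  then obtain S where S: "\<And>x y. cinner (T x) y = cinner x (S y)" by metis
  have "bounded_clinear S"
  proof (rule bounded_clinearI[where K = K])
    show "S (x + y) = S x + S y" for x y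
      by (rule cinner_eqI_right) (simp add: S[symmetric] cinner_add_right)
    show "S (c *\<^sub>C x) = c *\<^sub>C S x" for c x
      by (rule cinner_eqI_right) (simp add: S[symmetric] cinner_scaleC_right)
    show "norm (S y) \<le> K * norm y" for y
    proof (cases "S y = 0")
      case False
      have "(norm (S y))\<^sup>2 = cmod (cinner (T (S y)) y)"
        by (simp add: S cinner_self norm_power)
      also have "\<dots> \<le> norm (S y) * K * norm y" by (rule bd)
      finally show ?thesis using False by (simp add: power2_eq_square)
    qed (simp add: K)
  qed
  with S show thesis using that by blast
qed

subsection \<open>Square roots\<close>

text \<open>The coefficient of \<open>x ^ n\<close> in the binomial series of
  \<open>sqrt (1 - x)\<close>.\<close>

definition sqrt_coeff :: "nat \<Rightarrow> real"
  where "sqrt_coeff n = ((1/2) gchoose n) * (-1) ^ n"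

lemma sqrt_coeff_0 [simp]: "sqrt_coeff 0 = 1"
  by (simp add: sqrt_coeff_def)

lemma sqrt_coeff_nonpos: "n > 0 \<Longrightarrow> sqrt_coeff n \<le> 0"
proof (induction n)
  case (Suc n)
  have "sqrt_coeff (Suc n) = sqrt_coeff n * ((real n - 1/2) / (real n + 1))"
    by (simp add: sqrt_coeff_def gbinomial_Suc_rec field_simps)
  moreover have "n > 0 \<Longrightarrow> sqrt_coeff n * ((real n - 1/2) / (real n + 1)) \<le> 0"
    by (rule mult_nonpos_nonneg) (use Suc in auto)
  ultimately show ?case
    by (cases "n = 0") auto
qed simp

text \<open>Partial sums of coefficients are the coefficients of the series divided by
  \<open>1 - x\<close>, here those of \<open>(1 - x)\<close> to the power \<open>-1/2\<close>, which
  are nonnegative. As all coefficients but the first are nonpositive, this bounds their absolute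
  sum.\<close>

lemma sum_sqrt_coeff_nonneg: "0 \<le> (\<Sum>k\<le>n. sqrt_coeff k)"
proof -
  have "(-1) ^ m * (- (1/2) gchoose m) \<ge> (0::real)" for m
  proof (induction m)
    case (Suc m)
    have "(-1) ^ Suc m * (- (1/2) gchoose Suc m) =
        ((-1) ^ m * (- (1/2) gchoose m)) * ((real m + 1/2) / (real m + 1))"
      by (simp add: gbinomial_Suc_rec field_simps)
    with Suc show ?case by (metis add_nonneg_nonneg divide_nonneg_nonneg half_gt_zero_iff less_eq_real_def mult_nonneg_nonneg of_nat_0_le_iff zero_less_one)
  qed simp
  then show ?thesis
    unfolding sqrt_coeff_def gbinomial_sum_lower_neg by simp
qed

lemma sum_abs_sqrt_coeff_le: "(\<Sum>k=1..n. \<bar>sqrt_coeff k\<bar>) \<le> 1"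
proof -
  have "(\<Sum>k=1..n. \<bar>sqrt_coeff k\<bar>) = - (\<Sum>k=1..n. sqrt_coeff k)"
    unfolding sum_negf[symmetric] by (rule sum.cong) (auto simp: sqrt_coeff_nonpos)
  moreover have "(\<Sum>k\<le>n. sqrt_coeff k) = 1 + (\<Sum>k=1..n. sqrt_coeff k)"
    by (simp add: atMost_atLeast0 sum.atLeast_Suc_atMost)
  ultimately show ?thesis using sum_sqrt_coeff_nonneg[of n] by linarith
qed

lemma summable_sqrt_coeff: "summable (\<lambda>n. \<bar>sqrt_coeff n\<bar>)"
proof (rule bounded_imp_summable)
  show "(\<Sum>k\<le>n. \<bar>sqrt_coeff k\<bar>) \<le> 2" for n
    using sum_abs_sqrt_coeff_le[of n] by (simp add: atMost_atLeast0 sum.atLeast_Suc_atMost)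
qed simp

text \<open>Vandermonde's identity at \<open>1/2 + 1/2 = 1\<close>: the series squares to
  \<open>1 - x\<close>.\<close>

lemma sqrt_coeff_convolution:
  "(\<Sum>i\<le>n. sqrt_coeff i * sqrt_coeff (n - i)) = (if n = 0 then 1 else if n = 1 then -1 else 0)"
proof -
  have "(\<Sum>i\<le>n. sqrt_coeff i * sqrt_coeff (n - i)) =
      (\<Sum>i\<le>n. (-1) ^ n * (((1/2) gchoose i) * ((1/2) gchoose (n - i))))"
    by (rule sum.cong) (auto simp: sqrt_coeff_def power_add[symmetric])
  also have "\<dots> = (-1) ^ n * ((1/2 + 1/2) gchoose n)"
    unfolding sum_distrib_left[symmetric] gbinomial_Vandermonde[symmetric] atMost_atLeast0 ..
  also have "\<dots> = (-1) ^ n * real (1 choose n)"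
    using binomial_gbinomial[of 1 n, where 'a = real] by simp
  also have "\<dots> = (if n = 0 then 1 else if n = 1 then -1 else 0)"
    by (cases n rule: nat.exhaust) (auto simp: binomial_eq_0)
  finally show ?thesis .
qed

lemma summable_bounded_mult:
  fixes f :: "nat \<Rightarrow> 'a::banach"
  assumes "summable (\<lambda>n. \<bar>a n\<bar>)" "\<And>n. norm (f n) \<le> B"
  shows "summable (\<lambda>n. a n *\<^sub>R f n)"
proof (rule summable_comparison_test)
  show "summable (\<lambda>n. \<bar>a n\<bar> * B)" using assms(1) by (rule summable_mult2)
  show "\<exists>N. \<forall>n\<ge>N. norm (a n *\<^sub>R f n) \<le> \<bar>a n\<bar> * B"
    using assms(2) by (simp add: mult_left_mono)
qed

text \<open>To be read with \<open>f n = (K ^^ n) x\<close>: the Cauchy product of a power series in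
  an operator with itself, evaluated at one vector. The square of index pairs and the triangle
  \<open>i + j < N\<close> differ by terms whose weight is controlled by the scalar Cauchy
  product.\<close>

lemma square_partial_sum_tendsto:
  fixes f :: "nat \<Rightarrow> 'a::banach" and a :: "nat \<Rightarrow> real"
  assumes a: "summable (\<lambda>n. \<bar>a n\<bar>)" and f: "\<And>n. norm (f n) \<le> B"
  shows "(\<lambda>N. \<Sum>i<N. \<Sum>j<N. (a i * a j) *\<^sub>R f (i + j)) \<longlonglongrightarrow>
    (\<Sum>n. (\<Sum>i\<le>n. a i * a (n - i)) *\<^sub>R f n)"
proof -
  have B: "B \<ge> 0" using f[of 0] norm_ge_zero order_trans by blast
  define S where "S N = {(i, j). i + j < N} \<inter> {..<N} \<times> {..<N}" for N :: nat
  have S: "finite (S N)" "S N \<subseteq> {..<N} \<times> {..<N}" for N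
    unfolding S_def by (auto intro: finite_subset[of _ "{..<N} \<times> {..<N}"])
  have triangle: "(\<Sum>(i, j)\<in>S N. g i j) = (\<Sum>n<N. \<Sum>i\<le>n. g i (n - i))" for N and g :: "nat \<Rightarrow> nat \<Rightarrow> 'c::comm_monoid_add"
  proof -
    have "S N = {(i, j). i + j < N}" by (auto simp: S_def)
    then show ?thesis by (simp add: sum.triangle_reindex)
  qed
  have conv: "summable (\<lambda>n. \<Sum>i\<le>n. \<bar>a i\<bar> * \<bar>a (n - i)\<bar>)"
    using summable_Cauchy_product[of "\<lambda>n. \<bar>a n\<bar>" "\<lambda>n. \<bar>a n\<bar>"] a by simp
  have "summable (\<lambda>n. \<bar>\<Sum>i\<le>n. a i * a (n - i)\<bar>)"
  proof (rule summable_comparison_test[OF _ conv], intro exI allI impI)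
    show "norm \<bar>\<Sum>i\<le>n. a i * a (n - i)\<bar> \<le> (\<Sum>i\<le>n. \<bar>a i\<bar> * \<bar>a (n - i)\<bar>)" for n
      using sum_abs[of "\<lambda>i. a i * a (n - i)" "{..n}"] by (simp add: abs_mult)
  qed
  then have "summable (\<lambda>n. (\<Sum>i\<le>n. a i * a (n - i)) *\<^sub>R f n)"
    by (rule summable_bounded_mult) (rule f)
  then have lim: "(\<lambda>N. \<Sum>n<N. (\<Sum>i\<le>n. a i * a (n - i)) *\<^sub>R f n) \<longlonglongrightarrow>
      (\<Sum>n. (\<Sum>i\<le>n. a i * a (n - i)) *\<^sub>R f n)"
    by (rule summable_LIMSEQ)
  have part: "(\<Sum>n<N. (\<Sum>i\<le>n. a i * a (n - i)) *\<^sub>R f n) = (\<Sum>(i, j)\<in>S N. (a i * a j) *\<^sub>R f (i + j))" for N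
    unfolding triangle by (simp add: scaleR_sum_left)
  \<comment> \<open>The absolute weight of the index pairs in the square but outside the
    triangle.\<close>
  define d where "d N = (\<Sum>i<N. \<bar>a i\<bar>) * (\<Sum>j<N. \<bar>a j\<bar>) - (\<Sum>n<N. \<Sum>i\<le>n. \<bar>a i\<bar> * \<bar>a (n - i)\<bar>)" for N
  have "d \<longlonglongrightarrow> (\<Sum>n. \<bar>a n\<bar>) * (\<Sum>n. \<bar>a n\<bar>) - (\<Sum>n. \<bar>a n\<bar>) * (\<Sum>n. \<bar>a n\<bar>)"
    unfolding d_def
    using Cauchy_product_sums[of "\<lambda>n. \<bar>a n\<bar>" "\<lambda>n. \<bar>a n\<bar>"] a
    by (intro tendsto_diff tendsto_mult summable_LIMSEQ a) (simp add: sums_def)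
  then have d: "(\<lambda>N. d N * B) \<longlonglongrightarrow> 0" using tendsto_mult_left_zero by auto
  have bound: "norm ((\<Sum>i<N. \<Sum>j<N. (a i * a j) *\<^sub>R f (i + j)) -
      (\<Sum>n<N. (\<Sum>i\<le>n. a i * a (n - i)) *\<^sub>R f n)) \<le> d N * B" for N
  proof -
    have "(\<Sum>i<N. \<Sum>j<N. (a i * a j) *\<^sub>R f (i + j)) - (\<Sum>n<N. (\<Sum>i\<le>n. a i * a (n - i)) *\<^sub>R f n) =
        (\<Sum>(i, j)\<in>{..<N} \<times> {..<N} - S N. (a i * a j) *\<^sub>R f (i + j))"
      unfolding part by (subst sum_diff) (auto simp: S sum.cartesian_product)
    also have "norm \<dots> \<le> (\<Sum>p\<in>{..<N} \<times> {..<N} - S N. (\<bar>a (fst p)\<bar> * \<bar>a (snd p)\<bar>) * B)"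
      by (rule sum_norm_le) (auto simp: abs_mult f B mult_left_mono split: prod.splits)
    also have "\<dots> = d N * B"
      unfolding d_def sum_distrib_right[symmetric] triangle[symmetric, of "\<lambda>i j. \<bar>a i\<bar> * \<bar>a j\<bar>"]
      by (subst sum_diff) (auto simp: S sum_product sum.cartesian_product case_prod_unfold)
    finally show ?thesis .
  qed
  have "(\<lambda>N. (\<Sum>i<N. \<Sum>j<N. (a i * a j) *\<^sub>R f (i + j)) -
      (\<Sum>n<N. (\<Sum>i\<le>n. a i * a (n - i)) *\<^sub>R f n)) \<longlonglongrightarrow> 0"
    by (rule Lim_null_comparison[OF _ d]) (simp add: bound)
  from tendsto_add[OF this lim] show ?thesis by simp
qed

text \<open>The square root is the binomial series of \<open>\<surd>(1 - K)\<close>, whose coefficients are absolutely summable.\<close>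

lemma sqrt_one_minus_contraction:
  fixes K :: "'a::complex_hilbert_space \<Rightarrow> 'a"
  assumes K: "bounded_clinear K" and contr: "\<And>x. norm (K x) \<le> norm x"
    and sa: "\<And>x y. cinner (K x) y = cinner x (K y)"
  obtains Q where "bounded_clinear Q" "\<And>x. Q (Q x) = x - K x"
    "\<And>x. Im (cinner (Q x) x) = 0" "\<And>x. 0 \<le> Re (cinner (Q x) x)"
    "\<And>P x. bounded_clinear P \<Longrightarrow> (\<And>x. P (K x) = K (P x)) \<Longrightarrow> P (Q x) = Q (P x)"
proof -
  interpret K: bounded_linear K using K by (simp add: bounded_clinear_def)
  have KC: "K (c *\<^sub>C x) = c *\<^sub>C K x" for c x using K by (simp add: bounded_clinear_def)
  have pow: "norm ((K ^^ n) x) \<le> norm x" for n x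
    by (induction n) (auto intro: order_trans[OF contr])
  have pow_add: "(K ^^ n) (x + y) = (K ^^ n) x + (K ^^ n) y" for n x y
    by (induction n) (auto simp: K.add)
  have pow_sum: "(K ^^ n) (sum g A) = (\<Sum>a\<in>A. (K ^^ n) (g a))" for n and g :: "nat \<Rightarrow> 'a" and A
    by (induction n) (auto simp: K.sum)
  have pow_C: "(K ^^ n) (c *\<^sub>C x) = c *\<^sub>C (K ^^ n) x" for n c x
    by (induction n) (auto simp: KC)
  have pow_R: "(K ^^ n) (r *\<^sub>R x) = r *\<^sub>R (K ^^ n) x" for n r x
    by (simp only: scaleR_scaleC pow_C)
  have pow_sa: "cinner ((K ^^ n) x) y = cinner x ((K ^^ n) y)" for n x y
    by (induction n arbitrary: x y) (auto simp: sa funpow_swap1)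
  define q where "q N x = (\<Sum>n<N. sqrt_coeff n *\<^sub>R (K ^^ n) x)" for N x
  define Q where "Q x = (\<Sum>n. sqrt_coeff n *\<^sub>R (K ^^ n) x)" for x
  have q: "(\<lambda>N. q N x) \<longlonglongrightarrow> Q x" for x
    unfolding q_def Q_def by (intro summable_LIMSEQ summable_bounded_mult[OF summable_sqrt_coeff pow])
  have q_diff: "q N (x - y) = q N x - q N y" for N x y
    unfolding q_def sum_subtractf[symmetric]
    using pow_add[of _ "x - y" y] by (simp add: algebra_simps)
  have Q_add: "Q (x + y) = Q x + Q y" for x y
  proof (rule LIMSEQ_unique[OF q])
    have "q N (x + y) = q N x + q N y" for N
      by (simp add: q_def pow_add scaleR_add_right sum.distrib)
    then show "(\<lambda>N. q N (x + y)) \<longlonglongrightarrow> Q x + Q y" using tendsto_add[OF q q] by simp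
  qed
  have Q_C: "Q (c *\<^sub>C x) = c *\<^sub>C Q x" for c x
  proof (rule LIMSEQ_unique[OF q])
    have "q N (c *\<^sub>C x) = c *\<^sub>C q N x" for N
      by (simp add: q_def pow_C scaleC_scaleR_commute bounded_bilinear.sum_right[OF bounded_bilinear_scaleC])
    then show "(\<lambda>N. q N (c *\<^sub>C x)) \<longlonglongrightarrow> c *\<^sub>C Q x"
      using tendsto_scaleC[OF tendsto_const q] by simp
  qed
  have q_norm: "norm (q N x) \<le> 2 * norm x" for N x
  proof -
    have "norm (q N x) \<le> (\<Sum>n<N. \<bar>sqrt_coeff n\<bar> * norm x)"
      unfolding q_def by (rule sum_norm_le) (simp add: mult_left_mono pow)
    also have "\<dots> = (\<Sum>n<N. \<bar>sqrt_coeff n\<bar>) * norm x" by (simp add: sum_distrib_right)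
    also have "\<dots> \<le> 2 * norm x"
    proof (rule mult_right_mono)
      have "(\<Sum>n<N. \<bar>sqrt_coeff n\<bar>) \<le> (\<Sum>n\<le>N. \<bar>sqrt_coeff n\<bar>)"
        by (rule sum_mono2) auto
      also have "\<dots> \<le> 2"
        using sum_abs_sqrt_coeff_le[of N] by (simp add: atMost_atLeast0 sum.atLeast_Suc_atMost)
      finally show "(\<Sum>n<N. \<bar>sqrt_coeff n\<bar>) \<le> 2" .
    qed simp
    finally show ?thesis .
  qed
  have Q_norm: "norm (Q x) \<le> 2 * norm x" for x
    using tendsto_norm[OF q[of x]] q_norm by (intro LIMSEQ_le_const2) auto
  have "bounded_clinear Q" by (rule bounded_clinearI[OF Q_add Q_C Q_norm])
  moreover have "Q (Q x) = x - K x" for x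
  proof -
    \<comment> \<open>The inner argument moves with \<open>N\<close> as well; the bound 2 on the
      partial sums, uniform in \<open>N\<close>, allows both limits at once.\<close>
    have QQ: "(\<lambda>N. q N (q N x)) \<longlonglongrightarrow> Q (Q x)"
    proof (rule Lim_transform)
      show "(\<lambda>N. q N (Q x)) \<longlonglongrightarrow> Q (Q x)" by (rule q)
      have "(\<lambda>N. 2 * norm (q N x - Q x)) \<longlonglongrightarrow> 0"
        using LIM_zero[OF q[of x]] by (auto intro: tendsto_mult_right_zero simp: tendsto_norm_zero_iff)
      then show "(\<lambda>N. q N (q N x) - q N (Q x)) \<longlonglongrightarrow> 0"
        by (rule Lim_null_comparison[rotated]) (simp add: q_diff[symmetric] q_norm)
    qed
    have qq: "q N (q N x) = (\<Sum>i<N. \<Sum>j<N. (sqrt_coeff i * sqrt_coeff j) *\<^sub>R (K ^^ (i + j)) x)" for N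
      by (simp add: q_def pow_sum pow_R funpow_add scaleR_sum_right)
    have "Q (Q x) = (\<Sum>n. (\<Sum>i\<le>n. sqrt_coeff i * sqrt_coeff (n - i)) *\<^sub>R (K ^^ n) x)"
      by (rule LIMSEQ_unique[OF QQ]) (unfold qq,
        rule square_partial_sum_tendsto[where f = "\<lambda>n. (K ^^ n) x", OF summable_sqrt_coeff pow])
    also have "\<dots> = (\<Sum>n\<in>{0,1}. (\<Sum>i\<le>n. sqrt_coeff i * sqrt_coeff (n - i)) *\<^sub>R (K ^^ n) x)"
      by (rule suminf_finite) (auto simp: sqrt_coeff_convolution)
    also have "\<dots> = x - K x" by (simp add: sqrt_coeff_convolution)
    finally show ?thesis .
  qed
  moreover have Im: "Im (cinner (Q x) x) = 0" for x
  proof -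
    have "Im (cinner ((K ^^ n) x) x) = 0" for n
    proof -
      have "cinner ((K ^^ n) x) x = cnj (cinner ((K ^^ n) x) x)"
        by (subst (1) pow_sa) (rule cinner_commute)
      from arg_cong[OF this, of Im] show ?thesis by simp
    qed
    then have "Im (cinner (q N x) x) = 0" for N
      by (simp add: q_def cinner_sum_left cinner_scaleR_left)
    then show ?thesis
      using tendsto_Im[OF tendsto_cinner[OF q[of x] tendsto_const[of x]]] by (simp add: LIMSEQ_const_iff)
  qed
  \<comment> \<open>The constant term contributes the squared norm of \<open>x\<close>. The other
    coefficients are nonpositive with sum at least \<open>-1\<close>, and each is multiplied by at
    most the squared norm of \<open>x\<close>.\<close>
  moreover have "0 \<le> Re (cinner (Q x) x)" for x
  proof -
    have "0 \<le> Re (cinner (q (Suc N) x) x)" for N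
    proof -
      have "Re (cinner ((K ^^ n) x) x) \<le> (norm x)\<^sup>2" for n
      proof -
        have "Re (cinner ((K ^^ n) x) x) \<le> norm ((K ^^ n) x) * norm x"
          by (rule order_trans[OF complex_Re_le_cmod norm_cinner_le])
        also have "\<dots> \<le> norm x * norm x" by (intro mult_right_mono pow) simp
        finally show ?thesis by (simp add: power2_eq_square)
      qed
      then have "(\<Sum>n=1..N. sqrt_coeff n * (norm x)\<^sup>2) \<le> (\<Sum>n=1..N. sqrt_coeff n * Re (cinner ((K ^^ n) x) x))"
        by (intro sum_mono mult_left_mono_neg sqrt_coeff_nonpos) auto
      moreover have "- 1 * (norm x)\<^sup>2 \<le> (\<Sum>n=1..N. sqrt_coeff n) * (norm x)\<^sup>2"
      proof (rule mult_right_mono)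
        show "- 1 \<le> (\<Sum>n=1..N. sqrt_coeff n)"
          using sum_sqrt_coeff_nonneg[of N] by (simp add: atMost_atLeast0 sum.atLeast_Suc_atMost)
      qed simp
      moreover have "Re (cinner (q (Suc N) x) x) = (norm x)\<^sup>2 + (\<Sum>n=1..N. sqrt_coeff n * Re (cinner ((K ^^ n) x) x))"
        by (simp add: q_def cinner_sum_left cinner_scaleR_left cinner_add_left lessThan_Suc_atMost
            atMost_atLeast0 sum.atLeast_Suc_atMost)
      ultimately show ?thesis by (simp add: sum_distrib_right)
    qed
    then show ?thesis
      using tendsto_Re[OF tendsto_cinner[OF LIMSEQ_Suc[OF q[of x]] tendsto_const[of x]]]
      by (intro LIMSEQ_le_const) auto
  qed
  moreover have "P (Q x) = Q (P x)" if P: "bounded_clinear P" and comm: "\<And>x. P (K x) = K (P x)" for P x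
  proof -
    interpret P: bounded_linear P using P by (simp add: bounded_clinear_def)
    have "P ((K ^^ n) x) = (K ^^ n) (P x)" for n by (induction n) (auto simp: comm)
    then have "P (q N x) = q N (P x)" for N by (simp add: q_def P.sum P.scaleR)
    then show ?thesis using P.tendsto[OF q[of x]] by (intro LIMSEQ_unique[OF _ q[of "P x"]]) simp
  qed
  ultimately show thesis using that by blast
qed

section \<open>Square integrable functions\<close>

lemma ae_eq_refl [simp]: "f =\<^sub>a f"
  by (simp add: ae_eq_def)

lemma ae_eq_sym: "f =\<^sub>a g \<Longrightarrow> g =\<^sub>a f"
  by (auto simp: ae_eq_def)

lemma ae_eq_trans [trans]: "f =\<^sub>a g \<Longrightarrow> g =\<^sub>a h \<Longrightarrow> f =\<^sub>a h"
  unfolding ae_eq_def by (auto elim: eventually_elim2)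

lemma ae_eq_proj: "f =\<^sub>a g \<Longrightarrow> proj J f =\<^sub>a proj J g"
  unfolding ae_eq_def proj_def by (auto elim: eventually_mono)

lemma ae_eq_add: "f =\<^sub>a f' \<Longrightarrow> g =\<^sub>a g' \<Longrightarrow> (\<lambda>t. f t + g t) =\<^sub>a (\<lambda>t. f' t + g' t)"
  unfolding ae_eq_def by (auto elim: eventually_elim2)

lemma ae_eq_diff: "f =\<^sub>a f' \<Longrightarrow> g =\<^sub>a g' \<Longrightarrow> (\<lambda>t. f t - g t) =\<^sub>a (\<lambda>t. f' t - g' t)"
  unfolding ae_eq_def by (auto elim: eventually_elim2)

lemma ae_eq_comp: "f =\<^sub>a g \<Longrightarrow> (\<lambda>t. h (f t)) =\<^sub>a (\<lambda>t. h (g t))"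
  unfolding ae_eq_def by (auto elim: eventually_mono)

lemma ae_eq_shift:
  fixes f g :: "real \<Rightarrow> 'k::{second_countable_topology, real_normed_vector}"
  assumes [measurable]: "f \<in> borel_measurable borel" "g \<in> borel_measurable borel" and "f =\<^sub>a g"
  shows "shift t f =\<^sub>a shift t g"
  using AE_borel_affine[of 1 "\<lambda>s. f s = g s" t] assms(3) by (simp add: ae_eq_def shift_def)

lemma supported_in_shift:
  fixes f :: "real \<Rightarrow> 'k::{second_countable_topology, real_normed_vector}"
  assumes [measurable]: "f \<in> borel_measurable borel" "J \<in> sets borel" and "supported_in J f"
  shows "supported_in {s. t + s \<in> J} (shift t f)"
  using AE_borel_affine[of 1 "\<lambda>s. s \<notin> J \<longrightarrow> f s = 0" t] assms(3) by (simp add: supported_in_def shift_def)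

lemma supported_in_UNIV [simp]: "supported_in UNIV f"
  by (simp add: supported_in_def)

lemma supported_in_mono: "supported_in I f \<Longrightarrow> I \<subseteq> J \<Longrightarrow> supported_in J f"
  unfolding supported_in_def by (auto elim: eventually_mono)

lemma supported_in_proj [simp]: "supported_in J (proj J f)"
  by (simp add: supported_in_def proj_def)

lemma supported_in_proj': "supported_in J f \<Longrightarrow> supported_in J (proj I f)"
  unfolding supported_in_def proj_def by (auto elim: eventually_mono)

lemma supported_in_proj_eq: "supported_in J f \<longleftrightarrow> proj J f =\<^sub>a f"
  unfolding supported_in_def proj_def ae_eq_def
  by (rule iffI; erule eventually_mono) (auto simp: indicator_def split: if_splits)

lemma supported_in_add:
  "supported_in J f \<Longrightarrow> supported_in J g \<Longrightarrow> supported_in J (\<lambda>t. f t + g t :: 'k::monoid_add)"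
  unfolding supported_in_def by (auto elim: eventually_elim2)

lemma supported_in_diff:
  "supported_in J f \<Longrightarrow> supported_in J g \<Longrightarrow> supported_in J (\<lambda>t. f t - g t :: 'k::group_add)"
  unfolding supported_in_def by (auto elim: eventually_elim2)

lemma supported_in_comp: "supported_in J f \<Longrightarrow> h 0 = 0 \<Longrightarrow> supported_in J (\<lambda>t. h (f t))"
  unfolding supported_in_def by (auto elim: eventually_mono)

lemma supported_in_cong: "f =\<^sub>a g \<Longrightarrow> supported_in J f \<Longrightarrow> supported_in J g"
  unfolding supported_in_def ae_eq_def by (auto elim: eventually_elim2)

lemma measurable_proj [measurable]:
  fixes f :: "real \<Rightarrow> 'k::{second_countable_topology, real_normed_vector}"
  assumes [measurable]: "f \<in> borel_measurable borel" "J \<in> sets borel"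
  shows "proj J f \<in> borel_measurable borel"
  unfolding proj_def by measurable

lemma measurable_shift [measurable]:
  fixes f :: "real \<Rightarrow> 'k::topological_space"
  assumes "f \<in> borel_measurable borel"
  shows "shift t f \<in> borel_measurable borel"
  unfolding shift_def using assms by (rule measurable_compose[rotated]) measurable

lemma measurable_scaleC [measurable (raw)]:
  fixes f :: "'a \<Rightarrow> 'k::separable_hilbert_space"
  assumes "g \<in> borel_measurable M" "f \<in> borel_measurable M"
  shows "(\<lambda>t. g t *\<^sub>C f t) \<in> borel_measurable M"
  using assms by (rule borel_measurable_continuous_Pair)
    (intro continuous_on_fst continuous_on_snd continuous_on_id bounded_bilinear.continuous_on[OF bounded_bilinear_scaleC])

lemma measurable_cinner [measurable (raw)]:
  fixes f :: "'a \<Rightarrow> 'k::separable_hilbert_space"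
  assumes "g \<in> borel_measurable M" "f \<in> borel_measurable M"
  shows "(\<lambda>t. cinner (g t) (f t)) \<in> borel_measurable M"
  using assms by (rule borel_measurable_continuous_Pair)
    (intro continuous_on_fst continuous_on_snd continuous_on_id bounded_bilinear.continuous_on[OF bounded_bilinear_cinner])

lemma norm_proj: "(norm (proj J f t))\<^sup>2 = indicator J t * (norm (f t))\<^sup>2"
  by (auto simp: proj_def indicator_def)

lemma norm_add_sq_le: "(norm (x + y))\<^sup>2 \<le> 2 * (norm x)\<^sup>2 + 2 * (norm y)\<^sup>2"
  for x y :: "'a::complex_hilbert_space"
  using norm_add_sq[of x y] two_Re_cinner_le[of x y] by linarith

lemma L2_D:
  assumes "f \<in> L2 J"
  shows "f \<in> borel_measurable borel" "integrable lborel (\<lambda>t. (norm (f t))\<^sup>2)" "supported_in J f"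
  using assms by (auto simp: L2_def)

lemma L2_I:
  assumes "f \<in> borel_measurable borel" "integrable lborel (\<lambda>t. (norm (f t))\<^sup>2)" "supported_in J f"
  shows "f \<in> L2 J"
  using assms by (auto simp: L2_def)

lemma L2_mono: "f \<in> L2 I \<Longrightarrow> I \<subseteq> J \<Longrightarrow> f \<in> L2 J"
  using supported_in_mono by (fastforce simp: L2_def)

lemma L2_UNIV: "f \<in> L2 I \<Longrightarrow> f \<in> L2 UNIV"
  by (erule L2_mono) simp

lemma L2_cong:
  assumes f: "f \<in> L2 J" and [measurable]: "g \<in> borel_measurable borel" and eq: "f =\<^sub>a g"
  shows "g \<in> L2 J"
proof (rule L2_I)
  note [measurable] = L2_D(1)[OF f]
  show "integrable lborel (\<lambda>t. (norm (g t))\<^sup>2)"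
    by (rule integrable_cong_AE_imp[OF L2_D(2)[OF f]]) (use eq in \<open>auto simp: ae_eq_def elim: eventually_mono\<close>)
  show "supported_in J g" using supported_in_cong[OF eq] L2_D(3)[OF f] .
qed simp

lemma L2_zero [simp]: "(\<lambda>_. 0) \<in> L2 J"
  by (rule L2_I) (auto simp: supported_in_def)

lemma L2_add:
  assumes "f \<in> L2 J" "g \<in> L2 J"
  shows "(\<lambda>t. f t + g t) \<in> L2 J"
proof (rule L2_I)
  note [measurable] = L2_D(1)[OF assms(1)] L2_D(1)[OF assms(2)]
  show "(\<lambda>t. f t + g t) \<in> borel_measurable borel" by measurable
  show "integrable lborel (\<lambda>t. (norm (f t + g t))\<^sup>2)"
    by (rule Bochner_Integration.integrable_bound[where f = "\<lambda>t. 2 * (norm (f t))\<^sup>2 + 2 * (norm (g t))\<^sup>2"])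
      (auto intro!: Bochner_Integration.integrable_add integrable_mult_right L2_D(2)[OF assms(1)] L2_D(2)[OF assms(2)]
        simp: norm_add_sq_le)
  show "supported_in J (\<lambda>t. f t + g t)" by (intro supported_in_add L2_D(3) assms)
qed

lemma L2_scaleC:
  assumes "f \<in> L2 J"
  shows "(\<lambda>t. c *\<^sub>C f t) \<in> L2 J"
proof (rule L2_I)
  note [measurable] = L2_D(1)[OF assms]
  show "(\<lambda>t. c *\<^sub>C f t) \<in> borel_measurable borel" by measurable
  show "integrable lborel (\<lambda>t. (norm (c *\<^sub>C f t))\<^sup>2)"
    by (simp add: norm_scaleC power_mult_distrib integrable_mult_right L2_D(2)[OF assms])
  show "supported_in J (\<lambda>t. c *\<^sub>C f t)" by (rule supported_in_comp[OF L2_D(3)[OF assms]]) simp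
qed

lemma L2_scaleR: "f \<in> L2 J \<Longrightarrow> (\<lambda>t. r *\<^sub>R f t) \<in> L2 J"
  unfolding scaleR_scaleC by (rule L2_scaleC)

lemma L2_minus: "f \<in> L2 J \<Longrightarrow> (\<lambda>t. - f t) \<in> L2 J"
  using L2_scaleR[of f J "-1"] by simp

lemma L2_diff: "f \<in> L2 J \<Longrightarrow> g \<in> L2 J \<Longrightarrow> (\<lambda>t. f t - g t) \<in> L2 J"
  using L2_add[of f J "\<lambda>t. - g t"] L2_minus[of g J] by simp

lemma L2_proj:
  assumes "f \<in> L2 I" "J \<in> sets borel"
  shows "proj J f \<in> L2 (I \<inter> J)"
proof (rule L2_I)
  note [measurable] = L2_D(1)[OF assms(1)] assms(2)
  show "proj J f \<in> borel_measurable borel" by measurable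
  show "integrable lborel (\<lambda>t. (norm (proj J f t))\<^sup>2)"
    by (rule Bochner_Integration.integrable_bound[OF L2_D(2)[OF assms(1)]])
      (auto simp: proj_def indicator_def)
  show "supported_in (I \<inter> J) (proj J f)"
    using L2_D(3)[OF assms(1)] unfolding supported_in_def proj_def by (auto elim: eventually_mono)
qed

lemma L2_proj': "f \<in> L2 I \<Longrightarrow> J \<in> sets borel \<Longrightarrow> proj J f \<in> L2 J"
  using L2_proj L2_mono by blast

lemma L2_proj'': "f \<in> L2 I \<Longrightarrow> J \<in> sets borel \<Longrightarrow> proj J f \<in> L2 I"
  using L2_proj L2_mono by blast

lemma L2_shift:
  assumes "f \<in> L2 J" "J \<in> sets borel"
  shows "shift t f \<in> L2 {s. t + s \<in> J}"
proof (rule L2_I)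
  note [measurable] = L2_D(1)[OF assms(1)]
  show "shift t f \<in> borel_measurable borel" by measurable
  show "integrable lborel (\<lambda>s. (norm (shift t f s))\<^sup>2)"
    using lborel_integrable_real_affine[OF L2_D(2)[OF assms(1)], of 1 t] by (simp add: shift_def)
  show "supported_in {s. t + s \<in> J} (shift t f)"
    by (rule supported_in_shift[OF L2_D(1)[OF assms(1)] assms(2) L2_D(3)[OF assms(1)]])
qed

lemma L2_norm_sq_nonneg [simp]: "0 \<le> L2_norm_sq f"
  by (simp add: L2_norm_sq_def)

lemma L2_norm_sq_cong:
  assumes "f \<in> borel_measurable borel" "g \<in> borel_measurable borel" "f =\<^sub>a g"
  shows "L2_norm_sq f = L2_norm_sq g"
  unfolding L2_norm_sq_def
  by (rule integral_cong_AE) (use assms in \<open>auto simp: ae_eq_def elim: eventually_mono\<close>)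

lemma L2_norm_sq_eq_0:
  assumes "f \<in> L2 J"
  shows "L2_norm_sq f = 0 \<longleftrightarrow> f =\<^sub>a (\<lambda>_. 0)"
  unfolding L2_norm_sq_def ae_eq_def
  using integral_nonneg_eq_0_iff_AE[OF L2_D(2)[OF assms]] by simp

lemma L2_norm_sq_shift: "L2_norm_sq (shift t f) = L2_norm_sq f"
  unfolding L2_norm_sq_def shift_def
  using lborel_integral_real_affine[of 1 "\<lambda>s. (norm (f s))\<^sup>2" t] by simp

lemma L2_norm_sq_scaleC: "L2_norm_sq (\<lambda>t. c *\<^sub>C f t) = (cmod c)\<^sup>2 * L2_norm_sq f"
  by (simp add: L2_norm_sq_def norm_scaleC power_mult_distrib)

lemma L2_norm_sq_proj_le:
  assumes "f \<in> L2 I" "J \<in> sets borel"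
  shows "L2_norm_sq (proj J f) \<le> L2_norm_sq f"
  unfolding L2_norm_sq_def
  by (rule integral_mono) (use L2_D(2)[OF L2_proj[OF assms]] L2_D(2)[OF assms(1)] in
    \<open>auto simp: proj_def indicator_def\<close>)

lemma L2_norm_sq_proj_Un:
  assumes "proj (A \<union> B) f \<in> L2 UNIV" "A \<inter> B = {}" "A \<in> sets borel" "B \<in> sets borel"
  shows "L2_norm_sq (proj (A \<union> B) f) = L2_norm_sq (proj A f) + L2_norm_sq (proj B f)"
proof -
  have eq: "proj A f = proj A (proj (A \<union> B) f)" "proj B f = proj B (proj (A \<union> B) f)"
    by (auto simp: proj_def indicator_def)
  have "L2_norm_sq (proj (A \<union> B) f) = (LINT t|lborel. (norm (proj A f t))\<^sup>2 + (norm (proj B f t))\<^sup>2)"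
    unfolding L2_norm_sq_def
    by (rule Bochner_Integration.integral_cong) (use assms(2) in \<open>auto simp: proj_def indicator_def\<close>)
  also have "\<dots> = L2_norm_sq (proj A f) + L2_norm_sq (proj B f)"
    unfolding L2_norm_sq_def
    by (rule Bochner_Integration.integral_add)
      (use L2_D(2)[OF L2_proj[OF assms(1)]] assms(3,4) in \<open>auto simp: eq\<close>)
  finally show ?thesis .
qed

lemma integrable_cinner:
  assumes "f \<in> L2 I" "g \<in> L2 J"
  shows "integrable lborel (\<lambda>t. cinner (f t) (g t))"
proof (rule Bochner_Integration.integrable_bound)
  note [measurable] = L2_D(1)[OF assms(1)] L2_D(1)[OF assms(2)]
  show "integrable lborel (\<lambda>t. (norm (f t))\<^sup>2 + (norm (g t))\<^sup>2)"
    by (intro Bochner_Integration.integrable_add L2_D(2)[OF assms(1)] L2_D(2)[OF assms(2)])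
  show "(\<lambda>t. cinner (f t) (g t)) \<in> borel_measurable lborel" by measurable
  have "cmod (cinner x y) \<le> (norm x)\<^sup>2 + (norm y)\<^sup>2" for x y :: 'a
  proof -
    have "2 * (norm x * norm y) \<le> (norm x)\<^sup>2 + (norm y)\<^sup>2"
      using sum_squares_bound[of "norm x" "norm y"] by simp
    moreover have "0 \<le> (norm x)\<^sup>2 + (norm y)\<^sup>2" by simp
    ultimately show ?thesis using norm_cinner_le[of x y] by linarith
  qed
  then show "AE t in lborel. norm (cinner (f t) (g t)) \<le> norm ((norm (f t))\<^sup>2 + (norm (g t))\<^sup>2)"
    by simp
qed

lemma L2_inner_commute: "L2_inner f g = cnj (L2_inner g f)"
  unfolding L2_inner_def by (simp only: Bochner_Integration.integral_cnj[symmetric] cinner_commute[symmetric])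

lemma L2_inner_add_left:
  "f \<in> L2 UNIV \<Longrightarrow> g \<in> L2 UNIV \<Longrightarrow> h \<in> L2 UNIV \<Longrightarrow>
    L2_inner (\<lambda>t. f t + g t) h = L2_inner f h + L2_inner g h"
  unfolding L2_inner_def cinner_add_left by (intro Bochner_Integration.integral_add integrable_cinner)

lemma L2_inner_scaleC_left: "L2_inner (\<lambda>t. c *\<^sub>C f t) g = c * L2_inner f g"
  unfolding L2_inner_def cinner_scaleC_left by simp

lemma L2_inner_self: "L2_inner f f = complex_of_real (L2_norm_sq f)"
  unfolding L2_inner_def cinner_self L2_norm_sq_def by (rule integral_complex_of_real)

lemma L2_inner_cong:
  assumes "f =\<^sub>a f'" "g =\<^sub>a g'" "f \<in> L2 I" "f' \<in> L2 I" "g \<in> L2 J" "g' \<in> L2 J"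
  shows "L2_inner f g = L2_inner f' g'"
  unfolding L2_inner_def
proof (rule integral_cong_AE)
  note [measurable] = L2_D(1)[OF assms(3)] L2_D(1)[OF assms(4)] L2_D(1)[OF assms(5)] L2_D(1)[OF assms(6)]
  show "(\<lambda>t. cinner (f t) (g t)) \<in> borel_measurable lborel" by measurable
  show "(\<lambda>t. cinner (f' t) (g' t)) \<in> borel_measurable lborel" by measurable
  show "AE t in lborel. cinner (f t) (g t) = cinner (f' t) (g' t)"
    using assms(1,2) unfolding ae_eq_def by (auto elim: eventually_elim2)
qed

lemma L2_norm_sq_add:
  assumes "f \<in> L2 UNIV" "g \<in> L2 UNIV"
  shows "L2_norm_sq (\<lambda>t. f t + g t) = L2_norm_sq f + L2_norm_sq g + 2 * Re (L2_inner f g)"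
proof -
  have "L2_norm_sq (\<lambda>t. f t + g t) = (LINT t|lborel. (norm (f t))\<^sup>2 + (norm (g t))\<^sup>2 + 2 * Re (cinner (f t) (g t)))"
    by (simp add: L2_norm_sq_def norm_add_sq)
  also have "\<dots> = L2_norm_sq f + L2_norm_sq g + 2 * (LINT t|lborel. Re (cinner (f t) (g t)))"
    unfolding L2_norm_sq_def
    using integrable_cinner[OF assms] L2_D(2)[OF assms(1)] L2_D(2)[OF assms(2)]
    by (subst Bochner_Integration.integral_add Bochner_Integration.integral_mult_right_zero; simp)+
  also have "(LINT t|lborel. Re (cinner (f t) (g t))) = Re (L2_inner f g)"
    unfolding L2_inner_def using integrable_cinner[OF assms] by (rule integral_Re)
  finally show ?thesis .
qed

lemma ennreal_L2_norm_sq: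
  assumes "f \<in> L2 J"
  shows "(\<integral>\<^sup>+t. ennreal ((norm (f t))\<^sup>2) \<partial>lborel) = ennreal (L2_norm_sq f)"
  unfolding L2_norm_sq_def by (rule nn_integral_eq_integral[OF L2_D(2)[OF assms]]) simp

lemma L2_I_nn_integral:
  assumes [measurable]: "f \<in> borel_measurable borel" and "supported_in J f"
    and le: "(\<integral>\<^sup>+t. ennreal ((norm (f t))\<^sup>2) \<partial>lborel) \<le> ennreal c"
  shows "f \<in> L2 J" "c \<ge> 0 \<Longrightarrow> L2_norm_sq f \<le> c"
proof -
  show f: "f \<in> L2 J"
    by (rule L2_I[OF assms(1) _ assms(2)], rule integrableI_bounded)
      (use le in \<open>auto simp: top.extremum_strict order_le_less_trans[OF _ ennreal_less_top]\<close>)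
  show "c \<ge> 0 \<Longrightarrow> L2_norm_sq f \<le> c" using le unfolding ennreal_L2_norm_sq[OF f] by simp
qed

text \<open>Riesz-Fischer: a rapidly converging subsequence converges almost everywhere, and Fatou's
  lemma turns its pointwise limit into a limit in norm.\<close>

theorem L2_complete:
  fixes f :: "nat \<Rightarrow> real \<Rightarrow> 'k::separable_hilbert_space"
  assumes f: "\<And>n. f n \<in> L2 J"
    and cauchy: "\<And>e. e > 0 \<Longrightarrow> \<exists>N. \<forall>m\<ge>N. \<forall>n\<ge>N. L2_norm_sq (\<lambda>t. f m t - f n t) < e"
  obtains g where "g \<in> L2 J" "(\<lambda>n. L2_norm_sq (\<lambda>t. f n t - g t)) \<longlonglongrightarrow> 0"
proof -
  have [measurable]: "f n \<in> borel_measurable borel" for n using L2_D(1)[OF f] .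
  obtain N where N: "\<And>k m n. m \<ge> N k \<Longrightarrow> n \<ge> N k \<Longrightarrow> L2_norm_sq (\<lambda>t. f m t - f n t) < (1/4) ^ k"
    using cauchy[of "(1/4) ^ k" for k] by (metis zero_less_divide_1_iff zero_less_numeral zero_less_power)
  \<comment> \<open>Monotone indices with \<open>r k \<ge> N k\<close> and
    \<open>r k \<ge> k\<close>.\<close>
  define r where "r k = k + (\<Sum>i\<le>k. N i)" for k
  have rN: "N k \<le> r k" for k unfolding r_def by (rule trans_le_add2, rule member_le_sum) auto
  have r_ge: "k \<le> r k" for k by (simp add: r_def)
  have r_mono: "r k \<le> r l" if "k \<le> l" for k l unfolding r_def using that by (intro add_mono sum_mono2) auto
  define d where "d k t = f (r (Suc k)) t - f (r k) t" for k t
  have d_L2: "d k \<in> L2 J" for k unfolding d_def by (intro L2_diff f)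
  have [measurable]: "d k \<in> borel_measurable borel" for k using L2_D(1)[OF d_L2] .
  have d: "L2_norm_sq (d k) \<le> (1/4) ^ k" for k
    unfolding d_def using N[of k "r (Suc k)" "r k"] rN[of k] r_mono[of k "Suc k"] by fastforce
  \<comment> \<open>The weight \<open>2 ^ k\<close> still leaves a summable series, since the
    increments have squared norm at most \<open>(1/4) ^ k\<close>, and wherever the weighted sum is
    finite it forces geometric decay of the increments.\<close>
  have "(\<integral>\<^sup>+t. (\<Sum>k. ennreal (2 ^ k * (norm (d k t))\<^sup>2)) \<partial>lborel) =
      (\<Sum>k. \<integral>\<^sup>+t. ennreal (2 ^ k) * ennreal ((norm (d k t))\<^sup>2) \<partial>lborel)"
    by (subst nn_integral_suminf) (auto simp: ennreal_mult)
  also have "\<dots> = (\<Sum>k. ennreal (2 ^ k * L2_norm_sq (d k)))"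
    by (subst nn_integral_cmult) (auto simp: ennreal_L2_norm_sq[OF d_L2] ennreal_mult)
  also have "\<dots> \<le> (\<Sum>k. ennreal ((1/2) ^ k))"
  proof (intro suminf_le ennreal_leI)
    fix k show "2 ^ k * L2_norm_sq (d k) \<le> (1/2) ^ k"
      using mult_left_mono[OF d[of k], of "2 ^ k"] by (simp add: power_mult_distrib[symmetric])
  qed auto
  also have "\<dots> = ennreal (\<Sum>k. (1/2) ^ k)"
    by (rule suminf_ennreal2) (auto intro: summable_geometric)
  finally have "(\<integral>\<^sup>+t. (\<Sum>k. ennreal (2 ^ k * (norm (d k t))\<^sup>2)) \<partial>lborel) \<noteq> \<infinity>"
    by (auto simp: top_unique)
  then have AE: "AE t in lborel. (\<Sum>k. ennreal (2 ^ k * (norm (d k t))\<^sup>2)) \<noteq> \<infinity>"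
    by (intro nn_integral_PInf_AE) auto
  define g where "g t = lim (\<lambda>k. f (r k) t)" for t
  have [measurable]: "g \<in> borel_measurable borel" unfolding g_def by measurable
  have conv: "AE t in lborel. (\<lambda>k. f (r k) t) \<longlonglongrightarrow> g t"
    using AE
  proof eventually_elim
    case (elim t)
    then have "(\<Sum>k. ennreal (2 ^ k * (norm (d k t))\<^sup>2)) < top"
      by (simp only: infinity_ennreal_def less_top)
    then obtain C where C: "(\<Sum>k. ennreal (2 ^ k * (norm (d k t))\<^sup>2)) = ennreal C" "C \<ge> 0"
      unfolding less_top_ennreal by blast
    have "norm (d k t) \<le> sqrt C * (1 / sqrt 2) ^ k" for k
    proof -
      have "ennreal (2 ^ k * (norm (d k t))\<^sup>2) \<le> (\<Sum>k. ennreal (2 ^ k * (norm (d k t))\<^sup>2))"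
        by (rule order_trans[OF _ sum_le_suminf[OF summableI, of "{k}"]]) auto
      then have "2 ^ k * (norm (d k t))\<^sup>2 \<le> C" unfolding C(1) by (simp only: ennreal_le_iff[OF C(2)])
      then have "(norm (d k t))\<^sup>2 \<le> C * (1/2) ^ k" by (simp add: power_one_over field_simps)
      also have "\<dots> = (sqrt C * (1 / sqrt 2) ^ k)\<^sup>2"
        using C(2) by (simp add: power_mult_distrib power_divide flip: power_mult)
          (simp add: mult.commute[of k] power_mult)
      finally show ?thesis by (rule power2_le_imp_le) (use C(2) in simp)
    qed
    moreover have "summable (\<lambda>k. sqrt C * (1 / sqrt 2) ^ k)"
      by (intro summable_mult summable_geometric) simp
    ultimately have "summable (\<lambda>k. norm (d k t))"
      by (intro summable_comparison_test[of "\<lambda>k. norm (d k t)" "\<lambda>k. sqrt C * (1 / sqrt 2) ^ k"])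
        (simp_all add: exI[of _ 0])
    then have "summable (\<lambda>k. d k t)" by (rule summable_norm_cancel)
    then have "convergent (\<lambda>k. \<Sum>i<k. d i t)" by (simp add: summable_iff_convergent)
    then have "convergent (\<lambda>k. (\<Sum>i<k. d i t) + f (r 0) t)"
      by (intro convergent_add convergent_const)
    moreover have "(\<Sum>i<k. d i t) + f (r 0) t = f (r k) t" for k
      unfolding d_def using sum_lessThan_telescope[of "\<lambda>k. f (r k) t" k] by simp
    ultimately have "convergent (\<lambda>k. f (r k) t)" by simp
    then show ?case by (simp add: g_def convergent_LIMSEQ_iff)
  qed
  \<comment> \<open>Fatou's lemma along the subsequence. Membership of \<open>g\<close> in
    \<open>L2 UNIV\<close> is a by-product, as \<open>g\<close> differs from some \<open>f M\<close>
    by a square integrable function.\<close>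
  have close: "(\<lambda>t. f n t - g t) \<in> L2 UNIV \<and> L2_norm_sq (\<lambda>t. f n t - g t) \<le> e"
    if "e > 0" and M: "\<forall>m\<ge>M. \<forall>n\<ge>M. L2_norm_sq (\<lambda>t. f m t - f n t) < e" and "n \<ge> M" for e M n
  proof -
    have "(\<integral>\<^sup>+t. ennreal ((norm (f n t - g t))\<^sup>2) \<partial>lborel) =
        (\<integral>\<^sup>+t. liminf (\<lambda>k. ennreal ((norm (f n t - f (r k) t))\<^sup>2)) \<partial>lborel)"
    proof (rule nn_integral_cong_AE, use conv in eventually_elim)
      case (elim t)
      have "(\<lambda>k. ennreal ((norm (f n t - f (r k) t))\<^sup>2)) \<longlonglongrightarrow> ennreal ((norm (f n t - g t))\<^sup>2)"
        by (intro tendsto_ennrealI tendsto_intros elim)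
      then show ?case by (rule lim_imp_Liminf[OF sequentially_bot, symmetric])
    qed
    also have "\<dots> \<le> liminf (\<lambda>k. \<integral>\<^sup>+t. ennreal ((norm (f n t - f (r k) t))\<^sup>2) \<partial>lborel)"
      by (rule nn_integral_liminf) auto
    also have "\<dots> \<le> ennreal e"
    proof (rule Liminf_le)
      have "(\<integral>\<^sup>+t. ennreal ((norm (f n t - f (r k) t))\<^sup>2) \<partial>lborel) \<le> ennreal e" if "k \<ge> M" for k
        unfolding ennreal_L2_norm_sq[OF L2_diff[OF f f]]
        using M \<open>n \<ge> M\<close> order_trans[OF that r_ge] by (intro ennreal_leI less_imp_le) blast
      then show "\<forall>\<^sub>F k in sequentially. (\<integral>\<^sup>+t. ennreal ((norm (f n t - f (r k) t))\<^sup>2) \<partial>lborel) \<le> ennreal e"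
        unfolding eventually_sequentially by blast
    qed simp
    finally show ?thesis
      using L2_I_nn_integral[of "\<lambda>t. f n t - g t" UNIV e] \<open>e > 0\<close> by simp
  qed
  obtain M where "\<forall>m\<ge>M. \<forall>n\<ge>M. L2_norm_sq (\<lambda>t. f m t - f n t) < 1"
    using cauchy[of 1] by auto
  then have "(\<lambda>t. f M t - g t) \<in> L2 UNIV" using close[of 1 M M] by simp
  from L2_diff[OF L2_UNIV[OF f] this, of M] have "g \<in> L2 UNIV" by simp
  moreover have "supported_in J g"
  proof -
    have "AE t in lborel. \<forall>k. t \<notin> J \<longrightarrow> f k t = 0"
      unfolding AE_all_countable using L2_D(3)[OF f] by (simp add: supported_in_def)
    with conv show ?thesis unfolding supported_in_def
    proof eventually_elim
      case (elim t)
      then show ?case by (auto simp: LIMSEQ_const_iff)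
    qed
  qed
  ultimately have "g \<in> L2 J" by (simp add: L2_def)
  moreover have "(\<lambda>n. L2_norm_sq (\<lambda>t. f n t - g t)) \<longlonglongrightarrow> 0"
  proof (rule LIMSEQ_I)
    fix e :: real assume "e > 0"
    then obtain M where "\<forall>m\<ge>M. \<forall>n\<ge>M. L2_norm_sq (\<lambda>t. f m t - f n t) < e / 2"
      using cauchy[of "e / 2"] by auto
    then have "\<forall>n\<ge>M. L2_norm_sq (\<lambda>t. f n t - g t) \<le> e / 2"
      using close[of "e / 2" M] \<open>e > 0\<close> by simp
    then show "\<exists>M. \<forall>n\<ge>M. norm (L2_norm_sq (\<lambda>t. f n t - g t) - 0) < e"
      using \<open>e > 0\<close> by (intro exI[of _ M]) fastforce
  qed
  ultimately show thesis by (rule that)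
qed

subsection \<open>The Hilbert space of classes of square integrable functions\<close>

\<comment> \<open>The relation is partial so that every class has square integrable representatives.
  One type serves all supports: the subspace of functions on \<open>J\<close> appears as the range
  of a projection.\<close>
quotient_type (overloaded) 'k L2_space = "real \<Rightarrow> 'k::separable_hilbert_space" /
  partial: "\<lambda>f g. f \<in> L2 UNIV \<and> g \<in> L2 UNIV \<and> f =\<^sub>a g"
  by (rule part_equivpI) (auto intro!: sympI transpI exI[of _ "\<lambda>_. 0"] intro: ae_eq_sym ae_eq_trans)

instantiation L2_space :: (separable_hilbert_space) ab_group_add
begin

lift_definition zero_L2_space :: "'a L2_space" is "\<lambda>_. 0 :: 'a" by simp

lift_definition plus_L2_space :: "'a L2_space \<Rightarrow> 'a L2_space \<Rightarrow> 'a L2_space"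
  is "\<lambda>f g t. f t + g t :: 'a" by (auto intro: L2_add ae_eq_add)

lift_definition minus_L2_space :: "'a L2_space \<Rightarrow> 'a L2_space \<Rightarrow> 'a L2_space"
  is "\<lambda>f g t. f t - g t :: 'a" by (auto intro: L2_diff ae_eq_diff)

lift_definition uminus_L2_space :: "'a L2_space \<Rightarrow> 'a L2_space"
  is "\<lambda>f t. - f t :: 'a" by (auto intro: L2_minus ae_eq_comp)

instance
proof
  fix a b c :: "'a L2_space"
  show "a + b + c = a + (b + c)" by transfer (simp add: L2_add add.assoc)
  show "a + b = b + a" by transfer (simp add: L2_add add.commute)
  show "0 + a = a" by transfer simp
  show "- a + a = 0" by transfer simp
  show "a - b = a + - b" by transfer (simp add: L2_diff)
qed

end

instantiation L2_space :: (separable_hilbert_space) real_vector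
begin

lift_definition scaleR_L2_space :: "real \<Rightarrow> 'a L2_space \<Rightarrow> 'a L2_space"
  is "\<lambda>r f t. r *\<^sub>R f t :: 'a" by (auto intro: L2_scaleR ae_eq_comp)

instance
proof
  fix a b :: real and x y :: "'a L2_space"
  show "a *\<^sub>R (x + y) = a *\<^sub>R x + a *\<^sub>R y" by transfer (simp add: L2_add L2_scaleR scaleR_add_right)
  show "(a + b) *\<^sub>R x = a *\<^sub>R x + b *\<^sub>R x" by transfer (simp add: L2_add L2_scaleR scaleR_add_left)
  show "a *\<^sub>R b *\<^sub>R x = (a * b) *\<^sub>R x" by transfer (simp add: L2_scaleR)
  show "1 *\<^sub>R x = x" by transfer simp
qed

end

lift_definition L2_space_inner :: "'a::separable_hilbert_space L2_space \<Rightarrow> 'a L2_space \<Rightarrow> complex" is L2_inner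
  by (rule L2_inner_cong[where I = UNIV and J = UNIV]) auto

lift_definition L2_space_scaleC :: "complex \<Rightarrow> 'a::separable_hilbert_space L2_space \<Rightarrow> 'a L2_space"
  is "\<lambda>c f t. c *\<^sub>C f t" by (auto intro: L2_scaleC ae_eq_comp)

lift_definition L2_space_norm_sq :: "'a::separable_hilbert_space L2_space \<Rightarrow> real" is L2_norm_sq
  by (auto intro: L2_norm_sq_cong dest: L2_D(1))

lemma L2_space_scaleR: "r *\<^sub>R x = L2_space_scaleC (complex_of_real r) x"
  by transfer (auto intro: L2_scaleR simp: scaleR_scaleC[symmetric])

lemma L2_space_norm_sq_nonneg [simp]: "0 \<le> L2_space_norm_sq x"
  by transfer simp

lemma L2_space_norm_sq_eq_0: "L2_space_norm_sq x = 0 \<longleftrightarrow> x = 0"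
  by transfer (auto simp: L2_norm_sq_eq_0)

lemma L2_space_norm_sq_add:
  "L2_space_norm_sq (x + y) = L2_space_norm_sq x + L2_space_norm_sq y + 2 * Re (L2_space_inner x y)"
  by transfer (auto simp: L2_norm_sq_add)

lemma L2_space_norm_sq_scaleR: "L2_space_norm_sq (r *\<^sub>R x) = r\<^sup>2 * L2_space_norm_sq x"
  unfolding L2_space_scaleR by transfer (simp add: L2_norm_sq_scaleC)

lemma L2_space_inner_scaleR: "L2_space_inner (r *\<^sub>R x) y = r * L2_space_inner x y"
  unfolding L2_space_scaleR by transfer (simp add: L2_inner_scaleC_left)

lemma L2_space_inner_0_left: "L2_space_inner 0 y = 0"
  by transfer (simp add: L2_inner_def)

lemma L2_space_inner_0_right: "L2_space_inner y 0 = 0"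
  by transfer (simp add: L2_inner_def)

text \<open>Cauchy-Schwarz has to be repeated here: the general version presupposes the Hilbert
  space instance, whose triangle inequality rests on this lemma.\<close>

lemma L2_space_Re_inner_le:
  "Re (L2_space_inner x y) \<le> sqrt (L2_space_norm_sq x) * sqrt (L2_space_norm_sq y)"
proof (cases "x = 0 \<or> y = 0")
  case True
  then have "L2_space_inner x y = 0"
    using L2_space_inner_0_left L2_space_inner_0_right by blast
  then show ?thesis by simp
next
  case False
  define a where "a = sqrt (L2_space_norm_sq x)"
  define b where "b = sqrt (L2_space_norm_sq y)"
  have ab: "a > 0" "b > 0" "L2_space_norm_sq x = a\<^sup>2" "L2_space_norm_sq y = b\<^sup>2"
    using False by (auto simp: a_def b_def L2_space_norm_sq_eq_0 order_less_le)
  \<comment> \<open>The factor \<open>b / a\<close> gives both vectors the same length, so the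
    inequality is read off from a single square.\<close>
  have "0 \<le> L2_space_norm_sq ((- (b / a)) *\<^sub>R x + y)" by simp
  also have "\<dots> = 2 * b\<^sup>2 - 2 * (b / a) * Re (L2_space_inner x y)"
    unfolding L2_space_norm_sq_add L2_space_norm_sq_scaleR L2_space_inner_scaleR
    using ab(1) by (simp add: ab(3,4) power_divide)
  finally have "b / a * Re (L2_space_inner x y) \<le> b * b" by (simp add: power2_eq_square)
  then have "b * (Re (L2_space_inner x y) / a) \<le> b * b" by simp
  then have "Re (L2_space_inner x y) / a \<le> b" using ab(2) by (rule mult_left_le_imp_le)
  then show ?thesis using ab(1) by (simp add: a_def[symmetric] b_def[symmetric] divide_le_eq mult.commute)
qed

instantiation L2_space :: (separable_hilbert_space) real_normed_vector
begin

definition norm_L2_space :: "'a L2_space \<Rightarrow> real"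
  where "norm_L2_space x = sqrt (L2_space_norm_sq x)"

definition dist_L2_space :: "'a L2_space \<Rightarrow> 'a L2_space \<Rightarrow> real"
  where "dist_L2_space x y = norm (x - y)"

definition sgn_L2_space :: "'a L2_space \<Rightarrow> 'a L2_space"
  where "sgn_L2_space x = x /\<^sub>R norm x"

definition uniformity_L2_space :: "('a L2_space \<times> 'a L2_space) filter"
  where "uniformity_L2_space = (INF e\<in>{0<..}. principal {(x, y). dist x y < e})"

definition open_L2_space :: "'a L2_space set \<Rightarrow> bool"
  where "open_L2_space U \<longleftrightarrow> (\<forall>x\<in>U. \<forall>\<^sub>F (x', y) in uniformity. x' = x \<longrightarrow> y \<in> U)"

instance
proof
  fix x y :: "'a L2_space" and a :: real
  show "norm x = 0 \<longleftrightarrow> x = 0" by (simp add: norm_L2_space_def L2_space_norm_sq_eq_0)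
  show "norm (a *\<^sub>R x) = \<bar>a\<bar> * norm x"
    by (simp add: norm_L2_space_def L2_space_norm_sq_scaleR real_sqrt_mult)
  have sq: "L2_space_norm_sq z = (norm z)\<^sup>2" for z :: "'a L2_space"
    by (simp add: norm_L2_space_def)
  have "Re (L2_space_inner x y) \<le> norm x * norm y"
    using L2_space_Re_inner_le[of x y] by (simp only: norm_L2_space_def)
  then have "(norm (x + y))\<^sup>2 \<le> (norm x + norm y)\<^sup>2"
    using L2_space_norm_sq_add[of x y] unfolding sq power2_sum by (simp add: mult.assoc)
  then show "norm (x + y) \<le> norm x + norm y"
    by (rule power2_le_imp_le) (simp add: norm_L2_space_def)
qed (simp_all add: dist_L2_space_def sgn_L2_space_def uniformity_L2_space_def open_L2_space_def)

end

abbreviation L2_class :: "(real \<Rightarrow> 'k::separable_hilbert_space) \<Rightarrow> 'k L2_space"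
  where "L2_class \<equiv> abs_L2_space"

lemma L2_class_cases:
  fixes x :: "'k::separable_hilbert_space L2_space"
  obtains f where "f \<in> L2 UNIV" "x = L2_class f"
  using that[of "rep_L2_space x"] Quotient3_rep_reflp[OF Quotient3_L2_space, of x]
    Quotient3_abs_rep[OF Quotient3_L2_space, of x] by auto

lemma L2_class_eq_iff: "f \<in> L2 UNIV \<Longrightarrow> g \<in> L2 UNIV \<Longrightarrow> L2_class f = L2_class g \<longleftrightarrow> f =\<^sub>a g"
  using Quotient3_rel[OF Quotient3_L2_space, of f g] by auto

lemma L2_class_add: "f \<in> L2 UNIV \<Longrightarrow> g \<in> L2 UNIV \<Longrightarrow> L2_class f + L2_class g = L2_class (\<lambda>t. f t + g t)"
  by (rule plus_L2_space.abs_eq) auto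

lemma L2_class_diff: "f \<in> L2 UNIV \<Longrightarrow> g \<in> L2 UNIV \<Longrightarrow> L2_class f - L2_class g = L2_class (\<lambda>t. f t - g t)"
  by (rule minus_L2_space.abs_eq) auto

lemma norm_L2_class: "f \<in> L2 UNIV \<Longrightarrow> (norm (L2_class f))\<^sup>2 = L2_norm_sq f"
  by (simp add: norm_L2_space_def L2_space_norm_sq.abs_eq)

lemma L2_class_LIMSEQ_iff:
  assumes "\<And>n. f n \<in> L2 UNIV" "g \<in> L2 UNIV"
  shows "(\<lambda>n. L2_class (f n)) \<longlonglongrightarrow> L2_class g \<longleftrightarrow> (\<lambda>n. L2_norm_sq (\<lambda>t. f n t - g t)) \<longlonglongrightarrow> 0"
proof -
  have "L2_norm_sq (\<lambda>t. f n t - g t) = (norm (L2_class (f n) - L2_class g))\<^sup>2" for n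
    by (simp add: L2_class_diff norm_L2_class L2_diff assms)
  then show ?thesis
    unfolding LIM_zero_iff[symmetric, of _ "L2_class g"]
    by (simp add: tendsto_norm_zero_iff[symmetric, of "\<lambda>n. L2_class (f n) - L2_class g"]) 
qed

instance L2_space :: (separable_hilbert_space) banach
proof
  fix X :: "nat \<Rightarrow> 'a L2_space" assume X: "Cauchy X"
  have "\<exists>f. f \<in> L2 UNIV \<and> X n = L2_class f" for n by (metis L2_class_cases)
  then obtain f where f: "\<And>n. f n \<in> L2 UNIV" "\<And>n. X n = L2_class (f n)" by metis
  have "\<exists>N. \<forall>m\<ge>N. \<forall>n\<ge>N. L2_norm_sq (\<lambda>t. f m t - f n t) < e" if "e > 0" for e
  proof -
    have "0 < sqrt e" using that by simp
    from CauchyD[OF X this]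
    obtain N where N: "\<And>m n. m \<ge> N \<Longrightarrow> n \<ge> N \<Longrightarrow> norm (X m - X n) < sqrt e"
      by blast
    have "L2_norm_sq (\<lambda>t. f m t - f n t) < e" if "m \<ge> N" "n \<ge> N" for m n
    proof -
      have "L2_norm_sq (\<lambda>t. f m t - f n t) = (norm (X m - X n))\<^sup>2"
        by (simp add: f L2_class_diff norm_L2_class L2_diff)
      also have "\<dots> < (sqrt e)\<^sup>2" using N[OF that] by (intro power_strict_mono) auto
      finally show ?thesis using \<open>e > 0\<close> by simp
    qed
    then show ?thesis by blast
  qed
  then obtain g where g: "g \<in> L2 UNIV" "(\<lambda>n. L2_norm_sq (\<lambda>t. f n t - g t)) \<longlonglongrightarrow> 0"
    using L2_complete[of f UNIV, OF f(1)] by blast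
  then have "X \<longlonglongrightarrow> L2_class g"
    unfolding f(2) by (subst L2_class_LIMSEQ_iff) (auto intro: f)
  then show "convergent X" by (rule convergentI)
qed

instantiation L2_space :: (separable_hilbert_space) complex_hilbert_space
begin

definition cinner_L2_space :: "'a L2_space \<Rightarrow> 'a L2_space \<Rightarrow> complex"
  where "cinner_L2_space = L2_space_inner"

definition scaleC_L2_space :: "complex \<Rightarrow> 'a L2_space \<Rightarrow> 'a L2_space"
  where "scaleC_L2_space = L2_space_scaleC"

instance
proof
  fix x y z :: "'a L2_space" and c d :: complex and r :: real
  show "c *\<^sub>C (x + y) = c *\<^sub>C x + c *\<^sub>C y" unfolding scaleC_L2_space_def
    by transfer (auto intro: L2_add L2_scaleC simp: scaleC_add_right)
  show "(c + d) *\<^sub>C x = c *\<^sub>C x + d *\<^sub>C x" unfolding scaleC_L2_space_def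
    by transfer (auto intro: L2_add L2_scaleC simp: scaleC_add_left)
  show "c *\<^sub>C d *\<^sub>C x = (c * d) *\<^sub>C x" unfolding scaleC_L2_space_def
    by transfer (auto intro: L2_scaleC simp: scaleC_scaleC)
  show "r *\<^sub>R x = complex_of_real r *\<^sub>C x" unfolding scaleC_L2_space_def
    by (rule L2_space_scaleR)
  show "cinner x y = cnj (cinner y x)" unfolding cinner_L2_space_def
    by transfer (rule L2_inner_commute)
  show "cinner (x + y) z = cinner x z + cinner y z" unfolding cinner_L2_space_def
    by transfer (auto intro: L2_inner_add_left)
  show "cinner (c *\<^sub>C x) y = c * cinner x y" unfolding cinner_L2_space_def scaleC_L2_space_def
    by transfer (rule L2_inner_scaleC_left)
  show "cinner x x = complex_of_real ((norm x)\<^sup>2)" unfolding cinner_L2_space_def norm_L2_space_def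
    by (simp del: of_real_power) (transfer, rule L2_inner_self)
qed

end

lemma L2_class_scaleC: "f \<in> L2 UNIV \<Longrightarrow> c *\<^sub>C L2_class f = L2_class (\<lambda>t. c *\<^sub>C f t)"
  unfolding scaleC_L2_space_def by (rule L2_space_scaleC.abs_eq) auto

lemma cinner_L2_class: "f \<in> L2 UNIV \<Longrightarrow> g \<in> L2 UNIV \<Longrightarrow> cinner (L2_class f) (L2_class g) = L2_inner f g"
  unfolding cinner_L2_space_def by (rule L2_space_inner.abs_eq) auto

section \<open>The growth bound of a semigroup\<close>

text \<open>Sokal's gliding hump: one of \<open>T (x + h)\<close>, \<open>T (x - h)\<close> is at least as long as \<open>T h\<close>.\<close>

lemma uniform_boundedness_sequence:
  fixes T :: "nat \<Rightarrow> ('a::banach \<Rightarrow>\<^sub>L 'b::real_normed_vector)"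
  assumes T: "\<And>n. norm (T n) > 4 ^ n"
  obtains x where "\<And>M. \<exists>n. norm (blinfun_apply (T n) x) > M"
proof -
  \<comment> \<open>The constants: \<open>2/3\<close> is any factor below 1, since the operator norm
    need not be attained. Later steps have lengths \<open>(1/3) ^ (n + 1)\<close>,
    \<open>(1/3) ^ (n + 2)\<close> and so on, moving the point by at most
    \<open>1/2 * (1/3) ^ n\<close> in total. Hence \<open>2/3 - 1/2 = 1/6\<close> survives, and
    against norms above \<open>4 ^ n\<close> this grows like \<open>(4/3) ^ n\<close>.\<close>
  have step: "\<exists>x'. norm (x' - x) \<le> (1/3) ^ n \<and> norm (blinfun_apply (T n) x') \<ge> 2/3 * (1/3) ^ n * norm (T n)" for n x
  proof -
    have pos: "0 < norm (T n)" using T[of n] by (meson less_trans zero_less_numeral zero_less_power)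
    have "\<not> (\<forall>h. norm (blinfun_apply (T n) h) \<le> 2/3 * norm (T n) * norm h)"
    proof
      assume "\<forall>h. norm (blinfun_apply (T n) h) \<le> 2/3 * norm (T n) * norm h"
      then have "norm (T n) \<le> 2/3 * norm (T n)" using pos by (intro norm_blinfun_bound) auto
      then show False using pos by simp
    qed
    then obtain h where h: "norm (blinfun_apply (T n) h) > 2/3 * norm (T n) * norm h" by (auto simp: not_le)
    then have "h \<noteq> 0" by auto
    define k where "k = ((1/3) ^ n / norm h) *\<^sub>R h"
    have k: "norm k = (1/3) ^ n" using \<open>h \<noteq> 0\<close> by (simp add: k_def)
    have "norm (blinfun_apply (T n) k) = (1/3) ^ n / norm h * norm (blinfun_apply (T n) h)"
      by (simp add: k_def blinfun.scaleR_right)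
    moreover have "2/3 * (1/3) ^ n * norm (T n) \<le> (1/3) ^ n / norm h * norm (blinfun_apply (T n) h)"
      using h \<open>h \<noteq> 0\<close> by (simp add: field_simps)
    ultimately have Tk: "norm (blinfun_apply (T n) k) \<ge> 2/3 * (1/3) ^ n * norm (T n)" by simp
    have "2 * norm (blinfun_apply (T n) k) = norm (blinfun_apply (T n) (x + k) - blinfun_apply (T n) (x - k))"
      by (simp add: blinfun.add_right blinfun.diff_right flip: scaleR_2)
    also have "\<dots> \<le> norm (blinfun_apply (T n) (x + k)) + norm (blinfun_apply (T n) (x - k))"
      by (rule norm_triangle_ineq4)
    finally have "norm (blinfun_apply (T n) k) \<le> norm (blinfun_apply (T n) (x + k)) \<or>
        norm (blinfun_apply (T n) k) \<le> norm (blinfun_apply (T n) (x - k))" by linarith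
    then show ?thesis
    proof
      assume "norm (blinfun_apply (T n) k) \<le> norm (blinfun_apply (T n) (x + k))"
      with Tk k show ?thesis by (intro exI[of _ "x + k"]) auto
    next
      assume "norm (blinfun_apply (T n) k) \<le> norm (blinfun_apply (T n) (x - k))"
      with Tk k show ?thesis by (intro exI[of _ "x - k"]) auto
    qed
  qed
  obtain X where X: "\<And>n. norm (blinfun_apply (T n) (X n)) \<ge> 2/3 * (1/3) ^ n * norm (T n)"
    "\<And>n. norm (X (Suc n) - X n) \<le> (1/3) ^ Suc n"
    using dependent_nat_choice[of "\<lambda>n x. norm (blinfun_apply (T n) x) \<ge> 2/3 * (1/3) ^ n * norm (T n)"
      "\<lambda>n x y. norm (y - x) \<le> (1/3) ^ Suc n"] step[of 0 0] step by metis
  have sm: "summable (\<lambda>n. (1/3::real) ^ Suc n)"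
    by (simp add: summable_geometric summable_mult)
  then have "summable (\<lambda>n. X (Suc n) - X n)"
    by (rule summable_comparison_test'[where N = 0]) (rule X(2))
  then have sums: "summable (\<lambda>i. X (Suc (i + n)) - X (i + n))" for n
    using summable_iff_shift[of "\<lambda>n. X (Suc n) - X n" n] by simp
  define x where "x = (\<Sum>i. X (Suc i) - X i) + X 0"
  have tail: "x - X n = (\<Sum>i. X (Suc (i + n)) - X (i + n))" for n
  proof -
    have "(\<Sum>i. X (Suc i) - X i) = (\<Sum>i. X (Suc (i + n)) - X (i + n)) + (\<Sum>i<n. X (Suc i) - X i)"
      using suminf_split_initial_segment[of "\<lambda>i. X (Suc i) - X i" n] sums[of 0] by simp
    then show ?thesis using sum_lessThan_telescope[of X n] by (simp add: x_def)
  qed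
  have close: "norm (x - X n) \<le> 1/2 * (1/3) ^ n" for n
  proof -
    have "norm (x - X n) \<le> (\<Sum>i. (1/3) ^ Suc (i + n))"
      unfolding tail using summable_ignore_initial_segment[OF sm, of n]
      by (intro norm_suminf_le X(2)) simp
    also have "(\<Sum>i. (1/3::real) ^ Suc (i + n)) = (\<Sum>i. (1/3) ^ Suc n * (1/3) ^ i)"
      by (simp add: power_add mult_ac)
    also have "\<dots> = 1/2 * (1/3) ^ n"
      by (subst suminf_mult) (auto simp: suminf_geometric summable_geometric)
    finally show ?thesis .
  qed
  have lower: "norm (blinfun_apply (T n) x) \<ge> 1/6 * (4/3) ^ n" for n
  proof -
    have "blinfun_apply (T n) (X n) = blinfun_apply (T n) x - blinfun_apply (T n) (x - X n)"
      by (simp add: blinfun.diff_right)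
    then have "norm (blinfun_apply (T n) (X n)) \<le> norm (blinfun_apply (T n) x) + norm (blinfun_apply (T n) (x - X n))"
      using norm_triangle_ineq4 by metis
    moreover have "norm (blinfun_apply (T n) (x - X n)) \<le> norm (T n) * (1/2 * (1/3) ^ n)"
      by (rule order_trans[OF norm_blinfun mult_left_mono[OF close]]) simp
    ultimately have "norm (blinfun_apply (T n) x) \<ge> 1/6 * (1/3) ^ n * norm (T n)"
      using X(1)[of n] by (simp add: algebra_simps)
    moreover have "1/6 * (1/3) ^ n * norm (T n) \<ge> 1/6 * (1/3) ^ n * 4 ^ n"
      using less_imp_le[OF T[of n]] by (intro mult_left_mono) auto
    moreover have "(1/3::real) ^ n * 4 ^ n = (4/3) ^ n" by (simp flip: power_mult_distrib)
    ultimately show ?thesis by (simp add: mult.assoc)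
  qed
  show thesis
  proof (rule that)
    fix M
    obtain n where "(4/3::real) ^ n > 6 * M" using real_arch_pow[of "4/3" "6 * M"] by auto
    then show "\<exists>n. norm (blinfun_apply (T n) x) > M" using lower[of n] by (intro exI[of _ n]) linarith
  qed
qed

text \<open>If the norms were unbounded near 0, times tending to 0 with norms above
  \<open>4 ^ n\<close> would give an unbounded orbit, against strong continuity at 0. The semigroup
  law spreads the local bound over any bounded interval.\<close>

lemma C0_semigroup_norm_bounded:
  assumes A: "C0_semigroup A"
  obtains M where "M \<ge> 1" "\<And>t. 0 \<le> t \<Longrightarrow> t \<le> T \<Longrightarrow> norm (A t) \<le> M"
proof -
  have mult: "norm (A (s + t)) \<le> norm (A s) * norm (A t)" if "s \<ge> 0" "t \<ge> 0" for s t
    using A that norm_blinfun_compose[of "A s" "A t"] by (auto simp: C0_semigroup_def)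
  have "\<exists>d>0. \<exists>M. \<forall>t. 0 \<le> t \<longrightarrow> t \<le> d \<longrightarrow> norm (A t) \<le> M"
  proof (rule ccontr)
    assume "\<not> (\<exists>d>0. \<exists>M. \<forall>t. 0 \<le> t \<longrightarrow> t \<le> d \<longrightarrow> norm (A t) \<le> M)"
    then have "\<exists>t. 0 \<le> t \<and> t \<le> 1 / Suc n \<and> norm (A t) > 4 ^ n" for n
      by (force simp: not_le)
    then obtain t where t: "\<And>n. 0 \<le> t n" "\<And>n. t n \<le> 1 / Suc n" "\<And>n. norm (A (t n)) > 4 ^ n" by metis
    \<comment> \<open>Strong continuity is a limit from the right, so the sequence must avoid 0
      itself.\<close>
    have "t n \<noteq> 0" for n
    proof
      assume "t n = 0"
      then have "norm (A (t n)) \<le> 1"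
        using A norm_blinfun_id_le by (auto simp: C0_semigroup_def)
      also have "1 \<le> (4::real) ^ n" by simp
      finally show False using t(3)[of n] by simp
    qed
    then have tpos: "t n > 0" for n using t(1)[of n] by (simp add: order_less_le)
    have "t \<longlonglongrightarrow> 0"
      by (rule tendsto_sandwich[OF _ _ tendsto_const LIMSEQ_Suc[OF lim_1_over_n]])
        (use t in \<open>auto simp del: of_nat_Suc intro!: always_eventually\<close>)
    then have lim: "filterlim t (at_right 0) sequentially"
      by (rule tendsto_imp_filterlim_at_right) (auto simp: tpos)
    obtain x where x: "\<And>M. \<exists>n. norm (blinfun_apply (A (t n)) x) > M"
      using uniform_boundedness_sequence[of "\<lambda>n. A (t n)", OF t(3)] by blast
    have "((\<lambda>t. blinfun_apply (A t) x) \<longlongrightarrow> x) (at_right 0)"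
      using A by (simp add: C0_semigroup_def)
    from filterlim_compose[OF this lim] have "Bseq (\<lambda>n. blinfun_apply (A (t n)) x)"
      using convergent_imp_Bseq convergentI by blast
    then obtain M where "\<And>n. norm (blinfun_apply (A (t n)) x) \<le> M" by (auto simp: Bseq_def)
    with x[of M] show False by (meson not_le)
  qed
  then obtain d M0 where d: "d > 0" "\<And>t. 0 \<le> t \<Longrightarrow> t \<le> d \<Longrightarrow> norm (A t) \<le> M0" by blast
  define M where "M = max 1 M0"
  have M: "M \<ge> 1" "\<And>t. 0 \<le> t \<Longrightarrow> t \<le> d \<Longrightarrow> norm (A t) \<le> M" using d by (auto simp: M_def le_max_iff_disj)
  have bound: "norm (A t) \<le> M ^ Suc n" if "0 \<le> t" "t \<le> real n * d + d" for n t
    using that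
  proof (induction n arbitrary: t)
    case 0
    then show ?case using M(2) by simp
  next
    case (Suc n)
    show ?case
    proof (cases "t \<le> d")
      case True
      have "norm (A t) \<le> M" using Suc(2) True by (rule M(2))
      also have "\<dots> \<le> M ^ Suc (Suc n)" using M(1) by (rule self_le_power) simp
      finally show ?thesis .
    next
      case False
      have "norm (A t) = norm (A (d + (t - d)))" by simp
      also have "\<dots> \<le> norm (A d) * norm (A (t - d))" using False d(1) by (intro mult) auto
      also have "\<dots> \<le> M * M ^ Suc n"
      proof (rule mult_mono)
        show "norm (A (t - d)) \<le> M ^ Suc n" using False Suc(3) by (intro Suc.IH) (auto simp: algebra_simps)
      qed (use M d(1) in auto)
      finally show ?thesis by simp
    qed
  qed
  obtain n where n: "T / d < real n" using reals_Archimedean2 by blast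
  show thesis
  proof (rule that)
    show "1 \<le> M ^ Suc n" using M(1) by (rule one_le_power)
    fix t assume "0 \<le> t" "t \<le> T"
    moreover have "T \<le> real n * d + d" using n d(1) by (simp add: field_simps)
    ultimately show "norm (A t) \<le> M ^ Suc n" by (intro bound) auto
  qed
qed

text \<open>Fekete's lemma for \<open>ln \<parallel>A t\<parallel>\<close>.\<close>

lemma growth_bound_less_top:
  assumes A: "C0_semigroup A"
  shows "growth_bound A < \<infinity>"
proof (cases "\<exists>t\<ge>0. norm (A t) = 0")
  case True
  then obtain t0 where t0: "t0 \<ge> 0" "A t0 = 0" by auto
  have "A t = 0" if "t \<ge> t0" for t
  proof -
    have "A t = A ((t - t0) + t0)" by simp
    also have "\<dots> = A (t - t0) o\<^sub>L A t0"
      using A that t0(1) by (simp only: C0_semigroup_def)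
    also have "\<dots> = 0" using t0(2) by (simp add: blinfun_eqI)
    finally show ?thesis .
  qed
  then have "eventually (\<lambda>t. (if norm (A t) = 0 then - \<infinity> else ereal (ln (norm (A t)) / t)) = - \<infinity>) at_top"
    by (auto simp: eventually_at_top_linorder)
  then have "((\<lambda>t. if norm (A t) = 0 then - \<infinity> else ereal (ln (norm (A t)) / t)) \<longlongrightarrow> - \<infinity>) at_top"
    by (rule tendsto_eventually)
  then have "growth_bound A = - \<infinity>" unfolding growth_bound_def by (intro tendsto_Lim) auto
  then show ?thesis by simp
next
  case False
  then have pos: "norm (A t) > 0" if "t \<ge> 0" for t using that by auto
  have mult: "norm (A (s + t)) \<le> norm (A s) * norm (A t)" if "s \<ge> 0" "t \<ge> 0" for s t
    using A that norm_blinfun_compose[of "A s" "A t"] by (auto simp: C0_semigroup_def)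
  define f where "f t = ln (norm (A t))" for t
  have f_add: "f (s + t) \<le> f s + f t" if "s \<ge> 0" "t \<ge> 0" for s t
  proof -
    have "ln (norm (A (s + t))) \<le> ln (norm (A s) * norm (A t))"
      using mult[OF that] pos that by (intro ln_mono) auto
    then show ?thesis using pos that by (simp add: f_def ln_mult)
  qed
  have f_mult: "f (real n * s + t) \<le> real n * f s + f t" if "s \<ge> 0" "t \<ge> 0" for n s t
  proof (induction n)
    case (Suc n)
    have "f (real (Suc n) * s + t) = f (s + (real n * s + t))" by (simp add: algebra_simps)
    also have "\<dots> \<le> f s + f (real n * s + t)" using that by (intro f_add) auto
    finally show ?case using Suc by (simp add: algebra_simps)
  qed simp
  define L where "L = (INF t\<in>{0<..}. ereal (f t / t))"
  have L_le: "L \<le> ereal (f t / t)" if "t > 0" for t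
    unfolding L_def using that by (intro INF_lower) auto
  \<comment> \<open>\<open>growth_bound\<close> is defined through \<open>Lim\<close>, which says
    nothing until convergence is known; the limit is the infimum \<open>L\<close>, possibly minus
    infinity.\<close>
  have "((\<lambda>t. ereal (f t / t)) \<longlongrightarrow> L) at_top"
  proof (rule order_tendstoI)
    fix a assume "a < L"
    then have "a < ereal (f t / t)" if "t > 0" for t using L_le[OF that] by (rule less_le_trans)
    then show "\<forall>\<^sub>F t in at_top. a < ereal (f t / t)"
      by (intro eventually_mono[OF eventually_gt_at_top[of 0]]) auto
  next
    fix a assume "L < a"
    then obtain s where s: "s > 0" "ereal (f s / s) < a" unfolding L_def by (auto simp: INF_less_iff)
    then obtain b where b: "f s / s < b" "ereal b < a"
      using ereal_dense2 by (metis less_ereal.simps(1))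
    obtain M where M: "M \<ge> 1" "\<And>t. 0 \<le> t \<Longrightarrow> t \<le> s \<Longrightarrow> norm (A t) \<le> M"
      using C0_semigroup_norm_bounded[OF A] by blast
    define C where "C = \<bar>f s\<bar> + ln M"
    have est: "f t / t \<le> f s / s + C / t" if "t > 0" for t
    proof -
      \<comment> \<open>Write \<open>t = n * s + r\<close> with \<open>0 \<le> r \<le> s\<close>:
        subadditivity handles the multiple of \<open>s\<close>, the local bound \<open>M\<close> the
        remainder.\<close>
      define n where "n = nat \<lfloor>t / s\<rfloor>"
      have n: "real n \<le> t / s" "t / s \<le> real n + 1"
        using s(1) that by (auto simp: n_def intro: less_imp_le) 
      define r where "r = t - real n * s"
      have r: "0 \<le> r" "r \<le> s" using n s(1) by (auto simp: r_def field_simps)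
      have fr: "f r \<le> ln M" unfolding f_def using M(2)[OF r] pos[OF r(1)] by (intro ln_mono) auto
      have "f t = f (real n * s + r)" by (simp add: r_def)
      moreover have "f (real n * s + r) \<le> real n * f s + f r" using f_mult[of s r n] s(1) r(1) by simp
      moreover have "real n * f s = t / s * f s - r / s * f s" using s(1) by (simp add: r_def field_simps)
      moreover have "- (r / s * f s) \<le> \<bar>f s\<bar>"
      proof -
        have "\<bar>r / s * f s\<bar> \<le> 1 * \<bar>f s\<bar>"
          unfolding abs_mult using r s(1) by (intro mult_right_mono) auto
        then show ?thesis by linarith
      qed
      ultimately have "f t \<le> t / s * f s + C" using fr unfolding C_def by linarith
      then show ?thesis using that by (simp add: field_simps)
    qed
    have "((\<lambda>t. f s / s + C / t) \<longlongrightarrow> f s / s + 0) at_top"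
      by (intro tendsto_add tendsto_const real_tendsto_divide_at_top[OF tendsto_const filterlim_ident])
    then have "eventually (\<lambda>t. f s / s + C / t < b) at_top"
      using b(1) by (intro order_tendstoD(2)) auto
    then show "\<forall>\<^sub>F t in at_top. ereal (f t / t) < a"
      using eventually_gt_at_top[of 0]
    proof eventually_elim
      case (elim t)
      then have "f t / t < b" using est[of t] by linarith
      then show ?case using b(2) by (meson less_ereal.simps(1) less_trans)
    qed
  qed
  moreover have "eventually (\<lambda>t. ereal (f t / t) = (if norm (A t) = 0 then - \<infinity> else ereal (ln (norm (A t)) / t))) at_top"
    using eventually_ge_at_top[of 0] by eventually_elim (use pos in \<open>auto simp: f_def\<close>)
  ultimately have "((\<lambda>t. if norm (A t) = 0 then - \<infinity> else ereal (ln (norm (A t)) / t)) \<longlongrightarrow> L) at_top"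
    by (rule Lim_transform_eventually)
  then have "growth_bound A = L" unfolding growth_bound_def by (intro tendsto_Lim) auto
  also have "L \<le> ereal (f 1 / 1)" by (rule L_le) simp
  also have "\<dots> < \<infinity>" by simp
  finally show ?thesis .
qed

section \<open>A Pick inequality for Schur functions\<close>

text \<open>On the circle \<open>dz / (2 * pi * i)\<close> is \<open>z dt\<close>, so Cauchy's
  formula becomes a mean against \<open>z / (z - w)\<close>, the conjugate of a Szego
  kernel.\<close>

lemma circle_mean_Cauchy:
  assumes f: "f holomorphic_on cball 0 r" and w: "norm w < r"
  shows "((\<lambda>t. f (circlepath 0 r t) * (circlepath 0 r t / (circlepath 0 r t - w))) has_integral f w) {0..1}"
proof -
  have "((\<lambda>u. f u / (u - w)) has_contour_integral (2 * of_real pi * \<i> * f w)) (circlepath 0 r)"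
    by (rule Cauchy_integral_circlepath_simple[OF f]) (use w in simp)
  then have "((\<lambda>t. f (circlepath 0 r t) / (circlepath 0 r t - w) *
      vector_derivative (circlepath 0 r) (at t within {0..1})) has_integral (2 * of_real pi * \<i> * f w)) {0..1}"
    by (simp add: has_contour_integral_def)
  then have "((\<lambda>t. (2 * of_real pi * \<i>) * (f (circlepath 0 r t) * (circlepath 0 r t / (circlepath 0 r t - w))))
      has_integral (2 * of_real pi * \<i>) * f w) {0..1}"
  proof (rule has_integral_eq[rotated])
    fix t :: real assume "t \<in> {0..1}"
    then show "f (circlepath 0 r t) / (circlepath 0 r t - w) * vector_derivative (circlepath 0 r) (at t within {0..1}) =
        2 * of_real pi * \<i> * (f (circlepath 0 r t) * (circlepath 0 r t / (circlepath 0 r t - w)))"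
      by (simp add: vector_derivative_circlepath01) (simp add: circlepath)
  qed
  from has_integral_mult_right[OF this, of "inverse (2 * of_real pi * \<i>)"] show ?thesis
    by (simp add: field_simps)
qed

lemma norm_circlepath: "r > 0 \<Longrightarrow> norm (circlepath 0 r t) = r"
  by (simp add: circlepath norm_mult)

text \<open>Pairing with fixed vectors reduces operator-valued analyticity to scalar functions, for
  which Cauchy's formula is at hand.\<close>

lemma holomorphic_on_cinner_operator:
  assumes F: "operator_analytic_on F S"
  shows "(\<lambda>z. cinner (blinfun_apply (F z) u) y) holomorphic_on S"
proof (rule holomorphic_onI)
  fix z assume "z \<in> S"
  then obtain D where D: "(F has_derivative D) (at z)" "\<And>c h u. blinfun_apply (D (c * h)) u = c *\<^sub>C blinfun_apply (D h) u"
    using F unfolding operator_analytic_on_def by blast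
  have "bounded_linear (\<lambda>T. cinner (blinfun_apply T u) y)"
    by (rule bounded_linear_compose[OF bounded_bilinear.bounded_linear_left[OF bounded_bilinear_cinner]
          blinfun.bounded_linear_left])
  from bounded_linear.has_derivative[OF this D(1)]
  have "((\<lambda>z. cinner (blinfun_apply (F z) u) y) has_derivative (\<lambda>h. cinner (blinfun_apply (D h) u) y)) (at z)" .
  moreover have "(\<lambda>h. cinner (blinfun_apply (D h) u) y) = (*) (cinner (blinfun_apply (D 1) u) y)"
  proof
    fix h
    have "blinfun_apply (D h) u = h *\<^sub>C blinfun_apply (D 1) u" using D(2)[of h 1] by simp
    then show "cinner (blinfun_apply (D h) u) y = cinner (blinfun_apply (D 1) u) y * h"
      by (simp only: cinner_scaleC_left mult.commute)
  qed
  ultimately show "(\<lambda>z. cinner (blinfun_apply (F z) u) y) field_differentiable at z within S"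
    by (auto simp: field_differentiable_def has_field_derivative_def intro: has_derivative_at_withinI)
qed

lemma norm_sq_sum:
  fixes a :: "'i \<Rightarrow> complex" and u :: "'i \<Rightarrow> 'u::complex_hilbert_space"
  shows "complex_of_real ((norm (\<Sum>i\<in>I. a i *\<^sub>C u i))\<^sup>2) = (\<Sum>i\<in>I. \<Sum>j\<in>I. a i * cnj (a j) * cinner (u i) (u j))"
  unfolding cinner_self[symmetric] cinner_sum_left
  by (simp add: cinner_sum_right cinner_scaleC_left cinner_scaleC_right sum_distrib_left mult_ac)

text \<open>
  Both sides are means over the circle of radius \<open>r < 1\<close>: of \<open>\<langle>\<Phi> p, k\<rangle>\<close>, \<open>\<parallel>p\<parallel>\<^sup>2\<close> and \<open>\<parallel>k\<parallel>\<^sup>2\<close>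
  with \<open>p = \<Sum> u\<^sub>j / (1 - v\<^sub>j w)\<close> and the Szego kernel \<open>k = \<Sum> y\<^sub>i / (1 - v\<^sub>i w / r\<^sup>2)\<close>.
\<close>

lemma pick_inequality_disc_radius:
  fixes \<Phi> :: "complex \<Rightarrow> ('u::complex_hilbert_space \<Rightarrow>\<^sub>L 'y::complex_hilbert_space)"
    and v :: "'i \<Rightarrow> real"
  assumes hol: "\<And>u y. (\<lambda>w. cinner (blinfun_apply (\<Phi> w) u) y) holomorphic_on ball 0 1"
    and lin: "\<And>w. norm w < 1 \<Longrightarrow> complex_homogeneous (\<Phi> w)"
    and contr: "\<And>w. norm w < 1 \<Longrightarrow> norm (\<Phi> w) \<le> 1"
    and I: "finite I" and v: "\<And>i. i \<in> I \<Longrightarrow> \<bar>v i\<bar> < r" and r: "0 < r" "r < 1"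
  shows "2 * Re (\<Sum>i\<in>I. \<Sum>j\<in>I. cinner (blinfun_apply (\<Phi> (v i)) (u j)) (y i) / (1 - v j * v i)) \<le>
    Re (\<Sum>i\<in>I. \<Sum>j\<in>I. cinner (u i) (u j) / (1 - v i * (v j * r\<^sup>2))) +
    Re (\<Sum>i\<in>I. \<Sum>j\<in>I. cinner (y i) (y j) / (1 - v i * v j / r\<^sup>2))"
proof -
  define c where "c = circlepath 0 r"
  have c: "norm (c t) = r" for t using r by (simp add: c_def norm_circlepath)
  have c1: "norm (c t) < 1" for t using c r by simp
  have c0: "c t \<noteq> 0" for t using c[of t] r by auto
  \<comment> \<open>On the circle conjugation is the rational map
    \<open>z \<mapsto> r\<^sup>2 / z\<close>, which turns conjugated kernels into Cauchy
    kernels.\<close>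
  have cnj_c: "cnj (c t) = r\<^sup>2 / c t" for t
    using c0[of t] complex_norm_square[of "c t"] c[of t] by (simp add: field_simps)
  have mean: "((\<lambda>t. f (c t) * (c t / (c t - w))) has_integral f w) {0..1}"
    if "f holomorphic_on cball 0 r" "norm w < r" for f w
    unfolding c_def by (rule circle_mean_Cauchy) fact+
  have v1: "\<bar>v i\<bar> < 1" if "i \<in> I" for i using v[OF that] r by simp
  have nz: "1 - v i * w \<noteq> 0" if "i \<in> I" "norm w \<le> 1" for i and w :: complex
  proof
    assume "1 - v i * w = 0"
    then have "1 = norm (v i * w)" by (metis eq_iff_diff_eq_0 norm_one)
    also have "\<dots> \<le> \<bar>v i\<bar> * 1" unfolding norm_mult using that(2) by (intro mult_mono) auto
    finally show False using v1[OF that(1)] by simp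
  qed
  \<comment> \<open>The kernel at \<open>v i\<close> has its pole at \<open>r\<^sup>2 / v i\<close>,
    outside the closed disc of radius \<open>r\<close> exactly because
    \<open>\<bar>v i\<bar> < r\<close>.\<close>
  have nz': "1 - v i * w / r\<^sup>2 \<noteq> 0" if "i \<in> I" "norm w \<le> r" for i and w :: complex
  proof
    assume "1 - v i * w / r\<^sup>2 = 0"
    then have "1 = norm (v i * w / r\<^sup>2)" by (metis eq_iff_diff_eq_0 norm_one)
    also have "\<dots> = \<bar>v i\<bar> * norm w / r\<^sup>2" by (simp add: norm_mult norm_divide norm_power)
    finally have "r * r = \<bar>v i\<bar> * norm w" using r by (simp add: field_simps power2_eq_square)
    also have "\<dots> \<le> \<bar>v i\<bar> * r" using that(2) by (intro mult_left_mono) auto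
    also have "\<dots> < r * r" using v[OF that(1)] r by (intro mult_strict_right_mono)
    finally show False by simp
  qed
  have nzc: "c t - v i \<noteq> 0" if "i \<in> I" for i t
    using c[of t] v[OF that] by (metis abs_norm_cancel eq_iff_diff_eq_0 less_irrefl norm_of_real)
  \<comment> \<open>Both are sums of kernels. Conjugated on the circle, a summand of
    \<open>k\<close> reproduces values at \<open>v i\<close>, and a summand of \<open>p\<close>
    reproduces values at \<open>v j * r\<^sup>2\<close>; this explains the three different
    denominators in the claim.\<close>
  define p where "p w = (\<Sum>j\<in>I. (1 / (1 - v j * w)) *\<^sub>C u j)" for w :: complex
  define k where "k t = (\<Sum>i\<in>I. (1 / (1 - v i * c t / r\<^sup>2)) *\<^sub>C y i)" for t
  have cnj_k: "cnj (1 / (1 - v i * c t / r\<^sup>2)) = c t / (c t - v i)" if "i \<in> I" for i t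
    using c0[of t] nzc[OF that, of t] r by (simp add: cnj_c field_simps)
  have cnj_p: "cnj (1 / (1 - v j * c t)) = c t / (c t - v j * r\<^sup>2)" for j t
    using c0[of t] by (simp add: cnj_c divide_simps mult.commute)
  have Phi_p: "cinner (blinfun_apply (\<Phi> w) (p w)) z = (\<Sum>j\<in>I. cinner (blinfun_apply (\<Phi> w) (u j)) z / (1 - v j * w))"
    if "norm w < 1" for w :: complex and z
    using lin[OF that] by (simp add: p_def blinfun.sum_right cinner_sum_left complex_homogeneous_def cinner_scaleC_left)
  have hol_p: "(\<lambda>w. \<Sum>j\<in>I. cinner (blinfun_apply (\<Phi> w) (u j)) z / (1 - v j * w)) holomorphic_on cball 0 r" for z
    using r nz by (intro holomorphic_intros holomorphic_on_subset[OF hol]) auto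
  have int1: "((\<lambda>t. cinner (blinfun_apply (\<Phi> (c t)) (p (c t))) (k t)) has_integral
      (\<Sum>i\<in>I. \<Sum>j\<in>I. cinner (blinfun_apply (\<Phi> (v i)) (u j)) (y i) / (1 - v j * v i))) {0..1}"
  proof -
    have "((\<lambda>t. \<Sum>i\<in>I. (\<Sum>j\<in>I. cinner (blinfun_apply (\<Phi> (c t)) (u j)) (y i) / (1 - v j * c t)) * (c t / (c t - v i))) has_integral
      (\<Sum>i\<in>I. \<Sum>j\<in>I. cinner (blinfun_apply (\<Phi> (v i)) (u j)) (y i) / (1 - v j * v i))) {0..1}"
    proof (rule has_integral_sum[OF I])
      fix i assume "i \<in> I"
      then show "((\<lambda>t. (\<Sum>j\<in>I. cinner (blinfun_apply (\<Phi> (c t)) (u j)) (y i) / (1 - v j * c t)) * (c t / (c t - v i))) has_integral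
          (\<Sum>j\<in>I. cinner (blinfun_apply (\<Phi> (v i)) (u j)) (y i) / (1 - v j * v i))) {0..1}"
        using mean[OF hol_p[of "y i"], of "complex_of_real (v i)"] v by simp
    qed
    moreover have "cinner (blinfun_apply (\<Phi> (c t)) (p (c t))) (k t) =
       (\<Sum>i\<in>I. (\<Sum>j\<in>I. cinner (blinfun_apply (\<Phi> (c t)) (u j)) (y i) / (1 - v j * c t)) * (c t / (c t - v i)))" for t
      unfolding k_def cinner_sum_right cinner_scaleC_right Phi_p[OF c1]
      by (intro sum.cong refl, subst cnj_k, assumption, rule mult.commute)
    ultimately show ?thesis by simp
  qed
  have int2: "((\<lambda>t. complex_of_real ((norm (p (c t)))\<^sup>2)) has_integral
      (\<Sum>i\<in>I. \<Sum>j\<in>I. cinner (u i) (u j) / (1 - v i * (v j * r\<^sup>2)))) {0..1}"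
  proof -
    have "((\<lambda>t. \<Sum>i\<in>I. \<Sum>j\<in>I. (cinner (u i) (u j) / (1 - v i * c t)) * (c t / (c t - v j * r\<^sup>2))) has_integral
      (\<Sum>i\<in>I. \<Sum>j\<in>I. cinner (u i) (u j) / (1 - v i * (v j * r\<^sup>2)))) {0..1}"
    proof (intro has_integral_sum I)
      fix i j assume ij: "i \<in> I" "j \<in> I"
      have "\<bar>v j\<bar> * r\<^sup>2 < r" using mult_strict_right_mono[OF v1[OF ij(2)], of "r\<^sup>2"] r
        by (simp add: power2_eq_square) (smt (verit) mult_left_le)
      then have "norm (complex_of_real (v j * r\<^sup>2)) < r" by (simp only: norm_of_real abs_mult) simp
      moreover have "(\<lambda>w. cinner (u i) (u j) / (1 - v i * w)) holomorphic_on cball 0 r"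
        using r nz ij by (intro holomorphic_intros) auto
      ultimately show "((\<lambda>t. (cinner (u i) (u j) / (1 - v i * c t)) * (c t / (c t - v j * r\<^sup>2))) has_integral
        cinner (u i) (u j) / (1 - v i * (v j * r\<^sup>2))) {0..1}"
        using mean[of "\<lambda>w. cinner (u i) (u j) / (1 - v i * w)" "complex_of_real (v j * r\<^sup>2)"] by simp
    qed
    then show ?thesis
      unfolding p_def norm_sq_sum cnj_p by (simp add: mult_ac)
  qed
  have int3: "((\<lambda>t. complex_of_real ((norm (k t))\<^sup>2)) has_integral
      (\<Sum>i\<in>I. \<Sum>j\<in>I. cinner (y i) (y j) / (1 - v i * v j / r\<^sup>2))) {0..1}"
  proof -
    have "((\<lambda>t. \<Sum>i\<in>I. \<Sum>j\<in>I. (cinner (y i) (y j) / (1 - v i * c t / r\<^sup>2)) * (c t / (c t - v j))) has_integral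
      (\<Sum>i\<in>I. \<Sum>j\<in>I. cinner (y i) (y j) / (1 - v i * v j / r\<^sup>2))) {0..1}"
    proof (intro has_integral_sum I)
      fix i j assume ij: "i \<in> I" "j \<in> I"
      have "(\<lambda>w. cinner (y i) (y j) / (1 - v i * w / r\<^sup>2)) holomorphic_on cball 0 r"
        using r nz' ij by (intro holomorphic_intros) auto
      from mean[OF this, of "v j"] v[OF ij(2)]
      show "((\<lambda>t. (cinner (y i) (y j) / (1 - v i * c t / r\<^sup>2)) * (c t / (c t - v j))) has_integral
        cinner (y i) (y j) / (1 - v i * v j / r\<^sup>2)) {0..1}" by simp
    qed
    moreover have "complex_of_real ((norm (k t))\<^sup>2) =
        (\<Sum>i\<in>I. \<Sum>j\<in>I. (cinner (y i) (y j) / (1 - v i * c t / r\<^sup>2)) * (c t / (c t - v j)))" for t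
      unfolding k_def norm_sq_sum by (intro sum.cong refl, subst cnj_k, assumption) simp
    ultimately show ?thesis by simp
  qed
  have Re: "((\<lambda>t. Re (f t)) has_integral Re z) {0..1}" if "(f has_integral z) {0..1}" for f z
    using has_integral_linear[OF that bounded_linear_Re] by (simp add: o_def)
  have "((\<lambda>t. 2 * Re (cinner (blinfun_apply (\<Phi> (c t)) (p (c t))) (k t))) has_integral
    2 * Re (\<Sum>i\<in>I. \<Sum>j\<in>I. cinner (blinfun_apply (\<Phi> (v i)) (u j)) (y i) / (1 - v j * v i))) {0..1}"
    by (intro has_integral_mult_right Re int1)
  moreover have "((\<lambda>t. Re (complex_of_real ((norm (p (c t)))\<^sup>2)) + Re (complex_of_real ((norm (k t))\<^sup>2))) has_integral
    Re (\<Sum>i\<in>I. \<Sum>j\<in>I. cinner (u i) (u j) / (1 - v i * (v j * r\<^sup>2))) +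
    Re (\<Sum>i\<in>I. \<Sum>j\<in>I. cinner (y i) (y j) / (1 - v i * v j / r\<^sup>2))) {0..1}"
    by (intro has_integral_add Re int2 int3)
  \<comment> \<open>Pointwise on the circle: twice the real part of the inner product is at most the
    sum of the squared norms, and \<open>\<Phi>\<close> is contractive.\<close>
  ultimately show ?thesis
  proof (rule has_integral_le)
    fix t
    have "norm (blinfun_apply (\<Phi> (c t)) (p (c t))) \<le> 1 * norm (p (c t))"
      by (rule order_trans[OF norm_blinfun mult_right_mono[OF contr[OF c1]]]) simp
    then have "(norm (blinfun_apply (\<Phi> (c t)) (p (c t))))\<^sup>2 \<le> (norm (p (c t)))\<^sup>2" by (simp add: power_mono)
    then show "2 * Re (cinner (blinfun_apply (\<Phi> (c t)) (p (c t))) (k t)) \<le>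
        Re (complex_of_real ((norm (p (c t)))\<^sup>2)) + Re (complex_of_real ((norm (k t))\<^sup>2))"
      using two_Re_cinner_le[of "blinfun_apply (\<Phi> (c t)) (p (c t))" "k t"] unfolding Re_complex_of_real by linarith
  qed
qed

text \<open>The limit \<open>r \<rightarrow> 1\<close> from the left is harmless: there are finitely
  many points, and the denominators at \<open>r = 1\<close> do not vanish.\<close>

lemma pick_inequality_disc:
  fixes \<Phi> :: "complex \<Rightarrow> ('u::complex_hilbert_space \<Rightarrow>\<^sub>L 'y::complex_hilbert_space)"
    and v :: "'i \<Rightarrow> real"
  assumes hol: "\<And>u y. (\<lambda>w. cinner (blinfun_apply (\<Phi> w) u) y) holomorphic_on ball 0 1"
    and lin: "\<And>w. norm w < 1 \<Longrightarrow> complex_homogeneous (\<Phi> w)"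
    and contr: "\<And>w. norm w < 1 \<Longrightarrow> norm (\<Phi> w) \<le> 1"
    and I: "finite I" and v: "\<And>i. i \<in> I \<Longrightarrow> \<bar>v i\<bar> < 1"
  shows "2 * Re (\<Sum>i\<in>I. \<Sum>j\<in>I. cinner (blinfun_apply (\<Phi> (v i)) (u j)) (y i) / (1 - v j * v i)) \<le>
    Re (\<Sum>i\<in>I. \<Sum>j\<in>I. cinner (u i) (u j) / (1 - v i * v j)) +
    Re (\<Sum>i\<in>I. \<Sum>j\<in>I. cinner (y i) (y j) / (1 - v i * v j))" (is "?l \<le> ?r")
proof (rule tendsto_lowerbound[of "\<lambda>r. Re (\<Sum>i\<in>I. \<Sum>j\<in>I. cinner (u i) (u j) / (1 - v i * (v j * r\<^sup>2))) +
    Re (\<Sum>i\<in>I. \<Sum>j\<in>I. cinner (y i) (y j) / (1 - v i * v j / r\<^sup>2))" _ "at_left (1::real)"])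
  have nz: "complex_of_real (1 - v i * v j) \<noteq> 0" if "i \<in> I" "j \<in> I" for i j
  proof -
    have "\<bar>v i\<bar> * \<bar>v j\<bar> < 1 * 1" using v that by (intro mult_strict_mono) auto
    then have "v i * v j \<noteq> 1" by (metis abs_mult abs_one less_irrefl mult_1)
    then show ?thesis by (metis eq_iff_diff_eq_0 of_real_eq_0_iff)
  qed
  have lim: "((\<lambda>r. 1 - v i * (v j * r\<^sup>2)) \<longlongrightarrow> 1 - v i * v j) (at_left 1)"
      "((\<lambda>r. 1 - v i * v j / r\<^sup>2) \<longlongrightarrow> 1 - v i * v j) (at_left 1)" for i j
    by (auto intro!: tendsto_eq_intros)
  show "((\<lambda>r. Re (\<Sum>i\<in>I. \<Sum>j\<in>I. cinner (u i) (u j) / (1 - v i * (v j * r\<^sup>2))) +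
    Re (\<Sum>i\<in>I. \<Sum>j\<in>I. cinner (y i) (y j) / (1 - v i * v j / r\<^sup>2))) \<longlongrightarrow> ?r) (at_left 1)"
    by (intro tendsto_add tendsto_Re tendsto_sum tendsto_divide tendsto_const tendsto_of_real lim nz)
  have "eventually (\<lambda>r. \<forall>i\<in>I. \<bar>v i\<bar> < r) (at_left 1)"
    using v by (intro eventually_ball_finite I ballI order_tendstoD(1)[OF tendsto_ident_at])
  moreover have "eventually (\<lambda>r. 0 < r \<and> r < (1::real)) (at_left 1)"
    by (auto simp: eventually_at_left_field intro!: exI[of _ 0])
  ultimately show "eventually (\<lambda>r. ?l \<le> Re (\<Sum>i\<in>I. \<Sum>j\<in>I. cinner (u i) (u j) / (1 - v i * (v j * r\<^sup>2))) +
    Re (\<Sum>i\<in>I. \<Sum>j\<in>I. cinner (y i) (y j) / (1 - v i * v j / r\<^sup>2))) (at_left 1)"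
  proof eventually_elim
    case (elim r)
    show ?case by (rule pick_inequality_disc_radius[OF hol lin contr I]) (use elim in auto)
  qed
qed simp

text \<open>The Cayley transform \<open>z \<mapsto> (z - 1) / (z + 1)\<close> moves the disc to the half-plane.\<close>

lemma pick_inequality_half_plane:
  fixes F :: "complex \<Rightarrow> ('u::complex_hilbert_space \<Rightarrow>\<^sub>L 'y::complex_hilbert_space)"
    and z :: "'i \<Rightarrow> real"
  assumes F: "F \<in> schur_class" and I: "finite I" and z: "\<And>i. i \<in> I \<Longrightarrow> 0 < z i"
  shows "2 * Re (\<Sum>i\<in>I. \<Sum>j\<in>I. cinner (blinfun_apply (F (z i)) (u j)) (y i) / (z i + z j)) \<le>
    Re (\<Sum>i\<in>I. \<Sum>j\<in>I. cinner (u i) (u j) / (z i + z j)) +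
    Re (\<Sum>i\<in>I. \<Sum>j\<in>I. cinner (y i) (y j) / (z i + z j))"
proof -
  \<comment> \<open>The inverse Cayley transform, mapping the disc to the half-plane and
    \<open>v i\<close> to \<open>z i\<close>.\<close>
  define h where "h w = (1 + w) / (1 - w)" for w :: complex
  define \<Phi> where "\<Phi> w = F (h w)" for w
  define v where "v i = (z i - 1) / (z i + 1)" for i
  \<comment> \<open>Since \<open>1 - v i * v j = 2 * (z i + z j) / ((z i + 1) * (z j + 1))\<close>,
    rescaling the vectors by \<open>a i\<close> turns the kernel of the disc into
    \<open>1 / (z i + z j)\<close>.\<close>
  define a where "a i = complex_of_real (sqrt 2 / (z i + 1))" for i
  have ne: "1 - w \<noteq> 0" if "norm w < 1" for w :: complex using that by auto
  have Reh: "0 < Re (h w)" if "norm w < 1" for w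
  proof -
    have "(Re w)\<^sup>2 + (Im w)\<^sup>2 < 1" using that by (simp add: cmod_def)
    then have "0 < (1 + Re w) * (1 - Re w) - Im w * Im w" by (simp add: power2_eq_square algebra_simps)
    moreover have "0 < (1 - Re w)\<^sup>2 + (Im w)\<^sup>2"
      using ne[OF that] by (simp add: complex_eq_iff sum_power2_gt_zero_iff) 
    ultimately show ?thesis by (simp add: h_def Re_divide)
  qed
  have F': "operator_analytic_on F (right_half_plane 0)" "\<And>z. z \<in> right_half_plane 0 \<Longrightarrow> norm (F z) \<le> 1"
    using F by (auto simp: schur_class_def)
  have hR: "h w \<in> right_half_plane 0" if "norm w < 1" for w
    using Reh[OF that] by (simp add: right_half_plane_def)
  have "h holomorphic_on ball 0 1"
    unfolding h_def by (intro holomorphic_intros) auto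
  moreover have "h ` ball 0 1 \<subseteq> right_half_plane 0" using hR by auto
  ultimately have hol: "(\<lambda>w. cinner (blinfun_apply (\<Phi> w) u) y) holomorphic_on ball 0 1" for u y
    using holomorphic_on_compose_gen[OF _ holomorphic_on_cinner_operator[OF F'(1), of u y], of h "ball 0 1"]
    by (simp add: o_def \<Phi>_def)
  have hv: "h (v i) = z i" if "i \<in> I" for i
  proof -
    have "(1 + v i) / (1 - v i) = z i" using z[OF that] by (simp add: v_def field_simps)
    then show ?thesis unfolding h_def by (metis of_real_1 of_real_add of_real_diff of_real_divide)
  qed
  have vlt: "\<bar>v i\<bar> < 1" if "i \<in> I" for i using z[OF that] by (simp add: v_def abs_less_iff field_simps)
  have weight: "a i * a j / complex_of_real (1 - v i * v j) = 1 / complex_of_real (z i + z j)" if "i \<in> I" "j \<in> I" for i j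
  proof -
    have "1 - v i * v j = 2 * (z i + z j) / ((z i + 1) * (z j + 1))"
      using z[OF that(1)] z[OF that(2)] by (simp add: v_def divide_simps) (simp add: algebra_simps)
    then have "(sqrt 2 / (z i + 1)) * (sqrt 2 / (z j + 1)) / (1 - v i * v j) = 1 / (z i + z j)"
      using z[OF that(1)] z[OF that(2)] by simp (simp add: field_simps)
    from arg_cong[OF this, of complex_of_real] show ?thesis
      by (simp only: a_def of_real_mult of_real_divide of_real_1)
  qed
  have cnj_a: "cnj (a i) = a i" for i by (simp add: a_def)
  have "2 * Re (\<Sum>i\<in>I. \<Sum>j\<in>I. cinner (blinfun_apply (\<Phi> (v i)) (a j *\<^sub>C u j)) (a i *\<^sub>C y i) / (1 - v j * v i)) \<le>
    Re (\<Sum>i\<in>I. \<Sum>j\<in>I. cinner (a i *\<^sub>C u i) (a j *\<^sub>C u j) / (1 - v i * v j)) +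
    Re (\<Sum>i\<in>I. \<Sum>j\<in>I. cinner (a i *\<^sub>C y i) (a j *\<^sub>C y j) / (1 - v i * v j))"
  proof (rule pick_inequality_disc[OF hol _ _ I vlt])
    show "complex_homogeneous (\<Phi> w)" if "norm w < 1" for w
      using F'(1) hR[OF that] by (simp add: \<Phi>_def operator_analytic_on_def)
    show "norm (\<Phi> w) \<le> 1" if "norm w < 1" for w using F'(2)[OF hR[OF that]] by (simp add: \<Phi>_def)
  qed
  also have "(\<Sum>i\<in>I. \<Sum>j\<in>I. cinner (blinfun_apply (\<Phi> (v i)) (a j *\<^sub>C u j)) (a i *\<^sub>C y i) / (1 - v j * v i)) =
    (\<Sum>i\<in>I. \<Sum>j\<in>I. cinner (blinfun_apply (F (z i)) (u j)) (y i) / (z i + z j))"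
  proof (intro sum.cong refl)
    fix i j assume ij: "i \<in> I" "j \<in> I"
    have "norm (complex_of_real (v i)) < 1" using vlt[OF ij(1)] by simp
    then have "complex_homogeneous (\<Phi> (v i))"
      using F'(1) hR by (simp add: \<Phi>_def operator_analytic_on_def)
    then have "cinner (blinfun_apply (\<Phi> (v i)) (a j *\<^sub>C u j)) (a i *\<^sub>C y i) / (1 - v j * v i) =
        cinner (blinfun_apply (\<Phi> (v i)) (u j)) (y i) * (a i * a j / (1 - v i * v j))"
      by (simp add: complex_homogeneous_def cinner_scaleC_left cinner_scaleC_right cnj_a mult_ac)
    then show "cinner (blinfun_apply (\<Phi> (v i)) (a j *\<^sub>C u j)) (a i *\<^sub>C y i) / (1 - v j * v i) =
        cinner (blinfun_apply (F (z i)) (u j)) (y i) / (z i + z j)"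
      unfolding weight[OF ij] by (simp add: \<Phi>_def hv[OF ij(1)])
  qed
  also have "(\<Sum>i\<in>I. \<Sum>j\<in>I. cinner (a i *\<^sub>C u i) (a j *\<^sub>C u j) / (1 - v i * v j)) =
    (\<Sum>i\<in>I. \<Sum>j\<in>I. cinner (u i) (u j) / (z i + z j))"
  proof (intro sum.cong refl)
    fix i j assume ij: "i \<in> I" "j \<in> I"
    have "cinner (a i *\<^sub>C u i) (a j *\<^sub>C u j) / (1 - v i * v j) = cinner (u i) (u j) * (a i * a j / (1 - v i * v j))"
      by (simp add: cinner_scaleC_left cinner_scaleC_right cnj_a mult_ac)
    then show "cinner (a i *\<^sub>C u i) (a j *\<^sub>C u j) / (1 - v i * v j) = cinner (u i) (u j) / (z i + z j)"
      unfolding weight[OF ij] by simp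
  qed
  also have "(\<Sum>i\<in>I. \<Sum>j\<in>I. cinner (a i *\<^sub>C y i) (a j *\<^sub>C y j) / (1 - v i * v j)) =
    (\<Sum>i\<in>I. \<Sum>j\<in>I. cinner (y i) (y j) / (z i + z j))"
  proof (intro sum.cong refl)
    fix i j assume ij: "i \<in> I" "j \<in> I"
    have "cinner (a i *\<^sub>C y i) (a j *\<^sub>C y j) / (1 - v i * v j) = cinner (y i) (y j) * (a i * a j / (1 - v i * v j))"
      by (simp add: cinner_scaleC_left cinner_scaleC_right cnj_a mult_ac)
    then show "cinner (a i *\<^sub>C y i) (a j *\<^sub>C y j) / (1 - v i * v j) = cinner (y i) (y j) / (z i + z j)"
      unfolding weight[OF ij] by simp
  qed
  finally show ?thesis .
qed

section \<open>Approximation by sums of exponentials\<close>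

lemma has_bochner_integral_exp:
  assumes a: "(0::real) < a"
  shows "has_bochner_integral lborel (\<lambda>t. indicator {0..} t * exp (- a * t)) (1 / a)"
proof (rule has_bochner_integral_nn_integral)
  have "(\<integral>\<^sup>+t. ennreal (exp (- a * t)) * indicator {0..} t \<partial>lborel) = ennreal (0 - (- exp (- a * 0) / a))"
  proof (rule nn_integral_FTC_atLeast)
    show "((\<lambda>t. - exp (- a * t) / a) has_real_derivative exp (- a * t)) (at t)" for t
      using a by (auto intro!: derivative_eq_intros)
    have "((\<lambda>t. - exp (- (a * t)) / a) \<longlongrightarrow> - 0 / a) at_top"
      using a by (intro tendsto_intros filterlim_compose[OF exp_at_bot]
          filterlim_compose[OF filterlim_uminus_at_bot_at_top]
          filterlim_tendsto_pos_mult_at_top[OF tendsto_const]) (auto intro: filterlim_ident)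
    then show "((\<lambda>t. - exp (- a * t) / a) \<longlongrightarrow> 0) at_top" by simp
  qed auto
  also have "(\<integral>\<^sup>+t. ennreal (exp (- a * t)) * indicator {0..} t \<partial>lborel) =
      (\<integral>\<^sup>+t. ennreal (indicator {0..} t * exp (- a * t)) \<partial>lborel)"
    by (intro nn_integral_cong) (auto simp: indicator_def)
  finally show "(\<integral>\<^sup>+t. ennreal (indicator {0..} t * exp (- a * t)) \<partial>lborel) = ennreal (1 / a)" by simp
qed (use a in auto)

text \<open>The exponents are consecutive integers from \<open>N\<close> on: \<open>N\<close> will
  exceed the growth bound, and the sum is \<open>exp (- N * t)\<close> times a polynomial in
  \<open>exp (- t)\<close>, which makes Stone-Weierstrass applicable.\<close>

definition exp_sum :: "nat \<Rightarrow> nat \<Rightarrow> (nat \<Rightarrow> 'k::real_vector) \<Rightarrow> real \<Rightarrow> 'k"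
  where "exp_sum N K u t = (\<Sum>k\<le>K. (indicator {0..} t * exp (- real (N + k) * t)) *\<^sub>R u k)"

definition exp_sums :: "nat \<Rightarrow> (real \<Rightarrow> 'k::real_vector) set"
  where "exp_sums N = {exp_sum N K u | K u. True}"

lemma exp_sum_pad:
  assumes "K \<le> K'"
  shows "exp_sum N K u = exp_sum N K' (\<lambda>k. if k \<le> K then u k else 0)"
proof
  fix t
  have "exp_sum N K' (\<lambda>k. if k \<le> K then u k else 0) t =
      (\<Sum>k\<le>K'. if k \<le> K then (indicator {0..} t * exp (- real (N + k) * t)) *\<^sub>R u k else 0)"
    unfolding exp_sum_def by (rule sum.cong) auto
  also have "\<dots> = (\<Sum>k\<in>{..K'} \<inter> {..K}. (indicator {0..} t * exp (- real (N + k) * t)) *\<^sub>R u k)"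
    by (subst sum.inter_restrict) (auto intro!: sum.cong)
  also have "{..K'} \<inter> {..K} = {..K}" using assms by auto
  finally show "exp_sum N K u t = exp_sum N K' (\<lambda>k. if k \<le> K then u k else 0) t"
    by (simp add: exp_sum_def)
qed

lemma exp_sums_common_degree:
  fixes f :: "real \<Rightarrow> 'k::real_vector" and g :: "real \<Rightarrow> 'l::real_vector"
  assumes "f \<in> exp_sums N" "g \<in> exp_sums N"
  obtains K u v where "f = exp_sum N K u" "g = exp_sum N K v"
proof -
  obtain K u K' v where fg: "f = exp_sum N K u" "g = exp_sum N K' v" using assms by (auto simp: exp_sums_def)
  show thesis
    using that[OF trans[OF fg(1) exp_sum_pad[of K "max K K'"]] trans[OF fg(2) exp_sum_pad[of K' "max K K'"]]] by simp
qed

lemma exp_sums_add: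
  assumes "f \<in> exp_sums N" "g \<in> exp_sums N"
  shows "(\<lambda>t. f t + g t) \<in> exp_sums N"
proof -
  obtain K u v where fg: "f = exp_sum N K u" "g = exp_sum N K v" using exp_sums_common_degree[OF assms] .
  have "(\<lambda>t. f t + g t) = exp_sum N K (\<lambda>k. u k + v k)"
    by (simp add: fg exp_sum_def scaleR_add_right sum.distrib fun_eq_iff)
  then show ?thesis by (auto simp: exp_sums_def)
qed

lemma exp_sums_zero: "(\<lambda>_. 0) \<in> exp_sums N"
proof -
  have "(\<lambda>_. 0) = exp_sum N 0 (\<lambda>_. 0)" by (simp add: exp_sum_def fun_eq_iff)
  then show ?thesis by (auto simp: exp_sums_def)
qed

lemma exp_sums_sum: "(\<And>i. i \<in> I \<Longrightarrow> f i \<in> exp_sums N) \<Longrightarrow> (\<lambda>t. \<Sum>i\<in>I. f i t) \<in> exp_sums N"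
  by (induction I rule: infinite_finite_induct) (auto intro: exp_sums_add exp_sums_zero)

lemma measurable_exp_sum [measurable]:
  "exp_sum N K u \<in> borel_measurable (borel :: real measure)"
  for u :: "nat \<Rightarrow> 'k::{second_countable_topology, real_normed_vector}"
  unfolding exp_sum_def by measurable

lemma exp_sum_cinner:
  "cinner (exp_sum N K u t) (exp_sum N K v t) =
    (\<Sum>i\<le>K. \<Sum>j\<le>K. (indicator {0..} t * exp (- (real (N + i) + real (N + j)) * t)) *\<^sub>R cinner (u i) (v j))"
  unfolding exp_sum_def cinner_sum_left cinner_sum_right cinner_scaleR_left cinner_scaleR_right scaleR_scaleR
    scaleR_sum_right
  by (subst sum.swap, intro sum.cong refl) (auto simp: indicator_def exp_add[symmetric] algebra_simps)

lemma exp_sum_inner: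
  fixes u v :: "nat \<Rightarrow> 'k::separable_hilbert_space"
  assumes "N > 0"
  shows "has_bochner_integral lborel (\<lambda>t. cinner (exp_sum N K u t) (exp_sum N K v t))
    (\<Sum>i\<le>K. \<Sum>j\<le>K. cinner (u i) (v j) / (real (N + i) + real (N + j)))"
proof -
  have "has_bochner_integral lborel (\<lambda>t. cinner (exp_sum N K u t) (exp_sum N K v t))
    (\<Sum>i\<le>K. \<Sum>j\<le>K. (1 / (real (N + i) + real (N + j))) *\<^sub>R cinner (u i) (v j))"
    unfolding exp_sum_cinner
    by (intro has_bochner_integral_sum has_bochner_integral_scaleR_left has_bochner_integral_exp) (use assms in auto)
  then show ?thesis by (simp add: scaleR_conv_of_real mult.commute)
qed

lemma exp_sum_L2:
  fixes u :: "nat \<Rightarrow> 'k::separable_hilbert_space"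
  assumes "N > 0"
  shows "exp_sum N K u \<in> L2 {0..}"
    and "L2_norm_sq (exp_sum N K u) = Re (\<Sum>i\<le>K. \<Sum>j\<le>K. cinner (u i) (u j) / (real (N + i) + real (N + j)))"
proof -
  have "has_bochner_integral lborel (\<lambda>t. Re (cinner (exp_sum N K u t) (exp_sum N K u t)))
    (Re (\<Sum>i\<le>K. \<Sum>j\<le>K. cinner (u i) (u j) / (real (N + i) + real (N + j))))"
    by (rule has_bochner_integral_bounded_linear[OF bounded_linear_Re exp_sum_inner[OF assms]])
  then have *: "has_bochner_integral lborel (\<lambda>t. (norm (exp_sum N K u t))\<^sup>2)
    (Re (\<Sum>i\<le>K. \<Sum>j\<le>K. cinner (u i) (u j) / (real (N + i) + real (N + j))))" by simp
  show "exp_sum N K u \<in> L2 {0..}"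
    by (rule L2_I) (use * in \<open>auto simp: has_bochner_integral_iff supported_in_def exp_sum_def\<close>)
  show "L2_norm_sq (exp_sum N K u) = Re (\<Sum>i\<le>K. \<Sum>j\<le>K. cinner (u i) (u j) / (real (N + i) + real (N + j)))"
    unfolding L2_norm_sq_def using * by (simp add: has_bochner_integral_iff)
qed

lemma exp_sums_L2: "f \<in> exp_sums N \<Longrightarrow> N > 0 \<Longrightarrow> f \<in> L2 {0..}"
  for f :: "real \<Rightarrow> 'k::separable_hilbert_space"
  using exp_sum_L2(1) by (auto simp: exp_sums_def)

lemma laplace_integrand_of_real: "laplace_integrand f (complex_of_real a) t = exp (- a * t) *\<^sub>R f t"
proof -
  have "exp (- (complex_of_real a * complex_of_real t)) = complex_of_real (exp (- a * t))"
    by (simp add: exp_of_real flip: of_real_mult of_real_minus)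
  then show ?thesis by (simp add: laplace_integrand_def scaleR_scaleC[of _ "f t"])
qed

lemma laplace_exp_sum:
  fixes u :: "nat \<Rightarrow> 'k::separable_hilbert_space"
  assumes "N > 0" "a > 0"
  shows "laplace (exp_sum N K u) (complex_of_real a) = (\<Sum>k\<le>K. (1 / (a + real (N + k))) *\<^sub>R u k)"
proof -
  have eq: "indicator {0..} t *\<^sub>R laplace_integrand (exp_sum N K u) (complex_of_real a) t =
      (\<Sum>k\<le>K. (indicator {0..} t * exp (- (a + real (N + k)) * t)) *\<^sub>R u k)" for t
    unfolding laplace_integrand_of_real exp_sum_def scaleR_sum_right
    by (auto simp: indicator_def mult_exp_exp algebra_simps intro!: sum.cong)
  have "has_bochner_integral lborel (\<lambda>t. \<Sum>k\<le>K. (indicator {0..} t * exp (- (a + real (N + k)) * t)) *\<^sub>R u k)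
    (\<Sum>k\<le>K. (1 / (a + real (N + k))) *\<^sub>R u k)"
    by (intro has_bochner_integral_sum has_bochner_integral_scaleR_left has_bochner_integral_exp) (use assms in auto)
  then show ?thesis
    unfolding laplace_def set_lebesgue_integral_def eq by (rule has_bochner_integral_integral_eq)
qed

text \<open>
  The indicator function of \<open>A\<close> is a limit of continuous functions; with \<open>s = e\<^sup>-\<^sup>t\<close> these become
  continuous functions of \<open>s \<in> [0,1]\<close> that are approximated by polynomials.
\<close>

lemma indicator_exp_approx:
  fixes S :: real
  assumes A: "A \<in> sets borel" "A \<subseteq> {0..S}" and S: "S \<ge> 0"
  obtains p C where "\<And>n. real_polynomial_function (p n)"
    "\<And>n t. t \<ge> 0 \<Longrightarrow> \<bar>p n (exp (- t))\<bar> \<le> C"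
    "AE t in lborel. t \<ge> 0 \<longrightarrow> (\<lambda>n. exp (- real N * t) * p n (exp (- t))) \<longlonglongrightarrow> indicator A t"
proof -
  have "(indicator A :: real \<Rightarrow> real) measurable_on UNIV"
    using A(1) by (intro indicator_measurable_on) simp
  then obtain Z g where Z: "negligible Z" and g: "\<And>n. continuous_on UNIV (g n)"
    "\<And>t. t \<notin> Z \<Longrightarrow> (\<lambda>n. g n t) \<longlonglongrightarrow> (indicator A t :: real)"
    unfolding measurable_on_def by (auto)
  \<comment> \<open>The first factor is 1 on \<open>{0..S}\<close>, hence on \<open>A\<close>, and 0
    from \<open>S + 1\<close> on; the second clamps \<open>g n\<close> to \<open>{0..1}\<close>. The
    pointwise limit is preserved, and the functions become bounded and vanish for large
    \<open>t\<close>.\<close>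
  define h where "h n t = max 0 (min 1 (S + 1 - t)) * max 0 (min 1 (g n t))" for n t
  have h01: "0 \<le> h n t" "h n t \<le> 1" for n t by (auto simp: h_def mult_le_one)
  have h_cont: "continuous_on T (h n)" for n T
    unfolding h_def by (intro continuous_intros continuous_on_subset[OF g(1)]) auto
  have h0: "h n t = 0" if "t \<ge> S + 1" for n t using that by (simp add: h_def)
  have h_lim: "(\<lambda>n. h n t) \<longlonglongrightarrow> indicator A t" if "t \<notin> Z" for t
  proof -
    have "(\<lambda>n. h n t) \<longlonglongrightarrow> max 0 (min 1 (S + 1 - t)) * max 0 (min 1 (indicator A t))"
      unfolding h_def by (intro tendsto_intros g(2) that)
    moreover have "max 0 (min 1 (S + 1 - t)) * max 0 (min 1 (indicator A t)) = (indicator A t :: real)"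
      using A(2) by (auto simp: indicator_def)
    ultimately show ?thesis by (simp only:)
  qed
  \<comment> \<open>The value of \<open>s\<close> at \<open>t = S + 1\<close>. Replacing
    \<open>s\<close> by \<open>max s m\<close> removes the singularity of the logarithm at 0; below
    \<open>m\<close> the function \<open>c n\<close> is constantly 0. The factor
    \<open>exp (N * t)\<close> in \<open>c\<close> cancels the weight put back in front of the
    polynomial.\<close>
  define m where "m = exp (- (S + 1))"
  define c where "c n s = h n (- ln (max s m)) * exp (real N * (- ln (max s m)))" for n s
  have m: "m > 0" by (simp add: m_def)
  have c_cont: "continuous_on {0..1} (c n)" for n
    unfolding c_def using m
    by (intro continuous_intros continuous_on_compose2[OF h_cont[of UNIV]]) (auto simp: less_max_iff_disj)
  have "\<exists>p. real_polynomial_function p \<and> (\<forall>s\<in>{0..1}. \<bar>c n s - p s\<bar> < 1 / Suc n)" for n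
  proof -
    have "0 < 1 / real (Suc n)" by simp
    from Stone_Weierstrass_real_polynomial_function[OF compact_Icc c_cont this] show ?thesis by metis
  qed
  then obtain p where p: "\<And>n. real_polynomial_function (p n)" "\<And>n s. s \<in> {0..1} \<Longrightarrow> \<bar>c n s - p n s\<bar> < 1 / Suc n"
    by metis
  have c_eq: "c n (exp (- t)) = h n t * exp (real N * t)" for n t
  proof (cases "t \<le> S + 1")
    case True
    then have "max (exp (- t)) m = exp (- t)" by (simp add: m_def)
    then show ?thesis by (simp add: c_def)
  next
    case False
    then have "max (exp (- t)) m = m" by (simp add: m_def)
    then show ?thesis using False by (simp add: c_def h0 m_def)
  qed
  have exp01: "exp (- t) \<in> {0..1::real}" if "t \<ge> 0" for t using that by simp
  have dist: "\<bar>h n t * exp (real N * t) - p n (exp (- t))\<bar> < 1 / Suc n" if "t \<ge> 0" for n t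
    using p(2)[OF exp01[OF that], of n] unfolding c_eq .
  show thesis
  proof (rule that)
    show "real_polynomial_function (p n)" for n by (rule p)
    show "\<bar>p n (exp (- t))\<bar> \<le> exp (real N * (S + 1)) + 1" if "t \<ge> 0" for n t
    proof -
      have "\<bar>h n t * exp (real N * t)\<bar> \<le> exp (real N * (S + 1))"
      proof (cases "t \<le> S + 1")
        case True
        then have "h n t * exp (real N * t) \<le> 1 * exp (real N * (S + 1))"
          using h01 by (intro mult_mono) (auto intro: mult_left_mono)
        then show ?thesis using h01 by simp
      qed (simp add: h0)
      moreover have "1 / real (Suc n) \<le> 1" by simp
      ultimately show ?thesis using dist[OF that, of n] by linarith
    qed
    have "AE t in lebesgue. t \<notin> Z" using Z by (intro AE_not_in) (simp add: negligible_iff_null_sets)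
    then have "AE t in lborel. t \<notin> Z" by (simp add: AE_completion_iff)
    then show "AE t in lborel. t \<ge> 0 \<longrightarrow> (\<lambda>n. exp (- real N * t) * p n (exp (- t))) \<longlonglongrightarrow> indicator A t"
    proof eventually_elim
      case (elim t)
      show ?case
      proof
        assume t: "t \<ge> 0"
        have "(\<lambda>n. h n t * exp (real N * t) - p n (exp (- t))) \<longlonglongrightarrow> 0"
          by (rule Lim_null_comparison[OF _ LIMSEQ_Suc[OF lim_1_over_n]])
            (auto intro!: always_eventually less_imp_le[OF dist[OF t]] simp del: of_nat_Suc)
        from tendsto_mult[OF tendsto_const[of "exp (- real N * t)"] this]
        have "(\<lambda>n. h n t - exp (- real N * t) * p n (exp (- t))) \<longlonglongrightarrow> 0"
          by (simp add: right_diff_distrib mult.left_commute[of _ "h _ t"] mult_exp_exp)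
        from tendsto_diff[OF h_lim[OF elim] this]
        show "(\<lambda>n. exp (- real N * t) * p n (exp (- t))) \<longlonglongrightarrow> indicator A t" by simp
      qed
    qed
  qed
qed

lemma exp_poly_in_exp_sums:
  assumes "real_polynomial_function p"
  shows "(\<lambda>t. (indicator {0..} t * (exp (- real N * t) * p (exp (- t)))) *\<^sub>R x) \<in> exp_sums N"
proof -
  obtain a K where p: "p = (\<lambda>s. \<Sum>i\<le>K. a i * s ^ i)"
    using real_polynomial_function_imp_sum[OF assms] by blast
  have "exp (- real N * t) * exp (- t) ^ i = exp (- real (N + i) * t)" for t i
    by (simp add: exp_of_nat_mult[symmetric] mult_exp_exp algebra_simps)
  then have "(\<lambda>t. (indicator {0..} t * (exp (- real N * t) * p (exp (- t)))) *\<^sub>R x) = exp_sum N K (\<lambda>k. a k *\<^sub>R x)"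
    by (auto simp: p exp_sum_def fun_eq_iff sum_distrib_left scaleR_sum_left mult_ac intro!: sum.cong)
  then show ?thesis by (auto simp: exp_sums_def)
qed

text \<open>Density, phrased as induction so that it serves both for test functions and for inputs.
  Two kinds of limits occur because their majorants differ: exponential sums approximate a simple
  function on the whole half-line under a bound \<open>C * exp (- N * t)\<close>, whereas simple
  functions approximate \<open>f\<close> inside \<open>{0..S}\<close> under a square integrable
  bound. Mere \<open>L2\<close> convergence would not do for test functions: an output is at first
  integrable on the half-line only against \<open>exp (- N * t)\<close>.\<close>

lemma L2_exp_sums_induct:
  fixes f :: "real \<Rightarrow> 'k::separable_hilbert_space"
  assumes f: "f \<in> L2 {0..S}" and S: "S \<ge> 0"
    and base: "\<And>\<phi>. \<phi> \<in> exp_sums N \<Longrightarrow> P \<phi>"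
    and exp_lim: "\<And>\<phi> g C. (\<And>n. \<phi> n \<in> exp_sums N) \<Longrightarrow> g \<in> L2 {0..S} \<Longrightarrow>
      (\<And>n t. norm (\<phi> n t) \<le> C * (indicator {0..} t * exp (- real N * t))) \<Longrightarrow>
      AE t in lborel. (\<lambda>n. \<phi> n t) \<longlonglongrightarrow> g t \<Longrightarrow> (\<And>n. P (\<phi> n)) \<Longrightarrow> P g"
    and L2_lim: "\<And>\<phi> g h. (\<And>n. \<phi> n \<in> L2 {0..S}) \<Longrightarrow> g \<in> L2 {0..S} \<Longrightarrow> h \<in> borel_measurable borel \<Longrightarrow>
      integrable lborel (\<lambda>t. (h t :: real)\<^sup>2) \<Longrightarrow> (\<And>n t. norm (\<phi> n t) \<le> h t) \<Longrightarrow> (\<And>t. t \<notin> {0..S} \<Longrightarrow> h t = 0) \<Longrightarrow>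
      AE t in lborel. (\<lambda>n. \<phi> n t) \<longlonglongrightarrow> g t \<Longrightarrow> (\<And>n. P (\<phi> n)) \<Longrightarrow> P g"
  shows "P f"
proof -
  note [measurable] = L2_D(1)[OF f]
  \<comment> \<open>\<open>f\<close> vanishes outside \<open>{0..S}\<close> only almost everywhere;
    after the projection the simple functions vanish there everywhere.\<close>
  have "proj {0..S} f \<in> borel_measurable lborel" by measurable
  from borel_measurable_implies_sequence_metric[OF this, of 0]
  obtain F where F: "\<And>i. simple_function lborel (F i)" "\<And>t. (\<lambda>i. F i t) \<longlonglongrightarrow> proj {0..S} f t"
    "\<And>i t. norm (F i t) \<le> 2 * norm (proj {0..S} f t)"
    by auto
  have F0: "F i t = 0" if "t \<notin> {0..S}" for i t using F(3)[of i t] that by (simp add: proj_def)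
  have Fm [measurable]: "F i \<in> borel_measurable borel" for i
    using borel_measurable_simple_function[OF F(1)] by simp
  define h where "h t = 2 * norm (proj {0..S} f t)" for t
  have h2: "integrable lborel (\<lambda>t. (h t)\<^sup>2)"
    using L2_D(2)[OF L2_proj[OF f, of "{0..S}"]] by (simp add: h_def power_mult_distrib)
  have hm: "h \<in> borel_measurable borel" unfolding h_def by measurable
  have Fle: "norm (F i t) \<le> h t" for i t using F(3)[of i t] by (simp add: h_def)
  have Fh: "(norm (F i t))\<^sup>2 \<le> (h t)\<^sup>2" for i t
    by (intro power_mono Fle) simp
  have FL2: "F i \<in> L2 {0..S}" for i
  proof (rule L2_I)
    show "integrable lborel (\<lambda>t. (norm (F i t))\<^sup>2)"
      by (rule Bochner_Integration.integrable_bound[OF h2]) (auto simp: Fh)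
  qed (auto simp: supported_in_def F0)
  have "P (F i)" for i
  proof -
    define X where "X = range (F i) - {0}"
    have X: "finite X" using simple_functionD(1)[OF F(1), of i] by (simp add: X_def)
    define A where "A x = F i -` {x}" for x
    have A: "A x \<in> sets borel" "x \<in> X \<Longrightarrow> A x \<subseteq> {0..S}" for x
      using simple_functionD(2)[OF F(1), of i "{x}"] F0 by (force simp: A_def X_def)+
    have Feq: "F i t = (\<Sum>x\<in>X. indicator (A x) t *\<^sub>R x)" for t
    proof (cases "F i t = 0")
      case True
      then have "(\<Sum>x\<in>X. indicator (A x) t *\<^sub>R x) = 0" by (intro sum.neutral) (auto simp: A_def X_def)
      with True show ?thesis by simp
    next
      case False
      then have "(\<Sum>x\<in>X. indicator (A x) t *\<^sub>R x) = (\<Sum>x\<in>X. if x = F i t then x else 0)"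
        by (intro sum.cong) (auto simp: A_def indicator_def)
      then show ?thesis using X False by (simp add: X_def)
    qed
    define Q where "Q x p C \<longleftrightarrow> (\<forall>n. real_polynomial_function (p n)) \<and> (\<forall>n t. t \<ge> 0 \<longrightarrow> \<bar>p n (exp (- t))\<bar> \<le> C) \<and>
      (AE t in lborel. t \<ge> 0 \<longrightarrow> (\<lambda>n. exp (- real N * t) * p n (exp (- t))) \<longlonglongrightarrow> indicator (A x) t)"
      for x p C
    have "\<exists>p C. Q x p C" if "x \<in> X" for x
      by (rule indicator_exp_approx[OF A(1) A(2)[OF that] S, of N]) (unfold Q_def, blast)
    then obtain p C where pC: "\<And>x. x \<in> X \<Longrightarrow> Q x (p x) (C x)" by metis
    have p: "\<And>x n. x \<in> X \<Longrightarrow> real_polynomial_function (p x n)"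
      "\<And>x n t. x \<in> X \<Longrightarrow> t \<ge> 0 \<Longrightarrow> \<bar>p x n (exp (- t))\<bar> \<le> C x"
      "\<And>x. x \<in> X \<Longrightarrow> AE t in lborel. t \<ge> 0 \<longrightarrow> (\<lambda>n. exp (- real N * t) * p x n (exp (- t))) \<longlonglongrightarrow> indicator (A x) t"
      using pC unfolding Q_def by blast+
    define \<phi> where "\<phi> n t = (\<Sum>x\<in>X. (indicator {0..} t * (exp (- real N * t) * p x n (exp (- t)))) *\<^sub>R x)" for n t
    have \<phi>: "\<phi> n \<in> exp_sums N" for n
      unfolding \<phi>_def by (intro exp_sums_sum exp_poly_in_exp_sums p)
    show ?thesis
    proof (rule exp_lim[of \<phi>])
      show "norm (\<phi> n t) \<le> (\<Sum>x\<in>X. C x * norm x) * (indicator {0..} t * exp (- real N * t))" for n t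
      proof -
        have "norm (\<phi> n t) \<le> (\<Sum>x\<in>X. C x * norm x * (indicator {0..} t * exp (- real N * t)))"
          unfolding \<phi>_def
        proof (rule sum_norm_le)
          fix x assume "x \<in> X"
          have "t \<ge> 0 \<Longrightarrow> \<bar>p x n (exp (- t))\<bar> * (exp (- real N * t) * norm x) \<le> C x * (exp (- real N * t) * norm x)"
            by (intro mult_right_mono p(2)[OF \<open>x \<in> X\<close>]) auto
          then show "norm ((indicator {0..} t * (exp (- real N * t) * p x n (exp (- t)))) *\<^sub>R x) \<le>
              C x * norm x * (indicator {0..} t * exp (- real N * t))"
            by (cases "t \<ge> 0") (auto simp: abs_mult mult_ac)
        qed
        then show ?thesis by (simp add: sum_distrib_right)
      qed
      have "AE t in lborel. \<forall>x\<in>X. t \<ge> 0 \<longrightarrow> (\<lambda>n. exp (- real N * t) * p x n (exp (- t))) \<longlonglongrightarrow> indicator (A x) t"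
        using p(3) X by (intro AE_finite_allI) auto
      then show "AE t in lborel. (\<lambda>n. \<phi> n t) \<longlonglongrightarrow> F i t"
      proof eventually_elim
        case (elim t)
        show ?case
        proof (cases "t \<ge> 0")
          case True
          then show ?thesis unfolding \<phi>_def Feq using elim
            by (intro tendsto_sum tendsto_scaleR tendsto_const) auto
        next
          case False
          then show ?thesis by (simp add: \<phi>_def F0)
        qed
      qed
    qed (use \<phi> FL2 base in auto)
  qed
  moreover have "AE t in lborel. proj {0..S} f t = f t"
    using L2_D(3)[OF f] by (simp add: supported_in_proj_eq ae_eq_def)
  then have "AE t in lborel. (\<lambda>n. F n t) \<longlonglongrightarrow> f t"
  proof eventually_elim
    case (elim t)
    then show ?case using F(2)[of t] by simp
  qed
  ultimately show ?thesis
    by (intro L2_lim[OF FL2 f hm h2 Fle]) (auto simp: h_def proj_def)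
qed

section \<open>Locally square integrable functions\<close>

lemma L2_norm_sq_tendsto:
  assumes f: "\<And>n. f n \<in> L2 UNIV" and g: "g \<in> L2 UNIV" and lim: "(\<lambda>n. L2_norm_sq (\<lambda>t. f n t - g t)) \<longlonglongrightarrow> 0"
  shows "(\<lambda>n. L2_norm_sq (f n)) \<longlonglongrightarrow> L2_norm_sq g"
proof -
  have "(\<lambda>n. L2_class (f n)) \<longlonglongrightarrow> L2_class g" using lim by (simp add: L2_class_LIMSEQ_iff f g)
  then have "(\<lambda>n. (norm (L2_class (f n)))\<^sup>2) \<longlonglongrightarrow> (norm (L2_class g))\<^sup>2" by (intro tendsto_intros)
  then show ?thesis by (simp only: norm_L2_class[OF f] norm_L2_class[OF g])
qed

lemma L2_dominated_convergence:
  fixes f :: "nat \<Rightarrow> real \<Rightarrow> 'k::separable_hilbert_space"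
  assumes [measurable]: "\<And>n. f n \<in> borel_measurable borel" "g \<in> borel_measurable borel" "h \<in> borel_measurable borel"
    and h: "integrable lborel (\<lambda>t. (h t :: real)\<^sup>2)" and dom: "\<And>n t. norm (f n t) \<le> h t"
    and lim: "AE t in lborel. (\<lambda>n. f n t) \<longlonglongrightarrow> g t"
  shows "(\<lambda>n. L2_norm_sq (\<lambda>t. f n t - g t)) \<longlonglongrightarrow> 0"
proof -
  have "(\<lambda>n. LINT t|lborel. (norm (f n t - g t))\<^sup>2) \<longlonglongrightarrow> (LINT t|(lborel :: real measure). (0::real))"
  proof (rule Bochner_Integration.integral_dominated_convergence[where w = "\<lambda>t. 4 * (h t)\<^sup>2"])
    show "integrable lborel (\<lambda>t. 4 * (h t)\<^sup>2)" using h by simp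
    show "AE t in lborel. (\<lambda>n. (norm (f n t - g t))\<^sup>2) \<longlonglongrightarrow> 0"
      using lim
    proof eventually_elim
      case (elim t)
      then have "(\<lambda>n. (norm (f n t - g t))\<^sup>2) \<longlonglongrightarrow> (norm (g t - g t))\<^sup>2" by (intro tendsto_intros)
      then show ?case by simp
    qed
    show "AE t in lborel. norm ((norm (f n t - g t))\<^sup>2) \<le> 4 * (h t)\<^sup>2" for n
      using lim
    proof eventually_elim
      case (elim t)
      have "norm (g t) \<le> h t"
        by (rule LIMSEQ_le_const2[OF tendsto_norm[OF elim]]) (use dom in auto)
      then have "norm (f n t - g t) \<le> 2 * h t" using norm_triangle_ineq4[of "f n t" "g t"] dom[of n t] by linarith
      from power_mono[OF this, of 2] show ?case by (simp add: power_mult_distrib)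
    qed
  qed auto
  then show ?thesis by (simp add: L2_norm_sq_def)
qed

lemma L2_loc_iff:
  "f \<in> L2_loc \<longleftrightarrow> f \<in> borel_measurable borel \<and> (\<forall>a b. proj {a..b} f \<in> L2 UNIV)"
proof -
  have "set_integrable lborel {a..b} (\<lambda>t. (norm (f t))\<^sup>2) \<longleftrightarrow> proj {a..b} f \<in> L2 UNIV"
    if "f \<in> borel_measurable borel" for a b
    unfolding set_integrable_def L2_def using that by (simp add: norm_proj)
  then show ?thesis by (auto simp: L2_loc_def)
qed

lemma proj_proj: "proj I (proj J f) = proj (I \<inter> J) f"
  by (auto simp: proj_def indicator_def)

lemma proj_add: "proj J (\<lambda>t. f t + g t) = (\<lambda>t. proj J f t + proj J g t)"
  by (auto simp: proj_def scaleR_add_right)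

lemma proj_diff: "proj J (\<lambda>t. f t - g t) = (\<lambda>t. proj J f t - proj J g t)"
  by (auto simp: proj_def scaleR_diff_right)

lemma proj_scaleC: "proj J (\<lambda>t. c *\<^sub>C f t) = (\<lambda>t. c *\<^sub>C proj J f t)"
  by (simp add: proj_def scaleC_scaleR_commute)

lemma shift_proj: "shift t (proj J f) = proj {s. t + s \<in> J} (shift t f)"
  by (auto simp: shift_def proj_def indicator_def)

lemma L2_loc_D:
  assumes "f \<in> L2_loc"
  shows "f \<in> borel_measurable borel" "proj {a..b} f \<in> L2 UNIV"
  using assms by (auto simp: L2_loc_iff)

lemma L2_loc_proj_bounded:
  assumes "f \<in> L2_loc" "J \<in> sets borel" "J \<subseteq> {a..b}"
  shows "proj J f \<in> L2 J"
proof -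
  have "proj J f = proj J (proj {a..b} f)" using assms(3) by (simp add: proj_proj Int_absorb2)
  then show ?thesis using L2_proj'[OF L2_loc_D(2)[OF assms(1)] assms(2)] by simp
qed

lemma L2_loc_add: "f \<in> L2_loc \<Longrightarrow> g \<in> L2_loc \<Longrightarrow> (\<lambda>t. f t + g t) \<in> L2_loc"
  unfolding L2_loc_iff proj_add by (auto intro: L2_add)

lemma L2_loc_diff: "f \<in> L2_loc \<Longrightarrow> g \<in> L2_loc \<Longrightarrow> (\<lambda>t. f t - g t) \<in> L2_loc"
  unfolding L2_loc_iff proj_diff by (auto intro: L2_diff)

lemma L2_loc_proj:
  assumes "f \<in> L2_loc" "J \<in> sets borel"
  shows "proj J f \<in> L2_loc"
  using assms L2_proj''[OF L2_loc_D(2)[OF assms(1)] assms(2)]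
  by (auto simp: L2_loc_iff proj_proj Int_commute)

lemma L2_loc_shift:
  assumes "f \<in> L2_loc"
  shows "shift t f \<in> L2_loc"
proof -
  have "proj {a..b} (shift t f) = shift t (proj {t + a..t + b} f)" for a b
    unfolding shift_proj by (rule arg_cong[where f = "\<lambda>J. proj J (shift t f)"]) auto
  moreover have "shift t (proj {t + a..t + b} f) \<in> L2 UNIV" for a b
    using L2_shift[OF L2_loc_D(2)[OF assms], of t] by simp
  ultimately show ?thesis using L2_loc_D(1)[OF assms] by (auto simp: L2_loc_iff)
qed

lemma L2_imp_L2_loc: "f \<in> L2 J \<Longrightarrow> f \<in> L2_loc"
  unfolding L2_loc_iff using L2_proj''[OF L2_UNIV[of f J]] L2_D(1)[of f J] by auto

lemma left_bounded_add: 
  assumes "left_bounded f" "left_bounded g"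
  shows "left_bounded (\<lambda>t. f t + g t :: 'k::monoid_add)"
proof -
  obtain a b where "supported_in {a<..} f" "supported_in {b<..} g" using assms by (auto simp: left_bounded_def)
  then have "supported_in {min a b<..} (\<lambda>t. f t + g t)"
    by (intro supported_in_add; elim supported_in_mono) auto
  then show ?thesis by (auto simp: left_bounded_def)
qed

lemma left_bounded_proj: "left_bounded f \<Longrightarrow> left_bounded (proj J f)"
  unfolding left_bounded_def using supported_in_proj' by blast

lemma left_bounded_shift:
  fixes f :: "real \<Rightarrow> 'k::{second_countable_topology, real_normed_vector}"
  assumes "f \<in> borel_measurable borel" "left_bounded f"
  shows "left_bounded (shift t f)"
proof -
  obtain a where "supported_in {a<..} f" using assms(2) by (auto simp: left_bounded_def)
  then have "supported_in {s. t + s \<in> {a<..}} (shift t f)" by (intro supported_in_shift assms) auto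
  then have "supported_in {a - t<..} (shift t f)" by (rule supported_in_mono) auto
  then show ?thesis by (auto simp: left_bounded_def)
qed

lemma left_bounded_uminus: "left_bounded f \<Longrightarrow> left_bounded (\<lambda>t. - f t :: 'k::group_add)"
  unfolding left_bounded_def by (auto dest: supported_in_comp[where h = uminus])

lemma left_bounded_scaleC: "left_bounded f \<Longrightarrow> left_bounded (\<lambda>t. c *\<^sub>C f t)"
  unfolding left_bounded_def by (auto dest: supported_in_comp[where h = "\<lambda>x. c *\<^sub>C x"])

lemma left_bounded_diff: "left_bounded f \<Longrightarrow> left_bounded g \<Longrightarrow> left_bounded (\<lambda>t. f t - g t :: 'k::ab_group_add)"
  using left_bounded_add[of f "\<lambda>t. - g t"] left_bounded_uminus[of g] by simp

lemma left_bounded_supported: "supported_in J f \<Longrightarrow> J \<subseteq> {a..} \<Longrightarrow> left_bounded f"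
  unfolding left_bounded_def by (rule exI[of _ "a - 1"], erule supported_in_mono) force

lemma L2_left_loc_D:
  assumes "f \<in> L2_left_loc"
  shows "f \<in> borel_measurable borel" "f \<in> L2_loc" "left_bounded f"
  using assms L2_loc_D by (auto simp: L2_left_loc_def)

lemma L2_left_loc_add: "f \<in> L2_left_loc \<Longrightarrow> g \<in> L2_left_loc \<Longrightarrow> (\<lambda>t. f t + g t) \<in> L2_left_loc"
  by (auto simp: L2_left_loc_def intro: L2_loc_add left_bounded_add)

lemma L2_left_loc_proj: "f \<in> L2_left_loc \<Longrightarrow> J \<in> sets borel \<Longrightarrow> proj J f \<in> L2_left_loc"
  by (auto simp: L2_left_loc_def intro: L2_loc_proj left_bounded_proj)

lemma L2_left_loc_shift: "f \<in> L2_left_loc \<Longrightarrow> shift t f \<in> L2_left_loc"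
  by (auto simp: L2_left_loc_def intro: L2_loc_shift left_bounded_shift dest: L2_loc_D(1))

lemma L2_left_imp_loc: "f \<in> L2_left J \<Longrightarrow> f \<in> L2_left_loc"
  by (auto simp: L2_left_def L2_left_loc_def intro: L2_imp_L2_loc)

lemma L2_plus_loc_imp_left: "f \<in> L2_plus_loc \<Longrightarrow> f \<in> L2_left_loc"
  by (auto simp: L2_plus_loc_def L2_left_loc_def intro: left_bounded_supported)

lemma L2_left_loc_zero: "(\<lambda>_. 0) \<in> L2_left_loc"
  using L2_imp_L2_loc[OF L2_zero] by (auto simp: L2_left_loc_def left_bounded_def supported_in_def)

lemma L2_left_loc_proj_L2:
  assumes "f \<in> L2_left_loc" "J \<in> sets borel" "J \<subseteq> {..b}"
  shows "proj J f \<in> L2_left J"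
proof -
  obtain a where a: "supported_in {a<..} f" using L2_left_loc_D(3)[OF assms(1)] by (auto simp: left_bounded_def)
  have eq: "proj (J \<inter> {a<..}) f =\<^sub>a proj J f"
    using ae_eq_proj[OF a[unfolded supported_in_proj_eq], of J] by (simp add: proj_proj)
  have "proj (J \<inter> {a<..}) f \<in> L2 (J \<inter> {a<..})"
    by (rule L2_loc_proj_bounded[OF L2_left_loc_D(2)[OF assms(1)], of _ a b]) (use assms in auto)
  then have "proj (J \<inter> {a<..}) f \<in> L2 J" by (rule L2_mono) auto
  from L2_cong[OF this _ eq] have "proj J f \<in> L2 J"
    using L2_left_loc_D(1)[OF assms(1)] assms(2) by simp
  then show ?thesis using left_bounded_proj[OF L2_left_loc_D(3)[OF assms(1)]] by (simp add: L2_left_def)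
qed

lemma ae_eq_proj_null: "AE t in lborel. t \<in> I \<longleftrightarrow> t \<in> J \<Longrightarrow> proj I f =\<^sub>a proj J f"
  unfolding ae_eq_def proj_def by (erule eventually_mono) (auto simp: indicator_def)

lemma ae_eq_proj_atMost: "proj {..<t} f =\<^sub>a proj {..t} f"
  by (rule ae_eq_proj_null) (use AE_lborel_singleton[of t] in \<open>auto elim!: eventually_mono\<close>)

lemma ae_eq_proj_atLeastAtMost: "proj {s..<t} f =\<^sub>a proj {s..t} f"
  by (rule ae_eq_proj_null) (use AE_lborel_singleton[of t] in \<open>auto elim!: eventually_mono\<close>)

section \<open>Convergence of functions with support bounded to the left\<close>

lemma converges_left_locI:
  assumes "\<And>k. z k \<in> L2 UNIV" "z0 \<in> L2 UNIV" "\<And>k. supported_in {a<..} (z k)" "supported_in {a<..} z0"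
    and lim: "(\<lambda>k. L2_norm_sq (\<lambda>t. z k t - z0 t)) \<longlonglongrightarrow> 0"
  shows "converges_left_loc z z0"
  unfolding converges_left_loc_def
proof (intro exI[of _ a] conjI allI impI)
  fix b
  show "(\<lambda>k. L2_norm_sq (proj {a..b} (\<lambda>t. z k t - z0 t))) \<longlonglongrightarrow> 0"
    by (rule tendsto_sandwich[OF _ _ tendsto_const lim])
      (auto intro!: always_eventually L2_norm_sq_proj_le L2_diff assms)
qed (use assms in auto)

lemma converges_left_loc_proj:
  assumes conv: "converges_left_loc z z0" and z: "\<And>k. z k \<in> L2_loc" "z0 \<in> L2_loc"
    and J: "J \<in> sets borel" "J \<subseteq> {..b}"
  shows "(\<lambda>k. L2_norm_sq (proj J (\<lambda>t. z k t - z0 t))) \<longlonglongrightarrow> 0"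
proof -
  obtain a where a: "\<And>k. supported_in {a<..} (z k)" "supported_in {a<..} z0"
    and lim: "\<And>b. b > a \<Longrightarrow> (\<lambda>k. L2_norm_sq (proj {a..b} (\<lambda>t. z k t - z0 t))) \<longlonglongrightarrow> 0"
    using conv unfolding converges_left_loc_def by blast
  \<comment> \<open>The definition of convergence only offers windows \<open>{a..c}\<close> with
    \<open>c > a\<close>, while \<open>b\<close> may lie to the left of \<open>a\<close>.\<close>
  define c where "c = max b (a + 1)"
  have "L2_norm_sq (proj J (\<lambda>t. z k t - z0 t)) \<le> L2_norm_sq (proj {a..c} (\<lambda>t. z k t - z0 t))" for k
  proof -
    define d where "d = (\<lambda>t. z k t - z0 t)"
    have d: "d \<in> L2_loc" unfolding d_def by (intro L2_loc_diff z)
    have "supported_in {a<..} d" unfolding d_def by (intro supported_in_diff a)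
    then have supp: "supported_in {a..} d" by (rule supported_in_mono) auto
    have "proj (J \<inter> {a..c}) d =\<^sub>a proj J d"
    proof -
      from supp have "proj (J \<inter> {a..}) d =\<^sub>a proj J d"
        using ae_eq_proj[of "proj {a..} d" d J] by (simp add: supported_in_proj_eq proj_proj)
      moreover have "J \<inter> {a..} = J \<inter> {a..c}" using J(2) by (auto simp: c_def le_max_iff_disj)
      ultimately show ?thesis by simp
    qed
    from L2_norm_sq_cong[OF _ _ this]
    have "L2_norm_sq (proj J d) = L2_norm_sq (proj J (proj {a..c} d))"
      unfolding proj_proj using L2_loc_D(1)[OF d] J(1) by simp
    also have "\<dots> \<le> L2_norm_sq (proj {a..c} d)"
      by (rule L2_norm_sq_proj_le[OF L2_loc_D(2)[OF d] J(1)])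
    finally show ?thesis by (simp add: d_def)
  qed
  then show ?thesis
    by (intro tendsto_sandwich[OF _ _ tendsto_const lim[of c]]) (auto simp: c_def)
qed

lemma ae_eq_if_bounded_proj:
  assumes "\<And>n::nat. proj {- real n..real n} f =\<^sub>a proj {- real n..real n} g"
  shows "f =\<^sub>a g"
proof -
  have "AE t in lborel. \<forall>n::nat. proj {- real n..real n} f t = proj {- real n..real n} g t"
    unfolding AE_all_countable using assms by (simp add: ae_eq_def)
  then show ?thesis unfolding ae_eq_def
  proof eventually_elim
    case (elim t)
    obtain n :: nat where "\<bar>t\<bar> \<le> real n" using real_arch_simple by blast
    then have "t \<in> {- real n..real n}" by auto
    with elim show ?case by (auto simp: proj_def dest!: spec[of _ n])
  qed
qed

text \<open>Limits are unique up to \<open>=\<^sub>a\<close>. Applied to constant sequences, this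
  shows that the sequentially continuous map \<open>D\<close> respects
  \<open>=\<^sub>a\<close>.\<close>

lemma converges_left_loc_const:
  assumes conv: "converges_left_loc (\<lambda>_. f) g" and f: "f \<in> L2_loc" and g: "g \<in> L2_loc"
  shows "f =\<^sub>a g"
proof (rule ae_eq_if_bounded_proj)
  fix n :: nat
  have d: "(\<lambda>t. f t - g t) \<in> L2_loc" by (intro L2_loc_diff f g)
  have "(\<lambda>k::nat. L2_norm_sq (proj {- real n..real n} (\<lambda>t. f t - g t))) \<longlonglongrightarrow> 0"
    by (rule converges_left_loc_proj[OF conv, of _ "real n"]) (use f g in auto)
  then have "L2_norm_sq (proj {- real n..real n} (\<lambda>t. f t - g t)) = 0" by (simp add: LIMSEQ_const_iff)
  then have "proj {- real n..real n} (\<lambda>t. f t - g t) =\<^sub>a (\<lambda>_. 0)"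
    using L2_norm_sq_eq_0[OF L2_loc_D(2)[OF d]] by blast
  then show "proj {- real n..real n} f =\<^sub>a proj {- real n..real n} g"
    unfolding ae_eq_def proj_diff by (auto elim: eventually_mono)
qed

lemma converges_left_loc_ae_eq:
  assumes "f =\<^sub>a g" and "f \<in> L2_left_loc" "g \<in> L2_left_loc"
  shows "converges_left_loc (\<lambda>_. f) g"
proof -
  obtain a where a: "supported_in {a<..} f" using L2_left_loc_D(3)[OF assms(2)] by (auto simp: left_bounded_def)
  have "L2_norm_sq (proj {a..b} (\<lambda>t. f t - g t)) = 0" for b
  proof -
    have "proj {a..b} (\<lambda>t. f t - g t) =\<^sub>a (\<lambda>_. 0)"
      using assms(1) unfolding ae_eq_def proj_diff by (auto elim: eventually_mono simp: proj_def)
    then show ?thesis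
      using L2_norm_sq_eq_0[OF L2_loc_D(2)[OF L2_loc_diff[OF L2_left_loc_D(2)[OF assms(2)] L2_left_loc_D(2)[OF assms(3)]]]] by blast
  qed
  then show ?thesis
    unfolding converges_left_loc_def using a supported_in_cong[OF assms(1) a] by (intro exI[of _ a]) auto
qed

section \<open>Operators on spaces of square integrable functions\<close>

text \<open>Polarization with \<open>x + y\<close> and \<open>x + \<i> *\<^sub>C y\<close>.
  Positivity of an operator is stated through its quadratic form only, and this recovers
  self-adjointness.\<close>

lemma self_adjoint_if_real:
  assumes T: "bounded_clinear T" and real: "\<And>x. Im (cinner (T x) x) = 0"
  shows "cinner (T x) y = cinner x (T y)"
proof -
  interpret T: bounded_linear T using T by (simp add: bounded_clinear_def)
  have TC: "T (c *\<^sub>C x) = c *\<^sub>C T x" for c x using T by (simp add: bounded_clinear_def)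
  have "Im (cinner (T x) y) = - Im (cinner (T y) x)"
    using real[of "x + y"] real[of x] real[of y] by (simp add: T.add cinner_add_left cinner_add_right)
  moreover have "Re (cinner (T x) y) = Re (cinner (T y) x)"
    using real[of "x + \<i> *\<^sub>C y"] real[of x] real[of y]
    by (simp add: T.add TC cinner_add_left cinner_add_right cinner_scaleC_left cinner_scaleC_right)
  ultimately have "cinner (T x) y = cnj (cinner (T y) x)" by (simp add: complex_eq_iff)
  then show ?thesis by (simp only: cinner_commute[symmetric])
qed

lemma L2_rep [simp]: "rep_L2_space x \<in> L2 UNIV" "L2_class (rep_L2_space x) = x"
  using Quotient3_rep_reflp[OF Quotient3_L2_space, of x] Quotient3_abs_rep[OF Quotient3_L2_space, of x]
  by auto

lemma rep_L2_class: "f \<in> L2 UNIV \<Longrightarrow> rep_L2_space (L2_class f) =\<^sub>a f"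
  using L2_class_eq_iff[of "rep_L2_space (L2_class f)" f] by simp

lemma L2_class_cong: "f =\<^sub>a g \<Longrightarrow> f \<in> L2 UNIV \<Longrightarrow> g \<in> L2 UNIV \<Longrightarrow> L2_class f = L2_class g"
  by (simp add: L2_class_eq_iff)

lemma L2_inner_proj_left:
  assumes "f \<in> L2 I" "h \<in> L2 UNIV" "I \<in> sets borel"
  shows "L2_inner (proj I h) f = L2_inner h f"
  unfolding L2_inner_def
proof (rule integral_cong_AE)
  note [measurable] = L2_D(1)[OF assms(1)] L2_D(1)[OF assms(2)] assms(3)
  show "(\<lambda>t. cinner (proj I h t) (f t)) \<in> borel_measurable lborel" by measurable
  show "(\<lambda>t. cinner (h t) (f t)) \<in> borel_measurable lborel" by measurable
  show "AE t in lborel. cinner (proj I h t) (f t) = cinner (h t) (f t)"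
    using L2_D(3)[OF assms(1)] unfolding supported_in_def
    by (auto elim!: eventually_mono simp: proj_def indicator_def)
qed

lemma L2_inner_proj_right:
  assumes "f \<in> L2 I" "h \<in> L2 UNIV" "I \<in> sets borel"
  shows "L2_inner f (proj I h) = L2_inner f h"
  using L2_inner_proj_left[OF assms] by (metis L2_inner_commute)

lemma L2_bounded_linear_D:
  assumes "L2_bounded_linear I J T"
  shows "f \<in> L2 I \<Longrightarrow> T f \<in> L2 J"
    and "f \<in> L2 I \<Longrightarrow> g \<in> L2 I \<Longrightarrow> T (\<lambda>t. f t + g t) =\<^sub>a (\<lambda>t. T f t + T g t)"
    and "f \<in> L2 I \<Longrightarrow> T (\<lambda>t. c *\<^sub>C f t) =\<^sub>a (\<lambda>t. c *\<^sub>C T f t)"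
  using assms by (auto simp: L2_bounded_linear_def L2_linear_def)

lemma L2_contraction_imp_bounded: "L2_contraction I J T \<Longrightarrow> L2_bounded_linear I J T"
  unfolding L2_contraction_def L2_bounded_linear_def by (auto intro!: exI[of _ 1])

lemma L2_bounded_linear_diff:
  assumes T: "L2_bounded_linear I J T" and "f \<in> L2 I" "g \<in> L2 I"
  shows "T (\<lambda>t. f t - g t) =\<^sub>a (\<lambda>t. T f t - T g t)"
proof -
  have "(\<lambda>t. f t - g t) \<in> L2 I" by (rule L2_diff[OF assms(2,3)])
  from L2_bounded_linear_D(2)[OF T this assms(3)]
  have "T f =\<^sub>a (\<lambda>t. T (\<lambda>t. f t - g t) t + T g t)" by simp
  then show ?thesis unfolding ae_eq_def by (auto elim: eventually_mono)
qed

lemma L2_bounded_linear_cong: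
  assumes T: "L2_bounded_linear I J T" and fg: "f \<in> L2 I" "g \<in> L2 I" "f =\<^sub>a g"
  shows "T f =\<^sub>a T g"
proof -
  obtain M where M: "\<And>f. f \<in> L2 I \<Longrightarrow> L2_norm_sq (T f) \<le> M * L2_norm_sq f"
    using T by (auto simp: L2_bounded_linear_def)
  have d: "(\<lambda>t. f t - g t) \<in> L2 I" by (rule L2_diff[OF fg(1,2)])
  have "(\<lambda>t. f t - g t) =\<^sub>a (\<lambda>_. 0)" using fg(3) unfolding ae_eq_def by (auto elim: eventually_mono)
  then have "L2_norm_sq (\<lambda>t. f t - g t) = 0" using L2_norm_sq_eq_0[OF d] by simp
  with M[OF d] have "L2_norm_sq (T (\<lambda>t. f t - g t)) = 0"
    using L2_norm_sq_nonneg[of "T (\<lambda>t. f t - g t)"] by simp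
  then have "T (\<lambda>t. f t - g t) =\<^sub>a (\<lambda>_. 0)"
    using L2_norm_sq_eq_0[OF L2_bounded_linear_D(1)[OF T d]] by simp
  from ae_eq_trans[OF ae_eq_sym[OF L2_bounded_linear_diff[OF T fg(1,2)]] this]
  show ?thesis unfolding ae_eq_def by (auto elim: eventually_mono)
qed

text \<open>
  Operators on functions supported in \<open>I\<close> and operators on the Hilbert space of classes
  correspond to each other by precomposition with the projection \<^term>\<open>proj I\<close>.
\<close>

definition L2_lift ::
  "real set \<Rightarrow> ((real \<Rightarrow> 'h::separable_hilbert_space) \<Rightarrow> real \<Rightarrow> 'k::separable_hilbert_space)
    \<Rightarrow> 'h L2_space \<Rightarrow> 'k L2_space"
  where "L2_lift I T x = L2_class (T (proj I (rep_L2_space x)))"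

definition L2_lower ::
  "real set \<Rightarrow> ('h::separable_hilbert_space L2_space \<Rightarrow> 'k::separable_hilbert_space L2_space)
    \<Rightarrow> (real \<Rightarrow> 'h) \<Rightarrow> real \<Rightarrow> 'k"
  where "L2_lower I P f = proj I (rep_L2_space (P (L2_class f)))"

lemma L2_lift_class_proj:
  assumes T: "L2_bounded_linear I J T" and I: "I \<in> sets borel" and f: "f \<in> L2 UNIV"
  shows "L2_lift I T (L2_class f) = L2_class (T (proj I f))"
proof -
  have p: "proj I (rep_L2_space (L2_class f)) \<in> L2 I" "proj I f \<in> L2 I"
    using L2_proj'[OF f I] L2_proj'[OF L2_rep(1) I] by auto
  show ?thesis unfolding L2_lift_def
    by (rule L2_class_cong[OF L2_bounded_linear_cong[OF T p ae_eq_proj[OF rep_L2_class[OF f]]]])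
      (auto intro: L2_UNIV L2_bounded_linear_D(1)[OF T] p)
qed

lemma L2_lift_class:
  assumes T: "L2_bounded_linear I J T" and I: "I \<in> sets borel" and f: "f \<in> L2 I"
  shows "L2_lift I T (L2_class f) = L2_class (T f)"
proof -
  have p: "proj I f \<in> L2 I" by (rule L2_proj'[OF f I])
  have "proj I f =\<^sub>a f" using L2_D(3)[OF f] by (simp add: supported_in_proj_eq)
  from L2_bounded_linear_cong[OF T p f this] show ?thesis
    unfolding L2_lift_class_proj[OF T I L2_UNIV[OF f]]
    by (rule L2_class_cong) (auto intro: L2_UNIV L2_bounded_linear_D(1)[OF T] p f)
qed

lemma bounded_clinear_L2_lift:
  assumes T: "L2_bounded_linear I J T" and I: "I \<in> sets borel"
  shows "bounded_clinear (L2_lift I T)"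
proof -
  obtain M where M: "\<And>f. f \<in> L2 I \<Longrightarrow> L2_norm_sq (T f) \<le> M * L2_norm_sq f"
    using T by (auto simp: L2_bounded_linear_def)
  note in_J = L2_UNIV[OF L2_bounded_linear_D(1)[OF T]]
  show ?thesis
  proof (rule bounded_clinearI[where K = "sqrt \<bar>M\<bar>"])
    fix x y :: "'a L2_space" and c
    obtain f where f: "f \<in> L2 UNIV" "x = L2_class f" using L2_class_cases .
    obtain g where g: "g \<in> L2 UNIV" "y = L2_class g" using L2_class_cases .
    have p: "proj I f \<in> L2 I" "proj I g \<in> L2 I" using L2_proj'[OF _ I] f(1) g(1) by auto
    have "T (proj I (\<lambda>t. f t + g t)) =\<^sub>a (\<lambda>t. T (proj I f) t + T (proj I g) t)"
      unfolding proj_add by (rule L2_bounded_linear_D(2)[OF T p])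
    then show "L2_lift I T (x + y) = L2_lift I T x + L2_lift I T y"
      by (simp add: f g L2_class_add L2_lift_class_proj[OF T I] L2_add in_J p L2_class_eq_iff
          L2_proj'[OF L2_add[OF f(1) g(1)] I])
    have "T (proj I (\<lambda>t. c *\<^sub>C f t)) =\<^sub>a (\<lambda>t. c *\<^sub>C T (proj I f) t)"
      unfolding proj_scaleC by (rule L2_bounded_linear_D(3)[OF T p(1)])
    then show "L2_lift I T (c *\<^sub>C x) = c *\<^sub>C L2_lift I T x"
      by (simp add: f L2_class_scaleC L2_lift_class_proj[OF T I] L2_scaleC in_J p L2_class_eq_iff
          L2_proj'[OF L2_scaleC[OF f(1)] I])
    show "norm (L2_lift I T x) \<le> sqrt \<bar>M\<bar> * norm x"
    proof (rule power2_le_imp_le)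
      have "(norm (L2_lift I T x))\<^sup>2 = L2_norm_sq (T (proj I f))"
        by (simp add: f L2_lift_class_proj[OF T I] norm_L2_class in_J p)
      also have "\<dots> \<le> M * L2_norm_sq (proj I f)" by (rule M[OF p(1)])
      also have "\<dots> \<le> \<bar>M\<bar> * L2_norm_sq f"
        by (intro mult_mono L2_norm_sq_proj_le[OF f(1) I]) auto
      also have "\<dots> = (sqrt \<bar>M\<bar> * norm x)\<^sup>2"
        by (simp add: f norm_L2_class power_mult_distrib)
      finally show "(norm (L2_lift I T x))\<^sup>2 \<le> (sqrt \<bar>M\<bar> * norm x)\<^sup>2" .
    qed simp
  qed
qed

lemma L2_bounded_linear_lower:
  assumes P: "bounded_clinear P" and I: "I \<in> sets borel"
  shows "L2_bounded_linear J I (L2_lower I P)"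
proof -
  interpret P: bounded_linear P using P by (simp add: bounded_clinear_def)
  obtain K where K: "\<And>x. norm (P x) \<le> norm x * K" "K > 0" using P.pos_bounded by blast
  have in_I: "L2_lower I P f \<in> L2 I" for f unfolding L2_lower_def by (rule L2_proj'[OF L2_rep(1) I])
  show ?thesis unfolding L2_bounded_linear_def L2_linear_def
  proof (intro conjI ballI allI exI[of _ "K\<^sup>2"] in_I)
    fix f g :: "real \<Rightarrow> 'a" and c assume f: "f \<in> L2 J"
    have f': "f \<in> L2 UNIV" by (rule L2_UNIV[OF f])
    have "L2_class (rep_L2_space (P (c *\<^sub>C L2_class f))) = L2_class (\<lambda>t. c *\<^sub>C rep_L2_space (P (L2_class f)) t)"
      using P by (simp add: L2_class_scaleC[symmetric] bounded_clinear_def)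
    from iffD1[OF L2_class_eq_iff this]
    have "rep_L2_space (P (c *\<^sub>C L2_class f)) =\<^sub>a (\<lambda>t. c *\<^sub>C rep_L2_space (P (L2_class f)) t)"
      by (simp add: L2_scaleC)
    from ae_eq_proj[OF this, of I] show "L2_lower I P (\<lambda>t. c *\<^sub>C f t) =\<^sub>a (\<lambda>t. c *\<^sub>C L2_lower I P f t)"
      by (simp add: L2_lower_def L2_class_scaleC[symmetric] f' proj_scaleC)
    have "L2_norm_sq (L2_lower I P f) \<le> (norm (P (L2_class f)))\<^sup>2"
      unfolding L2_lower_def using L2_norm_sq_proj_le[OF L2_rep(1) I, of "P (L2_class f)"]
      by (simp add: norm_L2_class[symmetric])
    also have "\<dots> \<le> (norm (L2_class f) * K)\<^sup>2" by (intro power_mono K) simp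
    also have "\<dots> = K\<^sup>2 * L2_norm_sq f" by (simp add: power_mult_distrib norm_L2_class f')
    finally show "L2_norm_sq (L2_lower I P f) \<le> K\<^sup>2 * L2_norm_sq f" .
    assume g: "g \<in> L2 J"
    have g': "g \<in> L2 UNIV" by (rule L2_UNIV[OF g])
    have "L2_class (rep_L2_space (P (L2_class f + L2_class g))) =
        L2_class (\<lambda>t. rep_L2_space (P (L2_class f)) t + rep_L2_space (P (L2_class g)) t)"
      by (simp add: L2_class_add[symmetric] P.add)
    from iffD1[OF L2_class_eq_iff this]
    have "rep_L2_space (P (L2_class f + L2_class g)) =\<^sub>a
        (\<lambda>t. rep_L2_space (P (L2_class f)) t + rep_L2_space (P (L2_class g)) t)"
      by (simp add: L2_add)
    from ae_eq_proj[OF this, of I]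
    show "L2_lower I P (\<lambda>t. f t + g t) =\<^sub>a (\<lambda>t. L2_lower I P f t + L2_lower I P g t)"
      by (simp add: L2_lower_def L2_class_add[symmetric] f' g' proj_add)
  qed
qed

lemma L2_bounded_linear_id: "L2_bounded_linear I I (\<lambda>f. f)"
  unfolding L2_bounded_linear_def L2_linear_def by (auto intro!: exI[of _ 1])

lemma L2_class_lower:
  assumes "I \<in> sets borel"
  shows "L2_class (L2_lower I P f) = L2_lift I (\<lambda>f. f) (P (L2_class f))"
  by (simp add: L2_lower_def L2_lift_def)

text \<open>The choice operator obeys its specification as soon as one witness exists; the witness
  is the Hilbert space adjoint of the lift, cut down to \<open>I\<close>.\<close>

lemma L2_adjoint:
  assumes T: "L2_bounded_linear I J T" and I: "I \<in> sets borel" and J: "J \<in> sets borel"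
  shows "L2_bounded_linear J I (L2_adjoint I J T)"
    and "f \<in> L2 I \<Longrightarrow> g \<in> L2 J \<Longrightarrow> L2_inner (T f) g = L2_inner f (L2_adjoint I J T g)"
proof -
  obtain S where S: "bounded_clinear S" "\<And>x y. cinner (L2_lift I T x) y = cinner x (S y)"
    using adjoint_exists[OF bounded_clinear_L2_lift[OF T I]] by blast
  have "L2_inner (T f) g = L2_inner f (L2_lower I S g)" if f: "f \<in> L2 I" and g: "g \<in> L2 J" for f g
  proof -
    have "L2_inner (T f) g = cinner (L2_lift I T (L2_class f)) (L2_class g)"
      by (simp add: L2_lift_class[OF T I f] cinner_L2_class L2_UNIV[OF L2_bounded_linear_D(1)[OF T f]] L2_UNIV[OF g])
    also have "\<dots> = cinner (L2_class f) (L2_class (rep_L2_space (S (L2_class g))))" by (simp add: S(2))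
    also have "\<dots> = L2_inner f (rep_L2_space (S (L2_class g)))" by (rule cinner_L2_class[OF L2_UNIV[OF f] L2_rep(1)])
    also have "\<dots> = L2_inner f (L2_lower I S g)"
      unfolding L2_lower_def by (rule L2_inner_proj_right[OF f L2_rep(1) I, symmetric])
    finally show ?thesis .
  qed
  then have "\<exists>S. L2_bounded_linear J I S \<and> (\<forall>f\<in>L2 I. \<forall>g\<in>L2 J. L2_inner (T f) g = L2_inner f (S g))"
    using L2_bounded_linear_lower[OF S(1) I] by blast
  from someI_ex[OF this]
  show "L2_bounded_linear J I (L2_adjoint I J T)"
    and "f \<in> L2 I \<Longrightarrow> g \<in> L2 J \<Longrightarrow> L2_inner (T f) g = L2_inner f (L2_adjoint I J T g)"
    unfolding L2_adjoint_def by blast+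
qed

text \<open>Again only existence is at stake. \<open>K\<close> represents \<open>T\<close>-adjoint
  times \<open>T\<close> on all classes, and the square root of \<open>1 - K\<close> is lowered to
  functions on \<open>I\<close>. For its square to be computed there, the root must preserve classes
  supported in \<open>I\<close>.\<close>

lemma defect_operator:
  assumes T: "L2_contraction I J T" and I: "I \<in> sets borel" and J: "J \<in> sets borel"
  shows "L2_positive I (defect_operator I J T)"
    and "f \<in> L2 I \<Longrightarrow> defect_operator I J T (defect_operator I J T f) =\<^sub>a (\<lambda>t. f t - L2_adjoint I J T (T f) t)"
proof -
  note Tb = L2_contraction_imp_bounded[OF T]
  define U where "U = L2_lift I T"
  have U: "bounded_clinear U" unfolding U_def by (rule bounded_clinear_L2_lift[OF Tb I])
  have U_class: "U (L2_class f) = L2_class (T (proj I f))" if "f \<in> L2 UNIV" for f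
    unfolding U_def by (rule L2_lift_class_proj[OF Tb I that])
  have U_norm: "norm (U x) \<le> norm x" for x
  proof (rule power2_le_imp_le)
    obtain f where f: "f \<in> L2 UNIV" "x = L2_class f" using L2_class_cases .
    have p: "proj I f \<in> L2 I" by (rule L2_proj'[OF f(1) I])
    have "(norm (U x))\<^sup>2 = L2_norm_sq (T (proj I f))"
      by (simp add: f U_class norm_L2_class L2_UNIV[OF L2_bounded_linear_D(1)[OF Tb p]])
    also have "\<dots> \<le> L2_norm_sq (proj I f)" using T p by (simp add: L2_contraction_def)
    also have "\<dots> \<le> L2_norm_sq f" by (rule L2_norm_sq_proj_le[OF f(1) I])
    finally show "(norm (U x))\<^sup>2 \<le> (norm x)\<^sup>2" by (simp add: f norm_L2_class)
  qed simp
  obtain S where S: "bounded_clinear S" "\<And>x y. cinner (U x) y = cinner x (S y)"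
    using adjoint_exists[OF U] by blast
  have S_norm: "norm (S y) \<le> norm y" for y
  proof (cases "S y = 0")
    case False
    have "(norm (S y))\<^sup>2 = cmod (cinner (U (S y)) y)" by (simp add: S(2) cinner_self norm_power)
    also have "\<dots> \<le> norm (U (S y)) * norm y" by (rule norm_cinner_le)
    also have "\<dots> \<le> norm (S y) * norm y" by (intro mult_right_mono U_norm) simp
    finally show ?thesis using False by (simp add: power2_eq_square)
  qed simp
  define K where "K x = S (U x)" for x
  have K: "bounded_clinear K"
    using S(1) U unfolding K_def bounded_clinear_def by (auto intro: bounded_linear_compose)
  have K_norm: "norm (K x) \<le> norm x" for x
    unfolding K_def by (rule order_trans[OF S_norm U_norm])
  have K_inner: "cinner x (K y) = cinner (U x) (U y)" for x y unfolding K_def by (simp add: S(2))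
  have K_sa: "cinner (K x) y = cinner x (K y)" for x y
    by (subst cinner_commute) (simp add: K_inner cinner_commute[symmetric])
  \<comment> \<open>The projection onto classes supported in \<open>I\<close>. It commutes with
    \<open>K\<close>, therefore also with the square root.\<close>
  define E where "E = L2_lift I (\<lambda>f :: real \<Rightarrow> 'a. f)"
  have E: "bounded_clinear E" unfolding E_def by (rule bounded_clinear_L2_lift[OF L2_bounded_linear_id I])
  have E_class: "E (L2_class f) = L2_class (proj I f)" if "f \<in> L2 UNIV" for f
    unfolding E_def by (rule L2_lift_class_proj[OF L2_bounded_linear_id I that])
  have E_I: "E (L2_class f) = L2_class f" if "f \<in> L2 I" for f
    unfolding E_def by (rule L2_lift_class[OF L2_bounded_linear_id I that])
  have U_E: "U (E x) = U x" for x
  proof -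
    obtain f where f: "f \<in> L2 UNIV" "x = L2_class f" using L2_class_cases .
    show ?thesis by (simp add: f E_class U_class L2_proj''[OF f(1) I] proj_proj)
  qed
  have E_sa: "cinner (E x) y = cinner x (E y)" for x y
  proof -
    obtain f where f: "f \<in> L2 UNIV" "x = L2_class f" using L2_class_cases .
    obtain g where g: "g \<in> L2 UNIV" "y = L2_class g" using L2_class_cases .
    have p: "proj I f \<in> L2 I" "proj I g \<in> L2 I" using L2_proj'[OF _ I] f(1) g(1) by auto
    have "L2_inner (proj I f) g = L2_inner f (proj I g)"
      using L2_inner_proj_right[OF p(1) g(1) I] L2_inner_proj_left[OF p(2) f(1) I] by simp
    then show ?thesis by (simp add: f g E_class cinner_L2_class L2_UNIV[OF p(1)] L2_UNIV[OF p(2)])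
  qed
  have E_K: "E (K x) = K (E x)" for x
    by (rule cinner_eqI_right) (simp add: E_sa[symmetric] K_inner U_E)
  have "\<exists>Q. bounded_clinear Q \<and> (\<forall>x. Q (Q x) = x - K x) \<and> (\<forall>x. Im (cinner (Q x) x) = 0) \<and>
      (\<forall>x. 0 \<le> Re (cinner (Q x) x)) \<and> (\<forall>x. E (Q x) = Q (E x))"
  proof (rule sqrt_one_minus_contraction[OF K K_norm K_sa])
    fix Q assume Q: "bounded_clinear Q" "\<And>x. Q (Q x) = x - K x" "\<And>x. Im (cinner (Q x) x) = 0"
      "\<And>x. 0 \<le> Re (cinner (Q x) x)"
      "\<And>P x. bounded_clinear P \<Longrightarrow> (\<And>x. P (K x) = K (P x)) \<Longrightarrow> P (Q x) = Q (P x)"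
    show ?thesis using Q(1-4) Q(5)[OF E E_K] by (intro exI[of _ Q] conjI allI)
  qed
  then obtain Q where Q: "bounded_clinear Q" "\<And>x. Q (Q x) = x - K x"
    "\<And>x. Im (cinner (Q x) x) = 0" "\<And>x. 0 \<le> Re (cinner (Q x) x)" "\<And>x. E (Q x) = Q (E x)"
    by (elim exE conjE) (erule that; simp)
  have lower_class: "L2_class (L2_lower I Q f) = Q (L2_class f)" if "f \<in> L2 I" for f
    using Q(5)[of "L2_class f"]
    by (simp add: L2_class_lower[OF I] E_def[symmetric] E_I that)
  note lower = L2_bounded_linear_lower[OF Q(1) I, of I]
  have K_class: "K (L2_class f) = L2_class (L2_adjoint I J T (T f))" if f: "f \<in> L2 I" for f
  proof (rule cinner_eqI_right)
    fix z :: "'a L2_space"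
    obtain h where h: "h \<in> L2 UNIV" "z = L2_class h" using L2_class_cases .
    have ph: "proj I h \<in> L2 I" by (rule L2_proj'[OF h(1) I])
    have Tf: "T f \<in> L2 J" "T (proj I h) \<in> L2 J" using L2_bounded_linear_D(1)[OF Tb] f ph by auto
    have TTf: "L2_adjoint I J T (T f) \<in> L2 I" by (rule L2_bounded_linear_D(1)[OF L2_adjoint(1)[OF Tb I J] Tf(1)])
    have "cinner z (K (L2_class f)) = L2_inner (T (proj I h)) (T f)"
      unfolding K_inner h using L2_lift_class[OF Tb I f]
      by (simp add: U_class h U_def[symmetric] cinner_L2_class L2_UNIV[OF Tf(1)] L2_UNIV[OF Tf(2)])
    also have "\<dots> = L2_inner (proj I h) (L2_adjoint I J T (T f))" by (rule L2_adjoint(2)[OF Tb I J ph Tf(1)])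
    also have "\<dots> = L2_inner h (L2_adjoint I J T (T f))" by (rule L2_inner_proj_left[OF TTf h(1) I])
    also have "\<dots> = cinner z (L2_class (L2_adjoint I J T (T f)))"
      by (simp add: h cinner_L2_class L2_UNIV[OF TTf])
    finally show "cinner z (K (L2_class f)) = cinner z (L2_class (L2_adjoint I J T (T f)))" .
  qed
  have "L2_positive I (L2_lower I Q)"
    unfolding L2_positive_def
  proof (intro conjI ballI lower)
    fix f :: "real \<Rightarrow> 'a" assume f: "f \<in> L2 I"
    have "L2_inner (L2_lower I Q f) f = cinner (Q (L2_class f)) (L2_class f)"
      unfolding lower_class[OF f, symmetric]
      by (simp add: cinner_L2_class L2_UNIV[OF f] L2_UNIV[OF L2_bounded_linear_D(1)[OF lower f]])
    then show "Im (L2_inner (L2_lower I Q f) f) = 0" "0 \<le> Re (L2_inner (L2_lower I Q f) f)"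
      using Q(3,4) by auto
  qed
  moreover have "L2_lower I Q (L2_lower I Q f) =\<^sub>a (\<lambda>t. f t - L2_adjoint I J T (T f) t)" if f: "f \<in> L2 I" for f
  proof -
    have l: "L2_lower I Q f \<in> L2 I" by (rule L2_bounded_linear_D(1)[OF lower f])
    have TTf: "L2_adjoint I J T (T f) \<in> L2 I"
      by (rule L2_bounded_linear_D(1)[OF L2_adjoint(1)[OF Tb I J] L2_bounded_linear_D(1)[OF Tb f]])
    have "L2_class (L2_lower I Q (L2_lower I Q f)) = L2_class f - L2_class (L2_adjoint I J T (T f))"
      by (simp add: lower_class[OF l] lower_class[OF f] Q(2) K_class[OF f])
    then show ?thesis
      by (simp add: L2_class_diff L2_class_eq_iff L2_diff L2_UNIV[OF f] L2_UNIV[OF TTf]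
          L2_UNIV[OF L2_bounded_linear_D(1)[OF lower l]])
  qed
  ultimately have "\<exists>Q. L2_positive I Q \<and> (\<forall>f\<in>L2 I. Q (Q f) =\<^sub>a (\<lambda>t. f t - L2_adjoint I J T (T f) t))"
    by blast
  from someI_ex[OF this]
  show "L2_positive I (defect_operator I J T)"
    and "f \<in> L2 I \<Longrightarrow> defect_operator I J T (defect_operator I J T f) =\<^sub>a (\<lambda>t. f t - L2_adjoint I J T (T f) t)"
    unfolding defect_operator_def L2_sqrt_def by blast+
qed

text \<open>Whichever root the choice operator returns, it is self-adjoint, so the squared norm is
  the pairing of \<open>f\<close> with the square of the root at \<open>f\<close>. From here on the
  defect operator is used only through this formula.\<close>

lemma L2_norm_sq_defect_operator:
  assumes T: "L2_contraction I J T" and I: "I \<in> sets borel" and J: "J \<in> sets borel" and f: "f \<in> L2 I"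
  shows "L2_norm_sq (defect_operator I J T f) = L2_norm_sq f - L2_norm_sq (T f)"
proof -
  note Tb = L2_contraction_imp_bounded[OF T]
  define R where "R = defect_operator I J T"
  have R: "L2_bounded_linear I I R" "\<And>f. f \<in> L2 I \<Longrightarrow> Im (L2_inner (R f) f) = 0"
    using defect_operator(1)[OF T I J] by (auto simp: L2_positive_def R_def)
  have Rf: "R f \<in> L2 I" by (rule L2_bounded_linear_D(1)[OF R(1) f])
  have RRf: "R (R f) \<in> L2 I" by (rule L2_bounded_linear_D(1)[OF R(1) Rf])
  have Tf: "T f \<in> L2 J" by (rule L2_bounded_linear_D(1)[OF Tb f])
  have TTf: "L2_adjoint I J T (T f) \<in> L2 I" by (rule L2_bounded_linear_D(1)[OF L2_adjoint(1)[OF Tb I J] Tf])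
  have real: "Im (cinner (L2_lift I R x) x) = 0" for x
  proof -
    obtain g where g: "g \<in> L2 UNIV" "x = L2_class g" using L2_class_cases .
    have p: "proj I g \<in> L2 I" by (rule L2_proj'[OF g(1) I])
    have Rp: "R (proj I g) \<in> L2 I" by (rule L2_bounded_linear_D(1)[OF R(1) p])
    have "cinner (L2_lift I R x) x = L2_inner (R (proj I g)) g"
      by (simp add: g L2_lift_class_proj[OF R(1) I] cinner_L2_class L2_UNIV[OF Rp])
    also have "\<dots> = L2_inner (R (proj I g)) (proj I g)" by (rule L2_inner_proj_right[OF Rp g(1) I, symmetric])
    finally show ?thesis using R(2)[OF p] by simp
  qed
  have "complex_of_real (L2_norm_sq (R f)) = cinner (L2_lift I R (L2_class f)) (L2_class (R f))"
    by (simp add: L2_lift_class[OF R(1) I f] cinner_L2_class L2_UNIV[OF Rf] L2_inner_self)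
  also have "\<dots> = cinner (L2_class f) (L2_lift I R (L2_class (R f)))"
    by (rule self_adjoint_if_real[OF bounded_clinear_L2_lift[OF R(1) I] real])
  also have "L2_lift I R (L2_class (R f)) = L2_class (R (R f))" by (rule L2_lift_class[OF R(1) I Rf])
  also have "\<dots> = L2_class f - L2_class (L2_adjoint I J T (T f))"
    using defect_operator(2)[OF T I J f]
    by (simp add: R_def[symmetric] L2_class_diff L2_class_eq_iff L2_diff L2_UNIV[OF f] L2_UNIV[OF TTf] L2_UNIV[OF RRf])
  also have "cinner (L2_class f) \<dots> = L2_inner f f - L2_inner (T f) (T f)"
    unfolding L2_adjoint(2)[OF Tb I J f Tf]
    by (simp add: cinner_diff_right cinner_L2_class L2_UNIV[OF f] L2_UNIV[OF TTf])
  also have "\<dots> = complex_of_real (L2_norm_sq f - L2_norm_sq (T f))" by (simp add: L2_inner_self)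
  finally show ?thesis unfolding R_def of_real_eq_iff .
qed

lemma L2_contraction_diff_le:
  assumes T: "L2_contraction I J T" and f: "f \<in> L2 I" and g: "g \<in> L2 I"
  shows "L2_norm_sq (\<lambda>t. T f t - T g t) \<le> L2_norm_sq (\<lambda>t. f t - g t)"
proof -
  note Tb = L2_contraction_imp_bounded[OF T]
  have d: "(\<lambda>t. f t - g t) \<in> L2 I" by (rule L2_diff[OF f g])
  have "L2_norm_sq (\<lambda>t. T f t - T g t) = L2_norm_sq (T (\<lambda>t. f t - g t))"
    by (rule L2_norm_sq_cong[OF _ _ ae_eq_sym[OF L2_bounded_linear_diff[OF Tb f g]]])
      (auto intro!: L2_D(1)[of _ J] L2_diff L2_bounded_linear_D(1)[OF Tb] f g d)
  also have "\<dots> \<le> L2_norm_sq (\<lambda>t. f t - g t)" using T d by (simp add: L2_contraction_def)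
  finally show ?thesis .
qed

section \<open>Well-posed systems\<close>

locale well_posed =
  fixes \<Sigma> :: "('u::separable_hilbert_space, 'x::separable_hilbert_space, 'y::separable_hilbert_space) system"
  assumes well_posed: "well_posed_system \<Sigma>"
begin

abbreviation "A \<equiv> semigroup_op \<Sigma>"
abbreviation "B \<equiv> input_map \<Sigma>"
abbreviation "C \<equiv> output_map \<Sigma>"
abbreviation "D \<equiv> io_map \<Sigma>"

lemma semigroup: "C0_semigroup A"
  using well_posed by (simp add: well_posed_system_def)

lemma B_add: "u \<in> L2_left {..<0} \<Longrightarrow> v \<in> L2_left {..<0} \<Longrightarrow> B (\<lambda>t. u t + v t) = B u + B v"
  using well_posed by (simp add: well_posed_system_def continuous_linear_input_map_def)

lemma B_scaleC: "u \<in> L2_left {..<0} \<Longrightarrow> B (\<lambda>t. c *\<^sub>C u t) = c *\<^sub>C B u"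
  using well_posed by (simp add: well_posed_system_def continuous_linear_input_map_def)

lemma B_tendsto:
  "(\<And>k. z k \<in> L2_left {..<0}) \<Longrightarrow> z0 \<in> L2_left {..<0} \<Longrightarrow> converges_left_loc z z0 \<Longrightarrow> (\<lambda>k. B (z k)) \<longlonglongrightarrow> B z0"
  using well_posed by (simp add: well_posed_system_def continuous_linear_input_map_def)

lemma C_plus_loc: "C x \<in> L2_plus_loc"
  using well_posed by (simp add: well_posed_system_def continuous_linear_output_map_def)

lemma C_add: "C (x + x') =\<^sub>a (\<lambda>t. C x t + C x' t)"
  using well_posed by (simp add: well_posed_system_def continuous_linear_output_map_def)

lemma C_tendsto: "z \<longlonglongrightarrow> z0 \<Longrightarrow> converges_left_loc (\<lambda>k. C (z k)) (C z0)"
  using well_posed by (simp add: well_posed_system_def continuous_linear_output_map_def)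

lemma D_left_loc: "u \<in> L2_left_loc \<Longrightarrow> D u \<in> L2_left_loc"
  using well_posed by (simp add: well_posed_system_def continuous_linear_io_map_def)

lemma D_add: "u \<in> L2_left_loc \<Longrightarrow> v \<in> L2_left_loc \<Longrightarrow> D (\<lambda>t. u t + v t) =\<^sub>a (\<lambda>t. D u t + D v t)"
  using well_posed by (simp add: well_posed_system_def continuous_linear_io_map_def)

lemma D_scaleC: "u \<in> L2_left_loc \<Longrightarrow> D (\<lambda>t. c *\<^sub>C u t) =\<^sub>a (\<lambda>t. c *\<^sub>C D u t)"
  using well_posed by (simp add: well_posed_system_def continuous_linear_io_map_def)

lemma D_tendsto:
  "(\<And>k. z k \<in> L2_left_loc) \<Longrightarrow> z0 \<in> L2_left_loc \<Longrightarrow> converges_left_loc z z0 \<Longrightarrow>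
    converges_left_loc (\<lambda>k. D (z k)) (D z0)"
  using well_posed by (simp add: well_posed_system_def continuous_linear_io_map_def)

lemma A_B: "t \<ge> 0 \<Longrightarrow> u \<in> L2_left {..<0} \<Longrightarrow> blinfun_apply (A t) (B u) = B (shift_minus t u)"
  using well_posed by (simp add: well_posed_system_def)

lemma C_A: "t \<ge> 0 \<Longrightarrow> C (blinfun_apply (A t) x) =\<^sub>a shift_plus t (C x)"
  using well_posed by (simp add: well_posed_system_def)

lemma D_shift: "u \<in> L2_left_loc \<Longrightarrow> shift t (D u) =\<^sub>a D (shift t u)"
  using well_posed by (simp add: well_posed_system_def)

lemma D_causal_0: "u \<in> L2_left_loc \<Longrightarrow> proj {..<0} (D (proj {0..} u)) =\<^sub>a (\<lambda>_. 0)"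
  using well_posed by (simp add: well_posed_system_def)

lemma D_past: "u \<in> L2_left_loc \<Longrightarrow> proj {0..} (D (proj {..<0} u)) =\<^sub>a C (B (proj {..<0} u))"
  using well_posed by (simp add: well_posed_system_def)

lemma D_measurable [measurable]: "u \<in> L2_left_loc \<Longrightarrow> D u \<in> borel_measurable borel"
  using L2_left_loc_D(1)[OF D_left_loc] .

lemma C_measurable [measurable]: "C x \<in> borel_measurable borel"
  using C_plus_loc[of x] by (auto simp: L2_plus_loc_def dest: L2_loc_D(1))

lemma D_cong:
  assumes "u =\<^sub>a v" "u \<in> L2_left_loc" "v \<in> L2_left_loc"
  shows "D u =\<^sub>a D v"
  by (rule converges_left_loc_const[OF D_tendsto[OF assms(2,3) converges_left_loc_ae_eq[OF assms]]])
    (use D_left_loc assms L2_left_loc_D(2) in auto)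

lemma B_cong:
  assumes "u =\<^sub>a v" "u \<in> L2_left {..<0}" "v \<in> L2_left {..<0}"
  shows "B u = B v"
  using B_tendsto[OF assms(2,3) converges_left_loc_ae_eq[OF assms(1) L2_left_imp_loc[OF assms(2)] L2_left_imp_loc[OF assms(3)]]]
  by (simp add: LIMSEQ_const_iff)

lemma L2_left_zero: "(\<lambda>_. 0) \<in> L2_left J"
  by (simp add: L2_left_def left_bounded_def supported_in_def)

lemma B_zero: "B (\<lambda>_. 0) = 0"
  using B_scaleC[OF L2_left_zero, of 0] by simp

lemma C_zero: "C 0 =\<^sub>a (\<lambda>_. 0)"
proof -
  have "C (0 + 0) =\<^sub>a (\<lambda>t. C 0 t + C 0 t)" by (rule C_add)
  then show ?thesis unfolding ae_eq_def by (auto elim: eventually_mono)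
qed

section \<open>Causality of the input-output map\<close>

lemma past_future: "u = (\<lambda>t. proj {..<s} u t + proj {s..} u t)"
  by (auto simp: proj_def indicator_def fun_eq_iff)

lemma D_split:
  assumes "u \<in> L2_left_loc"
  shows "D u =\<^sub>a (\<lambda>t. D (proj {..<s} u) t + D (proj {s..} u) t)"
  by (subst past_future[of u s], rule D_add) (intro L2_left_loc_proj assms; simp)+

text \<open>Time invariance carries the causality axiom from time 0 to time
  \<open>s\<close>.\<close>

lemma D_causal_past:
  assumes u: "u \<in> L2_left_loc"
  shows "proj {..<s} (D (proj {s..} u)) =\<^sub>a (\<lambda>_. 0)"
proof -
  have m: "proj {s..} u \<in> L2_left_loc" by (intro L2_left_loc_proj u) simp
  have "shift s (proj {s..} u) = proj {0..} (shift s u)"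
    unfolding shift_proj by (rule arg_cong[where f = "\<lambda>J. proj J _"]) auto
  then have "proj {..<0} (shift s (D (proj {s..} u))) =\<^sub>a proj {..<0} (D (proj {0..} (shift s u)))"
    using ae_eq_proj[OF D_shift[OF m, of s], of "{..<0}"] by simp
  also have "\<dots> =\<^sub>a (\<lambda>_. 0)" by (rule D_causal_0[OF L2_left_loc_shift[OF u]])
  finally have "shift (- s) (proj {..<0} (shift s (D (proj {s..} u)))) =\<^sub>a shift (- s) (\<lambda>_. 0)"
    using m by (intro ae_eq_shift) (auto intro!: measurable_proj measurable_shift D_measurable)
  moreover have "shift (- s) (proj {..<0} (shift s (D (proj {s..} u)))) = proj {..<s} (D (proj {s..} u))"
    by (auto simp: shift_def proj_def indicator_def)
  ultimately show ?thesis by (simp add: shift_def)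
qed

lemma D_causal:
  assumes u: "u \<in> L2_left_loc"
  shows "proj {..<s} (D u) =\<^sub>a proj {..<s} (D (proj {..<s} u))"
proof -
  have "proj {..<s} (D u) =\<^sub>a (\<lambda>t. proj {..<s} (D (proj {..<s} u)) t + proj {..<s} (D (proj {s..} u)) t)"
    using ae_eq_proj[OF D_split[OF u]] by (simp add: proj_add)
  also have "\<dots> =\<^sub>a (\<lambda>t. proj {..<s} (D (proj {..<s} u)) t + 0)"
    by (intro ae_eq_add D_causal_past u) simp
  finally show ?thesis by simp
qed

lemma D_causal_cong:
  assumes u: "u \<in> L2_left_loc" and v: "v \<in> L2_left_loc" and eq: "proj {..<s} u =\<^sub>a proj {..<s} v"
  shows "proj {..<s} (D u) =\<^sub>a proj {..<s} (D v)"
proof -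
  have "proj {..<s} (D u) =\<^sub>a proj {..<s} (D (proj {..<s} u))" by (rule D_causal[OF u])
  also have "\<dots> =\<^sub>a proj {..<s} (D (proj {..<s} v))"
    by (intro ae_eq_proj D_cong eq L2_left_loc_proj u v) auto
  also have "\<dots> =\<^sub>a proj {..<s} (D v)" by (rule ae_eq_sym[OF D_causal[OF v]])
  finally show ?thesis .
qed

lemma D_supported:
  assumes u: "u \<in> L2_left_loc" and supp: "supported_in {s..} u"
  shows "supported_in {s..} (D u)"
proof -
  have "D (proj {s..} u) =\<^sub>a D u"
    using supp by (intro D_cong L2_left_loc_proj u) (auto simp: supported_in_proj_eq)
  from ae_eq_trans[OF ae_eq_sym[OF ae_eq_proj[OF this]] D_causal_past[OF u]]
  have "proj {..<s} (D u) =\<^sub>a (\<lambda>_. 0)" .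
  then show ?thesis
    unfolding supported_in_def ae_eq_def by (auto elim!: eventually_mono simp: proj_def split: split_indicator_asm)
qed

lemma D_proj_tendsto:
  assumes f: "\<And>n. f n \<in> L2 {0..}" and g: "g \<in> L2 {0..}"
    and lim: "(\<lambda>n. L2_norm_sq (\<lambda>t. f n t - g t)) \<longlonglongrightarrow> 0"
  shows "(\<lambda>n. L2_norm_sq (proj {0..S} (D (f n)))) \<longlonglongrightarrow> L2_norm_sq (proj {0..S} (D g))"
proof -
  have supp: "supported_in {-1<..} h" "h \<in> L2_left_loc" if "h \<in> L2 {0..}" for h :: "real \<Rightarrow> 'u"
  proof -
    show s: "supported_in {-1<..} h" by (rule supported_in_mono[OF L2_D(3)[OF that]]) auto
    show "h \<in> L2_left_loc" using s L2_imp_L2_loc[OF that] by (auto simp: L2_left_loc_def left_bounded_def)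
  qed
  have "converges_left_loc f g"
    by (rule converges_left_locI[OF L2_UNIV[OF f] L2_UNIV[OF g] supp(1)[OF f] supp(1)[OF g] lim])
  then have "converges_left_loc (\<lambda>n. D (f n)) (D g)" by (intro D_tendsto supp f g)
  then have "(\<lambda>n. L2_norm_sq (proj {0..S} (\<lambda>t. D (f n) t - D g t))) \<longlonglongrightarrow> 0"
    by (rule converges_left_loc_proj[where b = S]) (auto intro!: L2_left_loc_D(2) D_left_loc supp f g)
  then show ?thesis
    unfolding proj_diff
    by (intro L2_norm_sq_tendsto L2_loc_D(2) L2_left_loc_D(2) D_left_loc supp f g)
qed

end

section \<open>Passivity\<close>

locale schur_system = well_posed \<Sigma>
  for \<Sigma> :: "('u::separable_hilbert_space, 'x::separable_hilbert_space, 'y::separable_hilbert_space) system" +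
  fixes G :: "complex \<Rightarrow> ('u \<Rightarrow>\<^sub>L 'y)"
  assumes transfer: "is_transfer_function \<Sigma> G"
    and schur: "transfer_function_in_schur_class \<Sigma> G"
begin

text \<open>The Schur function and the transfer function agree to the right of both 0 and the growth
  bound. Only real points are needed later, so all that is kept is an integer beyond that bound,
  which exists because the growth bound is not plus infinity.\<close>

lemma transfer_at_reals:
  obtains F N where "F \<in> schur_class" "N > (0::nat)"
    "\<And>u a. u \<in> L2 {0..} \<Longrightarrow> a \<ge> real N \<Longrightarrow> set_integrable lborel {0..} (laplace_integrand (D u) (complex_of_real a))"
    "\<And>u a. u \<in> L2 {0..} \<Longrightarrow> a \<ge> real N \<Longrightarrow>
      laplace (D u) (complex_of_real a) = blinfun_apply (F (complex_of_real a)) (laplace u (complex_of_real a))"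
proof -
  obtain F where F: "F \<in> schur_class"
    "\<And>z. z \<in> right_half_plane (growth_bound A) \<inter> right_half_plane 0 \<Longrightarrow> F z = G z"
    using schur by (auto simp: transfer_function_in_schur_class_def)
  have "growth_bound A \<noteq> \<infinity>" using growth_bound_less_top[OF semigroup] by auto
  then obtain n :: nat where n: "growth_bound A < ereal (real n)" by (auto simp: less_PInf_Ex_of_nat)
  \<comment> \<open>\<open>Suc n\<close> instead of \<open>n\<close>: half-planes are open, and the
    points must be positive.\<close>
  have *: "set_integrable lborel {0..} (laplace_integrand (D u) (complex_of_real a)) \<and>
      laplace (D u) (complex_of_real a) = blinfun_apply (F (complex_of_real a)) (laplace u (complex_of_real a))"
    if u: "u \<in> L2 {0..}" and a: "a \<ge> real (Suc n)" for u a
  proof -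
    have "(\<lambda>t. exp (- real n * t) *\<^sub>R u t) \<in> L2 {0..}"
    proof (rule L2_I)
      note [measurable] = L2_D(1)[OF u]
      show "integrable lborel (\<lambda>t. (norm (exp (- real n * t) *\<^sub>R u t))\<^sup>2)"
      proof (rule Bochner_Integration.integrable_bound[OF L2_D(2)[OF u]])
        show "AE t in lborel. norm ((norm (exp (- real n * t) *\<^sub>R u t))\<^sup>2) \<le> norm ((norm (u t))\<^sup>2)"
          using L2_D(3)[OF u] unfolding supported_in_def
        proof eventually_elim
          case (elim t)
          show ?case
          proof (cases "t \<ge> 0")
            case True
            then have "exp (- real n * t) * norm (u t) \<le> 1 * norm (u t)" by (intro mult_right_mono) auto
            then show ?thesis by (simp add: power_mono)
          qed (use elim in simp)
        qed
      qed measurable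
      show "supported_in {0..} (\<lambda>t. exp (- real n * t) *\<^sub>R u t)"
        using L2_D(3)[OF u] unfolding supported_in_def by (auto elim: eventually_mono)
    qed (use L2_D(1)[OF u] in measurable)
    moreover have "complex_of_real a \<in> right_half_plane (ereal (real n))"
      using a by (simp add: right_half_plane_def)
    moreover have "F (complex_of_real a) = G (complex_of_real a)"
    proof (rule F(2))
      have "growth_bound A < ereal a" using n a by (meson ereal_less(2) ereal_less_eq(3) le_less_trans less_imp_le less_le_trans of_nat_less_iff lessI)
      then show "complex_of_real a \<in> right_half_plane (growth_bound A) \<inter> right_half_plane 0"
        using a by (simp add: right_half_plane_def zero_ereal_def)
    qed
    ultimately show ?thesis
      using transfer n unfolding is_transfer_function_def by simp
  qed
  show thesis by (rule that[of F "Suc n", OF F(1)]) (use * in auto)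
qed

text \<open>Pairing \<open>D u\<close> with \<open>exp (- a * t)\<close> gives the Laplace transform
  at \<open>a\<close>, hence the Schur function at \<open>a\<close> applied to the transform of
  \<open>u\<close>, a sum of \<open>1 / (a + b)\<close> over the exponents \<open>b\<close> of
  \<open>u\<close>. The outcome is exactly the left side of the Pick inequality, and the right side
  consists of the two Gram sums.\<close>

lemma exp_sums_pairing:
  fixes F :: "complex \<Rightarrow> ('u \<Rightarrow>\<^sub>L 'y)"
  assumes F: "F \<in> schur_class" and N: "N > 0"
    and int: "\<And>a. a \<ge> real N \<Longrightarrow> set_integrable lborel {0..} (laplace_integrand (D u) (complex_of_real a))"
    and lap: "\<And>a. a \<ge> real N \<Longrightarrow>
      laplace (D u) (complex_of_real a) = blinfun_apply (F (complex_of_real a)) (laplace u (complex_of_real a))"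
    and u: "u \<in> exp_sums N" and g: "g \<in> exp_sums N"
  shows "integrable lborel (\<lambda>t. cinner (D u t) (g t))"
    and "2 * Re (L2_inner (D u) g) \<le> L2_norm_sq u + L2_norm_sq g"
proof -
  obtain K p q where pq: "u = exp_sum N K p" "g = exp_sum N K q" using exp_sums_common_degree[OF u g] .
  define a where "a k = real (N + k)" for k
  define \<phi> where "\<phi> k t = indicator {0..} t *\<^sub>R laplace_integrand (D u) (complex_of_real (a k)) t" for k t
  have int': "integrable lborel (\<phi> k)" for k
    using int[of "a k"] unfolding set_integrable_def \<phi>_def by (simp add: a_def)
  have eq: "cinner (D u t) (g t) = (\<Sum>k\<le>K. cinner (\<phi> k t) (q k))" for t
  proof -
    have "\<phi> k t = (indicator {0..} t * exp (- a k * t)) *\<^sub>R D u t" for k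
      by (simp only: \<phi>_def laplace_integrand_of_real scaleR_scaleR)
    then show ?thesis
      by (simp add: pq(2) exp_sum_def cinner_sum_right cinner_scaleR_left cinner_scaleR_right a_def)
  qed
  have bl: "bounded_linear (\<lambda>x. cinner x (q k))" for k
    by (rule bounded_bilinear.bounded_linear_left[OF bounded_bilinear_cinner])
  have int2: "integrable lborel (\<lambda>t. cinner (\<phi> k t) (q k))" for k
    by (rule integrable_bounded_linear[OF bl int'])
  show "integrable lborel (\<lambda>t. cinner (D u t) (g t))" unfolding eq using int2 by simp
  have "L2_inner (D u) g = (\<Sum>k\<le>K. LINT t|lborel. cinner (\<phi> k t) (q k))"
    unfolding L2_inner_def eq using int2 by simp
  also have "\<dots> = (\<Sum>k\<le>K. cinner (LINT t|lborel. \<phi> k t) (q k))"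
    by (intro sum.cong refl integral_bounded_linear[OF bl int'])
  also have "\<dots> = (\<Sum>k\<le>K. cinner (laplace (D u) (complex_of_real (a k))) (q k))"
    by (simp add: laplace_def set_lebesgue_integral_def \<phi>_def)
  also have "\<dots> = (\<Sum>k\<le>K. cinner (blinfun_apply (F (complex_of_real (a k))) (\<Sum>j\<le>K. (1 / (a k + a j)) *\<^sub>R p j)) (q k))"
  proof (intro sum.cong refl)
    fix k
    have "a k \<ge> real N" "a k > 0" using N by (auto simp: a_def)
    then show "cinner (laplace (D u) (complex_of_real (a k))) (q k) =
        cinner (blinfun_apply (F (complex_of_real (a k))) (\<Sum>j\<le>K. (1 / (a k + a j)) *\<^sub>R p j)) (q k)"
      using laplace_exp_sum[OF N, of "a k" K p] by (simp only: lap pq(1)[symmetric]) (simp only: a_def)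
  qed
  also have "\<dots> = (\<Sum>k\<le>K. \<Sum>j\<le>K. cinner (blinfun_apply (F (complex_of_real (a k))) (p j)) (q k) / (a k + a j))"
    by (simp add: blinfun.sum_right blinfun.scaleR_right cinner_sum_left cinner_scaleR_left scaleR_conv_of_real mult.commute)
  finally show "2 * Re (L2_inner (D u) g) \<le> L2_norm_sq u + L2_norm_sq g"
    using pick_inequality_half_plane[OF F, of "{..K}" a p q] N
    unfolding pq exp_sum_L2(2)[OF N] by (simp add: a_def)
qed

text \<open>\<open>u\<close> is fixed while the test function is extended from exponential sums to
  all of \<open>L2 {0..S}\<close>; the truncated output is then used as test function.\<close>

lemma passive_exp_sums:
  obtains N where "N > (0::nat)"
    "\<And>u S. u \<in> exp_sums N \<Longrightarrow> S \<ge> 0 \<Longrightarrow> L2_norm_sq (proj {0..S} (D u)) \<le> L2_norm_sq u"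
proof -
  obtain F N where F: "F \<in> schur_class" and N: "N > (0::nat)"
    and int: "\<And>u a. u \<in> L2 {0..} \<Longrightarrow> a \<ge> real N \<Longrightarrow> set_integrable lborel {0..} (laplace_integrand (D u) (complex_of_real a))"
    and lap: "\<And>u a. u \<in> L2 {0..} \<Longrightarrow> a \<ge> real N \<Longrightarrow>
      laplace (D u) (complex_of_real a) = blinfun_apply (F (complex_of_real a)) (laplace u (complex_of_real a))"
    using transfer_at_reals by blast
  show thesis
  proof (rule that[OF N])
    fix u :: "real \<Rightarrow> 'u" and S :: real assume u: "u \<in> exp_sums N" and S: "S \<ge> 0"
    define y where "y = D u"
    have u2: "u \<in> L2 {0..}" by (rule exp_sums_L2[OF u N])
    have ul: "u \<in> L2_left_loc"
      using L2_imp_L2_loc[OF u2] left_bounded_supported[OF L2_D(3)[OF u2], of 0] by (simp add: L2_left_loc_def)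
    have [measurable]: "y \<in> borel_measurable borel" unfolding y_def by (rule D_measurable[OF ul])
    have y_loc: "y \<in> L2_loc" unfolding y_def by (rule L2_left_loc_D(2)[OF D_left_loc[OF ul]])
    define P where "P g \<longleftrightarrow> integrable lborel (\<lambda>t. cinner (y t) (g t)) \<and>
      2 * Re (L2_inner y g) \<le> L2_norm_sq u + L2_norm_sq g" for g
    \<comment> \<open>\<open>w\<close> dominates the pairings with the possibly growing output,
      \<open>h\<close> dominates the test functions in \<open>L2\<close>; the two kinds of limits
      below differ only in how \<open>w\<close> is obtained.\<close>
    have P_lim: "P g" if P: "\<And>n. P (\<phi> n)" and \<phi>: "\<And>n. \<phi> n \<in> L2 UNIV" and g: "g \<in> L2 UNIV"
      and h: "h \<in> borel_measurable borel" "integrable lborel (\<lambda>t. (h t)\<^sup>2)" and dom: "\<And>n t. norm (\<phi> n t) \<le> h t"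
      and w: "integrable lborel w" "\<And>t. norm (y t) * h t \<le> w t" and lim: "AE t in lborel. (\<lambda>n. \<phi> n t) \<longlonglongrightarrow> g t"
      for \<phi> g w and h :: "real \<Rightarrow> real"
    proof -
      note [measurable] = L2_D(1)[OF \<phi>] L2_D(1)[OF g]
      have lim': "AE t in lborel. (\<lambda>n. cinner (y t) (\<phi> n t)) \<longlonglongrightarrow> cinner (y t) (g t)"
        using lim by eventually_elim (rule tendsto_cinner[OF tendsto_const])
      have bd: "AE t in lborel. norm (cinner (y t) (\<phi> n t)) \<le> w t" for n
        by (intro always_eventually allI order_trans[OF norm_cinner_le] order_trans[OF mult_left_mono[OF dom] w(2)]) simp
      have meas: "(\<lambda>t. cinner (y t) (g t)) \<in> borel_measurable lborel" "(\<lambda>t. cinner (y t) (\<phi> n t)) \<in> borel_measurable lborel" for n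
        by measurable
      have "(\<lambda>n. L2_inner y (\<phi> n)) \<longlonglongrightarrow> L2_inner y g" unfolding L2_inner_def
        by (rule Bochner_Integration.integral_dominated_convergence[OF meas w(1) lim' bd])
      then have "(\<lambda>n. 2 * Re (L2_inner y (\<phi> n))) \<longlonglongrightarrow> 2 * Re (L2_inner y g)" by (intro tendsto_intros)
      moreover have "(\<lambda>n. L2_norm_sq u + L2_norm_sq (\<phi> n)) \<longlonglongrightarrow> L2_norm_sq u + L2_norm_sq g"
        by (intro tendsto_add tendsto_const L2_norm_sq_tendsto \<phi> g L2_dominated_convergence[OF _ _ h dom lim]) auto
      ultimately have "2 * Re (L2_inner y g) \<le> L2_norm_sq u + L2_norm_sq g"
        by (rule LIMSEQ_le) (use P in \<open>auto simp: P_def\<close>)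
      moreover have "integrable lborel (\<lambda>t. cinner (y t) (g t))"
        by (rule Bochner_Integration.integrable_dominated_convergence[OF meas w(1) lim' bd])
      ultimately show ?thesis by (simp add: P_def)
    qed
    have "P f" if "f \<in> L2 {0..S}" for f
    proof (rule L2_exp_sums_induct[OF that S, of N P])
      show "P \<phi>" if "\<phi> \<in> exp_sums N" for \<phi>
        using exp_sums_pairing[OF F N int[OF u2] lap[OF u2] u that] by (simp add: P_def y_def)
    next
      fix \<phi> :: "nat \<Rightarrow> real \<Rightarrow> 'y" and g and c :: real
      assume \<phi>: "\<And>n. \<phi> n \<in> exp_sums N" and g: "g \<in> L2 {0..S}"
        and dom: "\<And>n t. norm (\<phi> n t) \<le> c * (indicator {0..} t * exp (- real N * t))"
        and lim: "AE t in lborel. (\<lambda>n. \<phi> n t) \<longlonglongrightarrow> g t" and P: "\<And>n. P (\<phi> n)"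
      show "P g"
      proof (rule P_lim[OF P L2_UNIV[OF exp_sums_L2[OF \<phi> N]] L2_UNIV[OF g] _ _ dom _ _ lim])
        have "(c * (indicator {0..} t * exp (- real N * t)))\<^sup>2 = c\<^sup>2 * (indicator {0..} t * exp (- (2 * real N) * t))" for t
          by (auto simp: indicator_def power_mult_distrib exp_double[symmetric] algebra_simps)
        then show "integrable lborel (\<lambda>t. (c * (indicator {0..} t * exp (- real N * t)))\<^sup>2)"
          using has_bochner_integral_exp[of "2 * real N"] N by (simp add: has_bochner_integral_iff)
        \<comment> \<open>The majorant is integrable because the Laplace integral of the output
          converges absolutely at \<open>N\<close>.\<close>
        have "indicator {0..} t *\<^sub>R laplace_integrand y (complex_of_real (real N)) t = (indicator {0..} t * exp (- real N * t)) *\<^sub>R y t" for t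
          by (simp only: laplace_integrand_of_real scaleR_scaleR)
        then have "integrable lborel (\<lambda>t. (indicator {0..} t * exp (- real N * t)) *\<^sub>R y t)"
          using int[OF u2 order_refl] by (simp only: set_integrable_def y_def[symmetric])
        from integrable_norm[OF this]
        show "integrable lborel (\<lambda>t. c * norm ((indicator {0..} t * exp (- real N * t)) *\<^sub>R y t))" by simp
      qed (auto simp: abs_mult)
    next
      fix \<phi> :: "nat \<Rightarrow> real \<Rightarrow> 'y" and g and h :: "real \<Rightarrow> real"
      assume \<phi>: "\<And>n. \<phi> n \<in> L2 {0..S}" and g: "g \<in> L2 {0..S}"
        and h: "h \<in> borel_measurable borel" "integrable lborel (\<lambda>t. (h t)\<^sup>2)"
        and dom: "\<And>n t. norm (\<phi> n t) \<le> h t" and h0: "\<And>t. t \<notin> {0..S} \<Longrightarrow> h t = 0"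
        and lim: "AE t in lborel. (\<lambda>n. \<phi> n t) \<longlonglongrightarrow> g t" and P: "\<And>n. P (\<phi> n)"
      show "P g"
      proof (rule P_lim[OF P L2_UNIV[OF \<phi>] L2_UNIV[OF g] h dom _ _ lim])
        \<comment> \<open>On the bounded window the output is square integrable by the definition of
          \<open>D\<close>, and \<open>h\<close> vanishes outside.\<close>
        show "integrable lborel (\<lambda>t. (norm (proj {0..S} y t))\<^sup>2 + (h t)\<^sup>2)"
          by (intro Bochner_Integration.integrable_add L2_D(2)[OF L2_loc_D(2)[OF y_loc]] h)
        show "norm (y t) * h t \<le> (norm (proj {0..S} y t))\<^sup>2 + (h t)\<^sup>2" for t
        proof (cases "t \<in> {0..S}")
          case True
          then have "norm (y t) = norm (proj {0..S} y t)" by (simp add: proj_def)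
          moreover have "2 * (norm (proj {0..S} y t) * h t) \<le> (norm (proj {0..S} y t))\<^sup>2 + (h t)\<^sup>2"
            using sum_squares_bound[of "norm (proj {0..S} y t)" "h t"] by simp
          moreover have "0 \<le> (norm (proj {0..S} y t))\<^sup>2 + (h t)\<^sup>2" by simp
          ultimately show ?thesis by (metis add.commute linorder_linear mult_2 add_increasing2 order_trans add_le_same_cancel1 mult_nonneg_nonneg norm_ge_zero)
        qed (simp add: h0)
      qed
    qed
    \<comment> \<open>With the truncated output \<open>g\<close> as test function the pairing is the
      squared norm of \<open>g\<close>, so twice this norm is at most itself plus that of
      \<open>u\<close>.\<close>
    then have "P (proj {0..S} y)" by (simp add: L2_proj'[OF L2_loc_D(2)[OF y_loc, of 0 S], of "{0..S}", unfolded proj_proj, simplified])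
    moreover have "L2_inner y (proj {0..S} y) = L2_inner (proj {0..S} y) (proj {0..S} y)"
      unfolding L2_inner_def by (rule Bochner_Integration.integral_cong) (auto simp: proj_def indicator_def)
    ultimately show "L2_norm_sq (proj {0..S} (D u)) \<le> L2_norm_sq u"
      by (simp add: P_def L2_inner_self y_def)
  qed
qed

text \<open>The second use of density, now in the input. Both kinds of limits converge in
  \<open>L2\<close>, and the continuity of \<open>D\<close> transports this to the outputs on
  \<open>{0..S}\<close>.\<close>

lemma passive_bounded_support:
  assumes u: "u \<in> L2 {0..T}" and T: "T \<ge> 0" and S: "S \<ge> 0"
  shows "L2_norm_sq (proj {0..S} (D u)) \<le> L2_norm_sq u"
proof -
  obtain N where N: "N > (0::nat)"
    and exp: "\<And>u S. u \<in> exp_sums N \<Longrightarrow> S \<ge> 0 \<Longrightarrow> L2_norm_sq (proj {0..S} (D u)) \<le> L2_norm_sq u"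
    using passive_exp_sums by blast
  define P where "P v \<longleftrightarrow> L2_norm_sq (proj {0..S} (D v)) \<le> L2_norm_sq v" for v
  have P_lim: "P g" if P: "\<And>n. P (\<phi> n)" and \<phi>: "\<And>n. \<phi> n \<in> L2 {0..}" and g: "g \<in> L2 {0..}"
    and lim: "(\<lambda>n. L2_norm_sq (\<lambda>t. \<phi> n t - g t)) \<longlonglongrightarrow> 0" for \<phi> g
    unfolding P_def
  proof (rule LIMSEQ_le[OF D_proj_tendsto[OF \<phi> g lim] L2_norm_sq_tendsto[OF L2_UNIV[OF \<phi>] L2_UNIV[OF g] lim]])
    show "\<exists>N. \<forall>n\<ge>N. L2_norm_sq (proj {0..S} (D (\<phi> n))) \<le> L2_norm_sq (\<phi> n)" using P by (simp add: P_def)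
  qed
  have "P u"
  proof (rule L2_exp_sums_induct[OF u T, of N P])
    show "P \<phi>" if "\<phi> \<in> exp_sums N" for \<phi> using exp[OF that S] by (simp add: P_def)
  next
    fix \<phi> :: "nat \<Rightarrow> real \<Rightarrow> 'u" and g and c :: real
    assume \<phi>: "\<And>n. \<phi> n \<in> exp_sums N" and g: "g \<in> L2 {0..T}"
      and dom: "\<And>n t. norm (\<phi> n t) \<le> c * (indicator {0..} t * exp (- real N * t))"
      and lim: "AE t in lborel. (\<lambda>n. \<phi> n t) \<longlonglongrightarrow> g t" and P: "\<And>n. P (\<phi> n)"
    have \<phi>2: "\<phi> n \<in> L2 {0..}" for n by (rule exp_sums_L2[OF \<phi> N])
    have g2: "g \<in> L2 {0..}" by (rule L2_mono[OF g]) auto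
    show "P g"
    proof (rule P_lim[OF P \<phi>2 g2 L2_dominated_convergence[OF L2_D(1)[OF \<phi>2] L2_D(1)[OF g2] _ _ dom lim]])
      have "(c * (indicator {0..} t * exp (- real N * t)))\<^sup>2 = c\<^sup>2 * (indicator {0..} t * exp (- (2 * real N) * t))" for t
        by (auto simp: indicator_def power_mult_distrib exp_double[symmetric] algebra_simps)
      then show "integrable lborel (\<lambda>t. (c * (indicator {0..} t * exp (- real N * t)))\<^sup>2)"
        using has_bochner_integral_exp[of "2 * real N"] N by (simp add: has_bochner_integral_iff)
    qed auto
  next
    fix \<phi> :: "nat \<Rightarrow> real \<Rightarrow> 'u" and g and h :: "real \<Rightarrow> real"
    assume \<phi>: "\<And>n. \<phi> n \<in> L2 {0..T}" and g: "g \<in> L2 {0..T}"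
      and h: "h \<in> borel_measurable borel" "integrable lborel (\<lambda>t. (h t)\<^sup>2)"
      and dom: "\<And>n t. norm (\<phi> n t) \<le> h t"
      and lim: "AE t in lborel. (\<lambda>n. \<phi> n t) \<longlonglongrightarrow> g t" and P: "\<And>n. P (\<phi> n)"
    have 2: "f \<in> L2 {0..}" if "f \<in> L2 {0..T}" for f :: "real \<Rightarrow> 'u" by (rule L2_mono[OF that]) auto
    show "P g"
      by (rule P_lim[OF P 2[OF \<phi>] 2[OF g] L2_dominated_convergence[OF L2_D(1)[OF \<phi>] L2_D(1)[OF g] h dom lim]])
  qed
  then show ?thesis by (simp add: P_def)
qed

end

section \<open>Energy on half-lines and truncation of the far past\<close>

lemma ae_eq_proj_subset:
  assumes "proj {..<s} f =\<^sub>a proj {..<s} g" "J \<subseteq> {..s}"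
  shows "proj J f =\<^sub>a proj J g"
proof -
  have *: "proj {..s} f =\<^sub>a proj {..s} g"
    by (rule ae_eq_trans[OF ae_eq_sym[OF ae_eq_proj_atMost] ae_eq_trans[OF assms(1) ae_eq_proj_atMost]])
  have "proj J (proj {..s} h) = proj J h" for h :: "real \<Rightarrow> 'a"
    using assms(2) by (simp add: proj_proj Int_absorb2)
  with ae_eq_proj[OF *, of J] show ?thesis by simp
qed

lemma supported_in_proj_Int: "supported_in J f \<Longrightarrow> proj I f =\<^sub>a proj (I \<inter> J) f"
  using ae_eq_proj[of f "proj J f" I] ae_eq_sym[of "proj J f" f] by (simp add: supported_in_proj_eq proj_proj)

lemma L2_norm_sq_proj_atMost:
  assumes f: "f \<in> L2_left_loc" and t: "t \<ge> 0"
  shows "L2_norm_sq (proj {..t} f) = L2_norm_sq (proj {..<0} f) + L2_norm_sq (proj {0..t} f)"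
proof -
  have eq: "{..t} = {..<0} \<union> {0..t}" using t by auto
  have "proj {..t} f \<in> L2_left {..t}" by (rule L2_left_loc_proj_L2[OF f]) auto
  then have "proj ({..<0} \<union> {0..t}) f \<in> L2 UNIV"
    unfolding eq by (intro L2_UNIV[of _ "{..<0} \<union> {0..t}"]) (simp add: L2_left_def)
  then show ?thesis unfolding eq by (rule L2_norm_sq_proj_Un) auto
qed

lemma L2_norm_sq_proj_shift:
  fixes f :: "real \<Rightarrow> 'k::separable_hilbert_space"
  assumes f: "f \<in> borel_measurable borel" "supported_in {a..} f"
  shows "L2_norm_sq (proj {..T} f) = L2_norm_sq (proj {0..T - a} (shift a f))"
proof -
  have "L2_norm_sq (proj {..T} f) = L2_norm_sq (proj ({..T} \<inter> {a..}) f)"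
    by (intro L2_norm_sq_cong supported_in_proj_Int f measurable_proj) auto
  also have "\<dots> = L2_norm_sq (shift a (proj ({..T} \<inter> {a..}) f))" by (simp add: L2_norm_sq_shift)
  also have "shift a (proj ({..T} \<inter> {a..}) f) = proj {0..T - a} (shift a f)"
    unfolding shift_proj by (rule arg_cong[where f = "\<lambda>J. proj J (shift a f)"]) auto
  finally show ?thesis .
qed

text \<open>Left-bounded functions are dense, and they are the ones on which \<open>B\<close> and
  \<open>D\<close> act.\<close>

lemma truncation:
  fixes f :: "real \<Rightarrow> 'k::separable_hilbert_space"
  assumes f: "f \<in> L2 J"
  shows "proj {- real n..} f \<in> L2_left J" "(\<lambda>n. L2_norm_sq (\<lambda>t. proj {- real n..} f t - f t)) \<longlonglongrightarrow> 0"
proof -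
  show "proj {- real n..} f \<in> L2_left J"
    using L2_proj''[OF f, of "{- real n..}"] left_bounded_supported[OF supported_in_proj, of "{- real n..}" "- real n" f]
    by (simp add: L2_left_def)
  show "(\<lambda>n. L2_norm_sq (\<lambda>t. proj {- real n..} f t - f t)) \<longlonglongrightarrow> 0"
  proof (rule L2_dominated_convergence[where h = "\<lambda>t. norm (f t)"])
    show "AE t in lborel. (\<lambda>n. proj {- real n..} f t) \<longlonglongrightarrow> f t"
    proof (rule always_eventually, rule allI, rule tendsto_eventually)
      fix t
      obtain n :: nat where n: "- t \<le> real n" using real_arch_simple by blast
      show "eventually (\<lambda>n. proj {- real n..} f t = f t) sequentially"
        using eventually_ge_at_top[of n] by eventually_elim (use n in \<open>auto simp: proj_def indicator_def\<close>)
    qed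
  qed (use L2_D[OF f] in \<open>auto simp: proj_def indicator_def\<close>)
qed

lemma truncation_class: "f \<in> L2 UNIV \<Longrightarrow> (\<lambda>n. L2_class (proj {- real n..} f)) \<longlonglongrightarrow> L2_class f"
  for f :: "real \<Rightarrow> 'k::separable_hilbert_space"
  by (subst L2_class_LIMSEQ_iff) (auto intro: truncation(2) L2_proj'')

context schur_system
begin

text \<open>By causality the output up to \<open>T\<close> does not see the input after
  \<open>T\<close>, so the input may be cut off there.\<close>

lemma passive_plus_loc:
  assumes v: "v \<in> L2_plus_loc" and T: "T \<ge> 0"
  shows "L2_norm_sq (proj {0..T} (D v)) \<le> L2_norm_sq (proj {0..T} v)"
proof -
  have vl: "v \<in> L2_left_loc" by (rule L2_plus_loc_imp_left[OF v])
  define w where "w = proj {0..T} v"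
  have w: "w \<in> L2 {0..T}"
    unfolding w_def by (rule L2_loc_proj_bounded[of v _ 0 T]) (use vl L2_left_loc_D(2) in auto)
  have wl: "w \<in> L2_left_loc" unfolding w_def by (rule L2_left_loc_proj[OF vl]) simp
  have "proj {..<T} v =\<^sub>a proj ({..<T} \<inter> {0..}) v"
    using v by (intro supported_in_proj_Int) (simp add: L2_plus_loc_def)
  also have "proj ({..<T} \<inter> {0..}) v = proj {..<T} w"
    unfolding w_def proj_proj by (rule arg_cong[where f = "\<lambda>J. proj J v"]) auto
  finally have "proj {..<T} (D v) =\<^sub>a proj {..<T} (D w)" by (rule D_causal_cong[OF vl wl])
  then have "proj {0..T} (D v) =\<^sub>a proj {0..T} (D w)" by (rule ae_eq_proj_subset) auto
  then have "L2_norm_sq (proj {0..T} (D v)) = L2_norm_sq (proj {0..T} (D w))"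
    by (rule L2_norm_sq_cong[rotated 2]) (auto intro!: measurable_proj D_measurable vl wl)
  also have "\<dots> \<le> L2_norm_sq w" by (rule passive_bounded_support[OF w T T])
  finally show ?thesis by (simp add: w_def)
qed

lemma passive_left_loc:
  assumes u: "u \<in> L2_left_loc"
  shows "L2_norm_sq (proj {..T} (D u)) \<le> L2_norm_sq (proj {..T} u)"
proof -
  obtain a0 where a0: "supported_in {a0<..} u" using L2_left_loc_D(3)[OF u] by (auto simp: left_bounded_def)
  \<comment> \<open>The minimum with \<open>T\<close> keeps the shifted window
    \<open>{0..T - a}\<close> nonempty.\<close>
  define a where "a = min a0 T"
  have aT: "a \<le> T" by (simp add: a_def)
  have supp: "supported_in {a..} u" by (rule supported_in_mono[OF a0]) (auto simp: a_def)
  define v where "v = shift a u"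
  have vl: "v \<in> L2_left_loc" unfolding v_def by (rule L2_left_loc_shift[OF u])
  have "supported_in {s. a + s \<in> {a..}} v"
    unfolding v_def by (rule supported_in_shift[OF L2_left_loc_D(1)[OF u] _ supp]) simp
  moreover have "{s. a + s \<in> {a..}} = {0..}" by auto
  ultimately have "supported_in {0..} v" by simp
  then have v: "v \<in> L2_plus_loc" using L2_left_loc_D(2)[OF vl] by (simp add: L2_plus_loc_def)
  have "L2_norm_sq (proj {..T} (D u)) = L2_norm_sq (proj {0..T - a} (shift a (D u)))"
    by (rule L2_norm_sq_proj_shift[OF D_measurable[OF u] D_supported[OF u supp]])
  also have "\<dots> = L2_norm_sq (proj {0..T - a} (D v))"
    unfolding v_def by (intro L2_norm_sq_cong ae_eq_proj D_shift u measurable_proj measurable_shift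
        D_measurable L2_left_loc_shift) auto
  also have "\<dots> \<le> L2_norm_sq (proj {0..T - a} v)" using aT by (intro passive_plus_loc v) simp
  also have "\<dots> = L2_norm_sq (proj {..T} u)" unfolding v_def by (rule L2_norm_sq_proj_shift[OF L2_left_loc_D(1)[OF u] supp, symmetric])
  finally show ?thesis .
qed

text \<open>Let the final time tend to infinity: Fatou's lemma yields square integrability of the
  output together with the bound.\<close>

lemma passive_L2:
  assumes u: "u \<in> L2_left UNIV"
  shows "D u \<in> L2 UNIV" "L2_norm_sq (D u) \<le> L2_norm_sq u"
proof -
  have ul: "u \<in> L2_left_loc" by (rule L2_left_imp_loc[OF u])
  have u2: "u \<in> L2 UNIV" using u by (simp add: L2_left_def)
  have [measurable]: "D u \<in> borel_measurable borel" by (rule D_measurable[OF ul])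
  have "(\<integral>\<^sup>+t. ennreal ((norm (D u t))\<^sup>2) \<partial>lborel) =
      (\<integral>\<^sup>+t. liminf (\<lambda>n. ennreal ((norm (proj {..real n} (D u) t))\<^sup>2)) \<partial>lborel)"
  proof (rule nn_integral_cong)
    fix t
    obtain n :: nat where n: "t \<le> real n" using real_arch_simple by blast
    have "eventually (\<lambda>n. ennreal ((norm (proj {..real n} (D u) t))\<^sup>2) = ennreal ((norm (D u t))\<^sup>2)) sequentially"
      using eventually_ge_at_top[of n] by eventually_elim (use n in \<open>auto simp: proj_def indicator_def\<close>)
    then have "(\<lambda>n. ennreal ((norm (proj {..real n} (D u) t))\<^sup>2)) \<longlonglongrightarrow> ennreal ((norm (D u t))\<^sup>2)"
      by (rule tendsto_eventually)
    then show "ennreal ((norm (D u t))\<^sup>2) = liminf (\<lambda>n. ennreal ((norm (proj {..real n} (D u) t))\<^sup>2))"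
      by (rule lim_imp_Liminf[OF sequentially_bot, symmetric])
  qed
  also have "\<dots> \<le> liminf (\<lambda>n. \<integral>\<^sup>+t. ennreal ((norm (proj {..real n} (D u) t))\<^sup>2) \<partial>lborel)"
    by (rule nn_integral_liminf) measurable
  also have "\<dots> \<le> ennreal (L2_norm_sq u)"
  proof (rule Liminf_le)
    have "(\<integral>\<^sup>+t. ennreal ((norm (proj {..real n} (D u) t))\<^sup>2) \<partial>lborel) \<le> ennreal (L2_norm_sq u)" for n
    proof -
      have "proj {..real n} (D u) \<in> L2_left {..real n}"
        by (rule L2_left_loc_proj_L2[OF D_left_loc[OF ul]]) auto
      then have "proj {..real n} (D u) \<in> L2 {..real n}" by (simp add: L2_left_def)
      moreover have "L2_norm_sq (proj {..real n} (D u)) \<le> L2_norm_sq u"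
        by (rule order_trans[OF passive_left_loc[OF ul] L2_norm_sq_proj_le[OF u2]]) simp
      ultimately show ?thesis by (simp add: ennreal_L2_norm_sq ennreal_leI)
    qed
    then show "\<forall>\<^sub>F n in sequentially. (\<integral>\<^sup>+t. ennreal ((norm (proj {..real n} (D u) t))\<^sup>2) \<partial>lborel) \<le> ennreal (L2_norm_sq u)"
      by simp
  qed simp
  finally have *: "(\<integral>\<^sup>+t. ennreal ((norm (D u t))\<^sup>2) \<partial>lborel) \<le> ennreal (L2_norm_sq u)" .
  show "D u \<in> L2 UNIV" by (rule L2_I_nn_integral(1)[OF _ supported_in_UNIV *]) simp
  show "L2_norm_sq (D u) \<le> L2_norm_sq u"
    by (rule L2_I_nn_integral(2)[OF _ supported_in_UNIV *]) simp_all
qed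

section \<open>Concatenation of a past and a future input\<close>

lemma D_concat_past:
  assumes u: "u \<in> L2_left {..<0}" and v: "v \<in> L2_plus_loc"
  shows "proj {..<0} (D (\<lambda>t. u t + v t)) =\<^sub>a proj {..<0} (D u)"
proof (rule D_causal_cong)
  show ul: "u \<in> L2_left_loc" by (rule L2_left_imp_loc[OF u])
  show "(\<lambda>t. u t + v t) \<in> L2_left_loc" by (rule L2_left_loc_add[OF ul L2_plus_loc_imp_left[OF v]])
  have "supported_in {0..} v" using v by (simp add: L2_plus_loc_def)
  then show "proj {..<0} (\<lambda>t. u t + v t) =\<^sub>a proj {..<0} u"
    unfolding supported_in_def ae_eq_def by (auto elim!: eventually_mono simp: proj_def indicator_def)
qed

lemma D_past_left:
  assumes u: "u \<in> L2_left {..<0}"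
  shows "proj {0..} (D u) =\<^sub>a C (B u)"
proof -
  have ul: "u \<in> L2_left_loc" by (rule L2_left_imp_loc[OF u])
  have u2: "u \<in> L2 {..<0}" using u by (simp add: L2_left_def)
  have pu: "proj {..<0} u \<in> L2_left {..<0}"
    using L2_proj'[OF u2, of "{..<0}"] left_bounded_proj[of u] u by (simp add: L2_left_def)
  have eq: "proj {..<0} u =\<^sub>a u" using L2_D(3)[OF u2] by (simp add: supported_in_proj_eq)
  have "proj {0..} (D u) =\<^sub>a proj {0..} (D (proj {..<0} u))"
    by (rule ae_eq_proj[OF D_cong[OF ae_eq_sym[OF eq] ul L2_left_imp_loc[OF pu]]])
  also have "\<dots> =\<^sub>a C (B (proj {..<0} u))" by (rule D_past[OF ul])
  also have "B (proj {..<0} u) = B u" by (rule B_cong[OF eq pu u])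
  finally show ?thesis .
qed

lemma D_concat_future:
  assumes u: "u \<in> L2_left {..<0}" and v: "v \<in> L2_plus_loc"
  shows "proj {0..} (D (\<lambda>t. u t + v t)) =\<^sub>a proj {0..} (\<lambda>t. C (B u) t + D v t)"
proof -
  have ul: "u \<in> L2_left_loc" by (rule L2_left_imp_loc[OF u])
  have "proj {0..} (D (\<lambda>t. u t + v t)) =\<^sub>a proj {0..} (\<lambda>t. D u t + D v t)"
    by (rule ae_eq_proj[OF D_add[OF ul L2_plus_loc_imp_left[OF v]]])
  also have "\<dots> =\<^sub>a proj {0..} (\<lambda>t. C (B u) t + D v t)"
    using D_past_left[OF u] unfolding ae_eq_def by (auto elim!: eventually_mono simp: proj_def indicator_def)
  finally show ?thesis .
qed

lemma concat_norm_sq: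
  assumes u: "u \<in> L2_left {..<0}" and v: "v \<in> L2_plus_loc" and t: "t \<ge> 0"
  shows "L2_norm_sq (proj {..t} (\<lambda>s. u s + v s)) = L2_norm_sq u + L2_norm_sq (proj {0..t} v)"
proof -
  define w where "w = (\<lambda>s. u s + v s)"
  have u2: "u \<in> L2 {..<0}" using u by (simp add: L2_left_def)
  have wl: "w \<in> L2_left_loc" unfolding w_def
    by (rule L2_left_loc_add[OF L2_left_imp_loc[OF u] L2_plus_loc_imp_left[OF v]])
  have vs: "supported_in {0..} v" using v by (simp add: L2_plus_loc_def)
  note [measurable] = L2_D(1)[OF u2] L2_left_loc_D(1)[OF L2_plus_loc_imp_left[OF v]] L2_left_loc_D(1)[OF wl]
  have "L2_norm_sq (proj {..t} w) = L2_norm_sq (proj {..<0} w) + L2_norm_sq (proj {0..t} w)"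
    by (rule L2_norm_sq_proj_atMost[OF wl t])
  also have "L2_norm_sq (proj {..<0} w) = L2_norm_sq u"
    by (rule L2_norm_sq_cong) (use vs L2_D(3)[OF u2] in
      \<open>auto simp: w_def ae_eq_def supported_in_def proj_def indicator_def elim!: eventually_elim2\<close>)
  also have "L2_norm_sq (proj {0..t} w) = L2_norm_sq (proj {0..t} v)"
    by (rule L2_norm_sq_cong) (use L2_D(3)[OF u2] in
      \<open>auto simp: w_def ae_eq_def supported_in_def proj_def indicator_def elim!: eventually_mono\<close>)
  finally show ?thesis by (simp add: w_def)
qed

lemma concat_output_norm_sq:
  assumes u: "u \<in> L2_left {..<0}" and v: "v \<in> L2_plus_loc" and t: "t \<ge> 0"
  shows "L2_norm_sq (proj {..t} (D (\<lambda>s. u s + v s))) =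
    L2_norm_sq (proj {..<0} (D u)) + L2_norm_sq (proj {0..t} (\<lambda>s. C (B u) s + D v s))"
proof -
  define w where "w = (\<lambda>s. u s + v s)"
  have ul: "u \<in> L2_left_loc" by (rule L2_left_imp_loc[OF u])
  have vl: "v \<in> L2_left_loc" by (rule L2_plus_loc_imp_left[OF v])
  have wl: "w \<in> L2_left_loc" unfolding w_def by (rule L2_left_loc_add[OF ul vl])
  note [measurable] = D_measurable[OF ul] D_measurable[OF vl] D_measurable[OF wl]
  have "L2_norm_sq (proj {..t} (D w)) = L2_norm_sq (proj {..<0} (D w)) + L2_norm_sq (proj {0..t} (D w))"
    by (rule L2_norm_sq_proj_atMost[OF D_left_loc[OF wl] t])
  also have "L2_norm_sq (proj {..<0} (D w)) = L2_norm_sq (proj {..<0} (D u))"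
    by (rule L2_norm_sq_cong) (use D_concat_past[OF u v] in \<open>auto simp: w_def[symmetric]\<close>)
  also have "L2_norm_sq (proj {0..t} (D w)) = L2_norm_sq (proj {0..t} (\<lambda>s. C (B u) s + D v s))"
  proof (rule L2_norm_sq_cong)
    have "{0..t} \<inter> {0..} = {0..t}" by auto
    then show "proj {0..t} (D w) =\<^sub>a proj {0..t} (\<lambda>s. C (B u) s + D v s)"
      using ae_eq_proj[OF D_concat_future[OF u v], of "{0..t}"] by (simp add: proj_proj w_def)
  qed measurable
  finally show ?thesis by (simp add: w_def)
qed

text \<open>Passivity on \<open>{..t}\<close> for the concatenated input, both sides split at time
  0. After time 0 the past acts only through the state \<open>B u\<close>.\<close>

lemma energy_inequality:
  assumes u: "u \<in> L2_left {..<0}" and v: "v \<in> L2_plus_loc" and t: "t \<ge> 0"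
  shows "L2_norm_sq (proj {..<0} (D u)) + L2_norm_sq (proj {0..t} (\<lambda>s. C (B u) s + D v s)) \<le>
    L2_norm_sq u + L2_norm_sq (proj {0..t} v)"
  using passive_left_loc[OF L2_left_loc_add[OF L2_left_imp_loc[OF u] L2_plus_loc_imp_left[OF v]], of t]
  unfolding concat_norm_sq[OF assms] concat_output_norm_sq[OF assms] .

subsection \<open>The contractive extension of the input-output map\<close>

lemma D_class_add:
  assumes "u \<in> L2_left UNIV" "v \<in> L2_left UNIV"
  shows "L2_class (D (\<lambda>t. u t + v t)) = L2_class (D u) + L2_class (D v)"
proof -
  have s: "(\<lambda>t. u t + v t) \<in> L2_left UNIV"
    using assms by (auto simp: L2_left_def intro: L2_add left_bounded_add)
  show ?thesis
    using D_add[OF L2_left_imp_loc[OF assms(1)] L2_left_imp_loc[OF assms(2)]]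
    by (simp add: L2_class_add L2_class_eq_iff passive_L2(1) assms s L2_add)
qed

lemma D_class_scaleC:
  assumes "u \<in> L2_left UNIV"
  shows "L2_class (D (\<lambda>t. c *\<^sub>C u t)) = c *\<^sub>C L2_class (D u)"
proof -
  have s: "(\<lambda>t. c *\<^sub>C u t) \<in> L2_left UNIV"
    using assms by (auto simp: L2_left_def intro: L2_scaleC left_bounded_scaleC)
  show ?thesis
    using D_scaleC[OF L2_left_imp_loc[OF assms(1)]]
    by (simp add: L2_class_scaleC L2_class_eq_iff passive_L2(1) assms s L2_scaleC)
qed

lemma D_class_dist:
  assumes "u \<in> L2_left UNIV" "v \<in> L2_left UNIV"
  shows "norm (L2_class (D u) - L2_class (D v)) \<le> norm (L2_class u - L2_class v)"
proof -
  have uv: "u \<in> L2 UNIV" "v \<in> L2 UNIV" using assms by (auto simp: L2_left_def)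
  define w where "w = (\<lambda>t. u t - v t)"
  have w: "w \<in> L2_left UNIV"
    unfolding w_def using assms by (auto simp: L2_left_def intro: L2_diff left_bounded_diff)
  have "u = (\<lambda>t. w t + v t)" by (simp add: w_def)
  then have "L2_class (D u) - L2_class (D v) = L2_class (D w)" using D_class_add[OF w assms(2)] by simp
  moreover have "L2_class u - L2_class v = L2_class w" by (simp add: L2_class_diff uv w_def)
  moreover have "norm (L2_class (D w)) \<le> norm (L2_class w)"
    by (rule power2_le_imp_le)
      (use passive_L2(2)[OF w] passive_L2(1)[OF w] w in \<open>simp_all add: norm_L2_class L2_left_def\<close>)
  ultimately show ?thesis by simp
qed

text \<open>Extension by continuity: truncations form a Cauchy sequence, and the contraction
  property of \<open>D\<close> carries this over to their outputs.\<close>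

lemma L_ext_exists:
  "\<exists>L. L2_contraction UNIV UNIV L \<and> (\<forall>u\<in>L2_left UNIV. L u =\<^sub>a D u)"
proof -
  have "\<exists>g. g \<in> L2 UNIV \<and> (\<lambda>n. L2_class (D (proj {- real n..} f))) \<longlonglongrightarrow> L2_class g" if f: "f \<in> L2 UNIV" for f
  proof -
    have "Cauchy (\<lambda>n. L2_class (D (proj {- real n..} f)))"
    proof (rule CauchyI)
      fix e :: real assume "e > 0"
      from CauchyD[OF LIMSEQ_imp_Cauchy[OF truncation_class[OF f]] this]
      obtain M where M: "\<forall>m\<ge>M. \<forall>n\<ge>M. norm (L2_class (proj {- real m..} f) - L2_class (proj {- real n..} f)) < e" ..
      show "\<exists>M. \<forall>m\<ge>M. \<forall>n\<ge>M. norm (L2_class (D (proj {- real m..} f)) - L2_class (D (proj {- real n..} f))) < e"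
        using M D_class_dist[OF truncation(1)[OF f] truncation(1)[OF f]] by (meson le_less_trans)
    qed
    then obtain x where "(\<lambda>n. L2_class (D (proj {- real n..} f))) \<longlonglongrightarrow> x"
      using Cauchy_convergent convergent_def by blast
    moreover obtain g where "g \<in> L2 UNIV" "x = L2_class g" using L2_class_cases .
    ultimately show ?thesis by blast
  qed
  then obtain L where L: "\<And>f. f \<in> L2 UNIV \<Longrightarrow> L f \<in> L2 UNIV"
    "\<And>f. f \<in> L2 UNIV \<Longrightarrow> (\<lambda>n. L2_class (D (proj {- real n..} f))) \<longlonglongrightarrow> L2_class (L f)"
    by metis
  \<comment> \<open>The limit is the same for every approximating sequence; the constant sequence
    later identifies the extension with \<open>D\<close> on left-bounded inputs.\<close>
  have lim: "(\<lambda>n. L2_class (D (h n))) \<longlonglongrightarrow> L2_class (L f)"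
    if f: "f \<in> L2 UNIV" and h: "\<And>n. h n \<in> L2_left UNIV" and hf: "(\<lambda>n. L2_class (h n)) \<longlonglongrightarrow> L2_class f" for f h
  proof (rule Lim_transform[OF L(2)[OF f]])
    have "(\<lambda>n. L2_class (h n) - L2_class (proj {- real n..} f)) \<longlonglongrightarrow> L2_class f - L2_class f"
      by (intro tendsto_diff hf truncation_class f)
    then have "(\<lambda>n. norm (L2_class (h n) - L2_class (proj {- real n..} f))) \<longlonglongrightarrow> 0"
      by (simp add: tendsto_norm_zero_iff)
    then show "(\<lambda>n. L2_class (D (h n)) - L2_class (D (proj {- real n..} f))) \<longlonglongrightarrow> 0"
      by (rule Lim_null_comparison[rotated]) (auto intro!: always_eventually D_class_dist h truncation(1) f)
  qed
  have tr: "proj {- real n..} f \<in> L2_left UNIV" if "f \<in> L2 UNIV" for n and f :: "real \<Rightarrow> 'u" by (rule truncation(1)[OF that])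
  have left: "f \<in> L2 UNIV" if "f \<in> L2_left UNIV" for f :: "real \<Rightarrow> 'u" using that by (simp add: L2_left_def)
  have "L2_contraction UNIV UNIV L"
    unfolding L2_contraction_def L2_linear_def
  proof (intro conjI ballI allI L(1))
    fix f g :: "real \<Rightarrow> 'u" assume f: "f \<in> L2 UNIV" and g: "g \<in> L2 UNIV"
    have fg: "(\<lambda>t. f t + g t) \<in> L2 UNIV" by (rule L2_add[OF f g])
    have "L2_class (L (\<lambda>t. f t + g t)) = L2_class (L f) + L2_class (L g)"
    proof (rule LIMSEQ_unique[OF L(2)[OF fg]])
      have "L2_class (D (proj {- real n..} (\<lambda>t. f t + g t))) =
          L2_class (D (proj {- real n..} f)) + L2_class (D (proj {- real n..} g))" for n
        unfolding proj_add by (rule D_class_add[OF tr[OF f] tr[OF g]])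
      then show "(\<lambda>n. L2_class (D (proj {- real n..} (\<lambda>t. f t + g t)))) \<longlonglongrightarrow> L2_class (L f) + L2_class (L g)"
        using tendsto_add[OF L(2)[OF f] L(2)[OF g]] by simp
    qed
    then show "L (\<lambda>t. f t + g t) =\<^sub>a (\<lambda>t. L f t + L g t)"
      by (simp add: L2_class_add L2_class_eq_iff L f g fg L2_add)
  next
    fix c and f :: "real \<Rightarrow> 'u" assume f: "f \<in> L2 UNIV"
    have cf: "(\<lambda>t. c *\<^sub>C f t) \<in> L2 UNIV" by (rule L2_scaleC[OF f])
    have "L2_class (L (\<lambda>t. c *\<^sub>C f t)) = c *\<^sub>C L2_class (L f)"
    proof (rule LIMSEQ_unique[OF L(2)[OF cf]])
      have "L2_class (D (proj {- real n..} (\<lambda>t. c *\<^sub>C f t))) = c *\<^sub>C L2_class (D (proj {- real n..} f))" for n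
        unfolding proj_scaleC by (rule D_class_scaleC[OF tr[OF f]])
      then show "(\<lambda>n. L2_class (D (proj {- real n..} (\<lambda>t. c *\<^sub>C f t)))) \<longlonglongrightarrow> c *\<^sub>C L2_class (L f)"
        using tendsto_scaleC[OF tendsto_const L(2)[OF f]] by simp
    qed
    then show "L (\<lambda>t. c *\<^sub>C f t) =\<^sub>a (\<lambda>t. c *\<^sub>C L f t)"
      by (simp add: L2_class_scaleC L2_class_eq_iff L f cf L2_scaleC)
  next
    fix f :: "real \<Rightarrow> 'u" assume f: "f \<in> L2 UNIV"
    have "norm (L2_class (D (proj {- real n..} f))) \<le> norm (L2_class (proj {- real n..} f))" for n
    proof (rule power2_le_imp_le)
      show "(norm (L2_class (D (proj {- real n..} f))))\<^sup>2 \<le> (norm (L2_class (proj {- real n..} f)))\<^sup>2"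
        using passive_L2[OF tr[OF f]] left[OF tr[OF f]] by (simp add: norm_L2_class)
    qed simp
    then have "norm (L2_class (L f)) \<le> norm (L2_class f)"
      by (intro LIMSEQ_le[OF tendsto_norm[OF L(2)[OF f]] tendsto_norm[OF truncation_class[OF f]]]) auto
    then have "(norm (L2_class (L f)))\<^sup>2 \<le> (norm (L2_class f))\<^sup>2" by (simp add: power_mono)
    then show "L2_norm_sq (L f) \<le> L2_norm_sq f" by (simp add: norm_L2_class L f)
  qed
  moreover have "L u =\<^sub>a D u" if u: "u \<in> L2_left UNIV" for u
  proof -
    have "(\<lambda>_::nat. L2_class (D u)) \<longlonglongrightarrow> L2_class (L u)" by (rule lim[OF left[OF u] u tendsto_const])
    then have "L2_class (L u) = L2_class (D u)" by (simp add: LIMSEQ_const_iff)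
    then show ?thesis by (simp add: L2_class_eq_iff L left u passive_L2(1))
  qed
  ultimately show ?thesis by blast
qed

lemma L_ext: "L2_contraction UNIV UNIV (L_ext \<Sigma>)" "u \<in> L2_left UNIV \<Longrightarrow> L_ext \<Sigma> u =\<^sub>a D u"
  using someI_ex[OF L_ext_exists] unfolding L_ext_def by blast+

lemma T_past_contraction: "L2_contraction {..<0} {..<0} (T_past \<Sigma>)"
proof -
  have L: "L_ext \<Sigma> f \<in> L2 UNIV" "L2_norm_sq (L_ext \<Sigma> f) \<le> L2_norm_sq f" if "f \<in> L2 {..<0}" for f
    using L_ext(1) L2_UNIV[OF that] by (auto simp: L2_contraction_def L2_linear_def)
  have "T_past \<Sigma> (\<lambda>t. f t + g t) =\<^sub>a (\<lambda>t. T_past \<Sigma> f t + T_past \<Sigma> g t)" if "f \<in> L2 {..<0}" "g \<in> L2 {..<0}" for f g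
  proof -
    have "L_ext \<Sigma> (\<lambda>t. f t + g t) =\<^sub>a (\<lambda>t. L_ext \<Sigma> f t + L_ext \<Sigma> g t)"
      using L_ext(1) L2_UNIV[OF that(1)] L2_UNIV[OF that(2)] by (auto simp: L2_contraction_def L2_linear_def)
    from ae_eq_proj[OF this] show ?thesis unfolding T_past_def proj_add .
  qed
  moreover have "T_past \<Sigma> (\<lambda>t. c *\<^sub>C f t) =\<^sub>a (\<lambda>t. c *\<^sub>C T_past \<Sigma> f t)" if "f \<in> L2 {..<0}" for c f
  proof -
    have "L_ext \<Sigma> (\<lambda>t. c *\<^sub>C f t) =\<^sub>a (\<lambda>t. c *\<^sub>C L_ext \<Sigma> f t)"
      using L_ext(1) L2_UNIV[OF that(1)] by (auto simp: L2_contraction_def L2_linear_def)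
    from ae_eq_proj[OF this] show ?thesis unfolding T_past_def proj_scaleC .
  qed
  moreover have "T_past \<Sigma> f \<in> L2 {..<0}" if "f \<in> L2 {..<0}" for f
    unfolding T_past_def by (rule L2_proj'[OF L(1)[OF that]]) simp
  moreover have "L2_norm_sq (T_past \<Sigma> f) \<le> L2_norm_sq f" if "f \<in> L2 {..<0}" for f
    unfolding T_past_def by (rule order_trans[OF L2_norm_sq_proj_le[OF L(1)[OF that]] L(2)[OF that]]) simp
  ultimately show ?thesis by (simp add: L2_contraction_def L2_linear_def)
qed

lemma T_past_eq:
  assumes "u \<in> L2_left {..<0}"
  shows "T_past \<Sigma> u =\<^sub>a proj {..<0} (D u)"
  unfolding T_past_def
  by (rule ae_eq_proj[OF L_ext(2)]) (use assms in \<open>auto simp: L2_left_def intro: L2_UNIV\<close>)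

end

section \<open>The square integrable input map\<close>

text \<open>Test the difference against its own truncations. Hence values of \<open>Wc_star\<close>
  are unique up to \<open>=\<^sub>a\<close>, whatever the choice operator picks.\<close>

lemma L2_inner_eq_on_left:
  assumes v: "v \<in> L2 {..<0}" "v' \<in> L2 {..<0}"
    and eq: "\<And>u. u \<in> L2_left {..<0} \<Longrightarrow> L2_inner v u = L2_inner v' u"
  shows "v =\<^sub>a v'"
proof -
  define d where "d = (\<lambda>t. v t - v' t)"
  have d: "d \<in> L2 {..<0}" unfolding d_def by (rule L2_diff[OF v])
  have zero: "cinner (L2_class d) (L2_class (proj {- real n..} d)) = 0" for n
  proof -
    have l: "proj {- real n..} d \<in> L2_left {..<0}" by (rule truncation(1)[OF d])
    then have l': "proj {- real n..} d \<in> L2 UNIV" by (auto simp: L2_left_def intro: L2_UNIV)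
    have "L2_class d = L2_class v - L2_class v'" by (simp add: d_def L2_class_diff L2_UNIV[OF v(1)] L2_UNIV[OF v(2)])
    then show ?thesis
      using eq[OF l] by (simp add: cinner_diff_left cinner_L2_class l' L2_UNIV[OF v(1)] L2_UNIV[OF v(2)])
  qed
  have "(\<lambda>n. cinner (L2_class d) (L2_class (proj {- real n..} d))) \<longlonglongrightarrow> cinner (L2_class d) (L2_class d)"
    by (intro tendsto_cinner tendsto_const truncation_class L2_UNIV[OF d])
  then have "cinner (L2_class d) (L2_class d) = 0" by (simp add: zero LIMSEQ_const_iff)
  then have "L2_norm_sq d = 0" by (simp add: cinner_L2_class L2_UNIV[OF d] L2_inner_self)
  then have "d =\<^sub>a (\<lambda>_. 0)" using L2_norm_sq_eq_0[OF d] by simp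
  then show ?thesis unfolding d_def ae_eq_def by (auto elim: eventually_mono)
qed

context well_posed
begin

lemma Wc_star: "x \<in> Wc_star_dom \<Sigma> \<Longrightarrow> is_Wc_star_value \<Sigma> x (Wc_star \<Sigma> x)"
  unfolding Wc_star_dom_def Wc_star_def mem_Collect_eq
  by (rule someI_ex[of "is_Wc_star_value \<Sigma> x"])

lemma Wc_star_eqI:
  assumes "is_Wc_star_value \<Sigma> x v"
  shows "x \<in> Wc_star_dom \<Sigma>" "Wc_star \<Sigma> x =\<^sub>a v"
proof -
  show x: "x \<in> Wc_star_dom \<Sigma>" using assms by (auto simp: Wc_star_dom_def)
  from Wc_star[OF x] assms show "Wc_star \<Sigma> x =\<^sub>a v"
    by (intro L2_inner_eq_on_left) (auto simp: is_Wc_star_value_def)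
qed

end

locale densely_defined_system = schur_system \<Sigma> G
  for \<Sigma> :: "('u::separable_hilbert_space, 'x::separable_hilbert_space, 'y::separable_hilbert_space) system"
    and G :: "complex \<Rightarrow> ('u \<Rightarrow>\<^sub>L 'y)" +
  assumes dense: "Wc_star_densely_defined \<Sigma>"
begin

text \<open>Here the density of the domain of \<open>Wc_star\<close> enters: a vector is determined
  by its pairings with a dense set.\<close>

lemma is_Wc_value_unique:
  assumes "is_Wc_value \<Sigma> u z" "is_Wc_value \<Sigma> u z'"
  shows "z = z'"
proof -
  have *: "cinner x z = cinner x z'" if "x \<in> Wc_star_dom \<Sigma>" for x
    using assms that by (simp add: is_Wc_value_def)
  have "closed {x. cinner x z = cinner x z'}"
    by (intro closed_Collect_eq bounded_bilinear.continuous_on[OF bounded_bilinear_cinner]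
        continuous_on_id continuous_on_const)
  moreover have "Wc_star_dom \<Sigma> \<subseteq> {x. cinner x z = cinner x z'}" using * by blast
  ultimately have "closure (Wc_star_dom \<Sigma>) \<subseteq> {x. cinner x z = cinner x z'}" by (rule closure_minimal[rotated])
  then have "cinner x z = cinner x z'" for x using dense by (auto simp: Wc_star_densely_defined_def)
  then show ?thesis by (rule cinner_eqI_right)
qed

lemma Wc_eqI:
  assumes u: "u \<in> L2 {..<0}" and z: "is_Wc_value \<Sigma> u z"
  shows "u \<in> Wc_dom \<Sigma>" "Wc \<Sigma> u = z"
proof -
  show "u \<in> Wc_dom \<Sigma>" using u z by (auto simp: Wc_dom_def)
  show "Wc \<Sigma> u = z" unfolding Wc_def
    by (rule the_equality[of "is_Wc_value \<Sigma> u"]) (rule z, rule is_Wc_value_unique[OF _ z])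
qed

text \<open>The defining relation of an adjoint is a family of closed conditions, and it holds on
  the graph of \<open>B\<close> by the definition of \<open>Wc_star\<close>.\<close>

lemma Wc_limit:
  assumes un: "\<And>n. f n \<in> L2_left {..<0}" and u: "u \<in> L2 {..<0}"
    and lim: "(\<lambda>n. L2_norm_sq (\<lambda>t. f n t - u t)) \<longlonglongrightarrow> 0" and B: "(\<lambda>n. B (f n)) \<longlonglongrightarrow> z"
  shows "u \<in> Wc_dom \<Sigma>" "Wc \<Sigma> u = z"
proof -
  have fn: "f n \<in> L2 UNIV" for n using un[of n] by (auto simp: L2_left_def intro: L2_UNIV)
  have conv: "(\<lambda>n. L2_class (f n)) \<longlonglongrightarrow> L2_class u"
    using lim by (simp add: L2_class_LIMSEQ_iff fn L2_UNIV[OF u])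
  have "is_Wc_value \<Sigma> u z" unfolding is_Wc_value_def
  proof
    fix x assume x: "x \<in> Wc_star_dom \<Sigma>"
    have v: "Wc_star \<Sigma> x \<in> L2 UNIV" "\<And>u. u \<in> L2_left {..<0} \<Longrightarrow> L2_inner (Wc_star \<Sigma> x) u = cinner x (B u)"
      using Wc_star[OF x] by (auto simp: is_Wc_star_value_def intro: L2_UNIV)
    have "(\<lambda>n. cinner (L2_class (Wc_star \<Sigma> x)) (L2_class (f n))) \<longlonglongrightarrow> cinner (L2_class (Wc_star \<Sigma> x)) (L2_class u)"
      by (intro tendsto_cinner tendsto_const conv)
    then have "(\<lambda>n. cinner x (B (f n))) \<longlonglongrightarrow> L2_inner (Wc_star \<Sigma> x) u"
      by (simp add: cinner_L2_class v fn un L2_UNIV[OF u])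
    moreover have "(\<lambda>n. cinner x (B (f n))) \<longlonglongrightarrow> cinner x z" by (intro tendsto_cinner tendsto_const B)
    ultimately show "L2_inner (Wc_star \<Sigma> x) u = cinner x z" by (rule LIMSEQ_unique)
  qed
  from Wc_eqI[OF u this] show "u \<in> Wc_dom \<Sigma>" "Wc \<Sigma> u = z" .
qed

text \<open>
  Since \<^const>\<open>Wc\<close> is the adjoint of the adjoint of the restriction of \<open>\<BB>\<close> to
  \<^term>\<open>L2_left {..<0}\<close>, it is the closure of that restriction.
\<close>

lemma Wc_dom_approximation:
  assumes u: "u \<in> Wc_dom \<Sigma>"
  obtains f where "\<And>n. f n \<in> L2_left {..<0}" "(\<lambda>n. L2_norm_sq (\<lambda>t. f n t - u t)) \<longlonglongrightarrow> 0"
    "(\<lambda>n. B (f n)) \<longlonglongrightarrow> Wc \<Sigma> u"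
proof -
  have u2: "u \<in> L2 {..<0}" using u by (simp add: Wc_dom_def)
  obtain z where z: "is_Wc_value \<Sigma> u z" using u by (auto simp: Wc_dom_def)
  have Wz: "Wc \<Sigma> u = z" by (rule Wc_eqI[OF u2 z])
  define \<Gamma> where "\<Gamma> = (\<lambda>f. (L2_class f, B f)) ` L2_left {..<0}"
  have left: "f \<in> L2 UNIV" if "f \<in> L2_left {..<0}" for f using that by (auto simp: L2_left_def intro: L2_UNIV)
  have add: "p + q \<in> \<Gamma>" if pq: "p \<in> \<Gamma>" "q \<in> \<Gamma>" for p q
  proof -
    obtain f g where "f \<in> L2_left {..<0}" "p = (L2_class f, B f)" "g \<in> L2_left {..<0}" "q = (L2_class g, B g)"
      using pq by (auto simp: \<Gamma>_def)
    moreover from this have "(\<lambda>t. f t + g t) \<in> L2_left {..<0}"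
      by (auto simp: L2_left_def intro: L2_add left_bounded_add)
    ultimately show ?thesis unfolding \<Gamma>_def
      by (intro image_eqI[where x = "\<lambda>t. f t + g t"]) (auto simp: L2_class_add left B_add)
  qed
  have scale: "c *\<^sub>C p \<in> \<Gamma>" if p: "p \<in> \<Gamma>" for p c
  proof -
    obtain f where "f \<in> L2_left {..<0}" "p = (L2_class f, B f)" using p by (auto simp: \<Gamma>_def)
    moreover from this have "(\<lambda>t. c *\<^sub>C f t) \<in> L2_left {..<0}"
      by (auto simp: L2_left_def intro: L2_scaleC left_bounded_scaleC)
    ultimately show ?thesis unfolding \<Gamma>_def
      by (intro image_eqI[where x = "\<lambda>t. c *\<^sub>C f t"]) (auto simp: L2_class_scaleC left B_scaleC scaleC_prod_def)
  qed
  have "(L2_class u, z) \<in> closure \<Gamma>"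
  proof (rule ccontr)
    assume notin: "(L2_class u, z) \<notin> closure \<Gamma>"
    have "(L2_class (\<lambda>_. 0), B (\<lambda>_. 0)) \<in> \<Gamma>" unfolding \<Gamma>_def using L2_left_zero by blast
    then have zero: "0 \<in> closure \<Gamma>"
      using closure_subset by (force simp: B_zero zero_L2_space.abs_eq zero_prod_def)
    have cadd: "p + q \<in> closure \<Gamma>" if pq: "p \<in> closure \<Gamma>" "q \<in> closure \<Gamma>" for p q
    proof -
      obtain P R where "\<And>n. P n \<in> \<Gamma>" "P \<longlonglongrightarrow> p" "\<And>n. R n \<in> \<Gamma>" "R \<longlonglongrightarrow> q"
        using pq unfolding closure_sequential by blast
      then show ?thesis unfolding closure_sequential
        by (intro exI[of _ "\<lambda>n. P n + R n"] conjI allI add tendsto_add)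
    qed
    have cscale: "c *\<^sub>C p \<in> closure \<Gamma>" if p: "p \<in> closure \<Gamma>" for p c
    proof -
      obtain P where "\<And>n. P n \<in> \<Gamma>" "P \<longlonglongrightarrow> p" using p unfolding closure_sequential by blast
      then show ?thesis unfolding closure_sequential
        by (intro exI[of _ "\<lambda>n. c *\<^sub>C P n"] conjI allI scale tendsto_scaleC tendsto_const)
    qed
    obtain m where m: "\<And>p. p \<in> closure \<Gamma> \<Longrightarrow> cinner p m = 0" "cinner (L2_class u, z) m \<noteq> 0"
      using separating_orthogonal_vector[OF closed_closure zero cadd cscale notin] by blast
    obtain v x where vx: "v \<in> L2 UNIV" "m = (L2_class v, x)"
      by (metis L2_class_cases prod.collapse)
    \<comment> \<open>Orthogonality of \<open>(v, x)\<close> to the graph says that \<open>v\<close>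
      pairs with \<open>f\<close> to minus the pairing of \<open>x\<close> with \<open>B f\<close>.
      So \<open>- v\<close>, restricted to the past where the inputs live, is the value of the
      adjoint at \<open>x\<close>.\<close>
    define w where "w = proj {..<0} (\<lambda>t. - v t)"
    have v': "(\<lambda>t. - v t) \<in> L2 UNIV" by (rule L2_minus[OF vx(1)])
    have w: "w \<in> L2 {..<0}" unfolding w_def by (rule L2_proj'[OF v']) simp
    have inner_w: "L2_inner w f = - L2_inner v f" if "f \<in> L2 {..<0}" for f
      unfolding w_def L2_inner_proj_left[OF that v' borel_open[OF open_lessThan]]
      by (simp add: L2_inner_def cinner_minus_left)
    have "is_Wc_star_value \<Sigma> x w"
      unfolding is_Wc_star_value_def
    proof (intro conjI ballI w)
      fix f :: "real \<Rightarrow> 'u" assume f: "f \<in> L2_left {..<0}"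
      then have f2: "f \<in> L2 {..<0}" by (simp add: L2_left_def)
      have "(L2_class f, B f) \<in> \<Gamma>" using f by (auto simp: \<Gamma>_def)
      from m(1)[OF subsetD[OF closure_subset this]]
      have "cinner (L2_class f, B f) m = 0" .
      then have "L2_inner f v + cinner (B f) x = 0"
        by (simp add: vx(2) cinner_prod_def cinner_L2_class L2_UNIV[OF f2] vx(1))
      from arg_cong[OF this, of cnj] have "L2_inner v f + cinner x (B f) = 0"
        by (simp only: complex_cnj_add L2_inner_commute[symmetric] cinner_commute[symmetric] complex_cnj_zero)
      then show "L2_inner w f = cinner x (B f)"
        unfolding inner_w[OF f2] by (simp add: add_eq_0_iff)
    qed
    from Wc_star_eqI[OF this] have x: "x \<in> Wc_star_dom \<Sigma>" "Wc_star \<Sigma> x =\<^sub>a w" .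
    have Wx: "Wc_star \<Sigma> x \<in> L2 {..<0}" using Wc_star[OF x(1)] by (simp add: is_Wc_star_value_def)
    \<comment> \<open>Since \<open>z\<close> is the value of \<open>Wc\<close> at \<open>u\<close>,
      the same computation makes \<open>(v, x)\<close> orthogonal to the point it was meant to
      separate.\<close>
    have "cinner x z = L2_inner (Wc_star \<Sigma> x) u" using z x(1) by (simp add: is_Wc_value_def)
    also have "\<dots> = L2_inner w u" by (rule L2_inner_cong[OF x(2) ae_eq_refl Wx w u2 u2])
    also have "\<dots> = - L2_inner v u" by (rule inner_w[OF u2])
    finally have "L2_inner v u + cinner x z = 0" by simp
    from arg_cong[OF this, of cnj] have "L2_inner u v + cinner z x = 0"
      by (simp only: complex_cnj_add L2_inner_commute[symmetric] cinner_commute[symmetric] complex_cnj_zero)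
    then show False
      using m(2) by (simp add: vx cinner_prod_def cinner_L2_class L2_UNIV[OF u2])
  qed
  then obtain P where P: "\<And>n. P n \<in> \<Gamma>" "P \<longlonglongrightarrow> (L2_class u, z)" unfolding closure_sequential by blast
  then have "\<exists>f. f \<in> L2_left {..<0} \<and> P n = (L2_class f, B f)" for n by (auto simp: \<Gamma>_def)
  then obtain f where f: "\<And>n. f n \<in> L2_left {..<0}" "\<And>n. P n = (L2_class (f n), B (f n))" by metis
  show thesis
  proof (rule that[of f])
    show "f n \<in> L2_left {..<0}" for n by (rule f)
    have "(\<lambda>n. L2_class (f n)) \<longlonglongrightarrow> L2_class u" using tendsto_fst[OF P(2)] by (simp add: f(2))
    then show "(\<lambda>n. L2_norm_sq (\<lambda>t. f n t - u t)) \<longlonglongrightarrow> 0"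
      by (simp add: L2_class_LIMSEQ_iff left f(1) L2_UNIV[OF u2])
    show "(\<lambda>n. B (f n)) \<longlonglongrightarrow> Wc \<Sigma> u" using tendsto_snd[OF P(2)] by (simp add: f(2) Wz)
  qed
qed

end

section \<open>Storage functions\<close>

lemma set_integral_norm_sq: "(LINT s:J|lborel. (norm (y s))\<^sup>2) = L2_norm_sq (proj J y)"
  unfolding set_lebesgue_integral_def L2_norm_sq_def by (simp add: norm_proj)

lemma L2_plus_loc_zero: "(\<lambda>_. 0) \<in> L2_plus_loc"
  using L2_left_loc_D(2)[OF L2_left_loc_zero] by (simp add: L2_plus_loc_def supported_in_def)

lemma proj_shift_past: "proj {..<0} (shift t f) = shift t (proj {..<t} f)"
  unfolding shift_proj by (rule arg_cong[where f = "\<lambda>J. proj J (shift t f)"]) auto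

lemma proj_shift_left:
  assumes "f \<in> L2_left_loc"
  shows "proj {..<0} (shift t f) \<in> L2_left {..<0}"
  by (rule L2_left_loc_proj_L2[OF L2_left_loc_shift[OF assms], of _ 0]) auto

lemma L2_norm_sq_split:
  assumes f: "f \<in> L2_loc" and t: "0 \<le> t" and s: "0 \<le> s"
  shows "L2_norm_sq (proj {0..t + s} f) = L2_norm_sq (proj {0..t} f) + L2_norm_sq (proj {0..s} (shift t f))"
proof -
  have eq: "{0..t + s} = {0..<t} \<union> {t..t + s}" using t s by auto
  have "L2_norm_sq (proj {0..t + s} f) = L2_norm_sq (proj {0..<t} f) + L2_norm_sq (proj {t..t + s} f)"
    unfolding eq by (rule L2_norm_sq_proj_Un) (use L2_loc_D(2)[OF f, of 0 "t + s"] eq in auto)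
  also have "L2_norm_sq (proj {0..<t} f) = L2_norm_sq (proj {0..t} f)"
    by (intro L2_norm_sq_cong ae_eq_proj_atLeastAtMost measurable_proj L2_loc_D(1)[OF f]) auto
  also have "L2_norm_sq (proj {t..t + s} f) = L2_norm_sq (shift t (proj {t..t + s} f))"
    by (simp add: L2_norm_sq_shift)
  also have "shift t (proj {t..t + s} f) = proj {0..s} (shift t f)"
    unfolding shift_proj by (rule arg_cong[where f = "\<lambda>J. proj J (shift t f)"]) auto
  finally show ?thesis .
qed

section \<open>State, response and the available storage\<close>

context schur_system
begin

abbreviation state :: "'x \<Rightarrow> (real \<Rightarrow> 'u) \<Rightarrow> real \<Rightarrow> 'x"
  where "state x0 u t \<equiv> blinfun_apply (A t) x0 + input_map_upto \<Sigma> t (proj {0..t} u)"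

abbreviation response :: "'x \<Rightarrow> (real \<Rightarrow> 'u) \<Rightarrow> real \<Rightarrow> 'y"
  where "response x0 u \<equiv> (\<lambda>s. C x0 s + D u s)"

lemma response_measurable: "u \<in> L2_left_loc \<Longrightarrow> response x0 u \<in> borel_measurable borel"
  using C_measurable[of x0] D_measurable[of u] by measurable

lemma response_loc: "u \<in> L2_left_loc \<Longrightarrow> response x0 u \<in> L2_loc"
  using C_plus_loc[of x0] L2_left_loc_D(2)[OF D_left_loc] by (auto simp: L2_plus_loc_def intro: L2_loc_add)

lemma state_0: "state x0 u 0 = x0"
proof -
  have "proj {..<0} (shift 0 (proj {0..0} u)) = (\<lambda>_. 0)"
    by (auto simp: proj_def shift_def indicator_def)
  moreover have "A 0 = id_blinfun" using semigroup by (simp add: C0_semigroup_def)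
  ultimately show ?thesis by (simp add: input_map_upto_def B_zero)
qed

lemma response_cong:
  assumes u: "u \<in> L2_left_loc" and v: "v \<in> L2_left_loc" and eq: "proj {..<t} u =\<^sub>a proj {..<t} v"
  shows "L2_norm_sq (proj {0..t} (response x0 u)) = L2_norm_sq (proj {0..t} (response x0 v))"
proof (rule L2_norm_sq_cong)
  have "proj {0..t} (D u) =\<^sub>a proj {0..t} (D v)"
    by (rule ae_eq_proj_subset[OF D_causal_cong[OF u v eq]]) auto
  then show "proj {0..t} (response x0 u) =\<^sub>a proj {0..t} (response x0 v)"
    unfolding proj_add by (intro ae_eq_add ae_eq_refl)
qed (intro measurable_proj response_measurable u v; simp)+

lemma trajectory_response:
  assumes "trajectory \<Sigma> x0 u x y" "t \<ge> 0"
  shows "x t = state x0 u t" "u \<in> L2_plus_loc"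
    "(LINT s:{0..t}|lborel. (norm (y s))\<^sup>2) = L2_norm_sq (proj {0..t} (response x0 u))"
    "(LINT s:{0..t}|lborel. (norm (u s))\<^sup>2) = L2_norm_sq (proj {0..t} u)"
proof -
  show u: "u \<in> L2_plus_loc" and "x t = state x0 u t" using assms by (auto simp: trajectory_def)
  have y: "y \<in> L2_plus_loc" "y =\<^sub>a response x0 u" using assms by (auto simp: trajectory_def)
  have "L2_norm_sq (proj {0..t} y) = L2_norm_sq (proj {0..t} (response x0 u))"
    by (intro L2_norm_sq_cong ae_eq_proj y measurable_proj response_measurable L2_plus_loc_imp_left u
        L2_left_loc_D(1)[OF L2_plus_loc_imp_left[OF y(1)]]) auto
  then show "(LINT s:{0..t}|lborel. (norm (y s))\<^sup>2) = L2_norm_sq (proj {0..t} (response x0 u))"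
    by (simp only: set_integral_norm_sq)
qed (rule set_integral_norm_sq)

text \<open>The output energy is a finite real and may change sides even where \<open>S\<close> is
  infinite; trajectories are replaced by explicit states and responses.\<close>

lemma storage_functionI:
  assumes "\<And>x. 0 \<le> S x" "S 0 = 0"
    and "\<And>x0 u t. u \<in> L2_plus_loc \<Longrightarrow> t > 0 \<Longrightarrow>
      S (state x0 u t) \<le> S x0 + ereal (L2_norm_sq (proj {0..t} u) - L2_norm_sq (proj {0..t} (response x0 u)))"
  shows "storage_function \<Sigma> S"
  unfolding storage_function_def
proof (intro conjI allI impI; (elim conjE)?)
  fix x0 u x y and t :: real assume tr: "trajectory \<Sigma> x0 u x y" and t: "0 < t"
  have t0: "0 \<le> t" using t by simp
  have x0: "x 0 = x0" using trajectory_response(1)[OF tr order_refl] state_0[of x0 u] by simp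
  define a where "a = L2_norm_sq (proj {0..t} u)"
  define b where "b = L2_norm_sq (proj {0..t} (response x0 u))"
  have "S (x t) + ereal b \<le> (S x0 + ereal (a - b)) + ereal b"
    unfolding trajectory_response(1)[OF tr t0] a_def b_def
    by (intro add_right_mono assms(3) trajectory_response(2)[OF tr t0] t)
  also have "\<dots> = S x0 + ereal a" by (simp add: add.assoc)
  finally show "S (x t) + ereal (LINT s:{0..t}|lborel. (norm (y s))\<^sup>2) \<le>
      S (x 0) + ereal (LINT s:{0..t}|lborel. (norm (u s))\<^sup>2)"
    unfolding trajectory_response(3,4)[OF tr t0] x0 a_def b_def .
qed (use assms in auto)

lemma state_cong:
  assumes "proj {..<t} u = proj {..<t} v"
  shows "state x0 u t = state x0 v t"
proof -
  have "proj {..<0} (shift t (proj {0..t} w)) = shift t (proj {0..t} (proj {..<t} w))" for w :: "real \<Rightarrow> 'u"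
    unfolding proj_shift_past by (simp add: proj_proj Int_commute)
  then show ?thesis using assms by (simp add: input_map_upto_def)
qed

text \<open>The state at time \<open>t\<close> carries all the influence of the past: the initial
  state contributes through \<open>C_A\<close>, and the input before \<open>t\<close> contributes
  the output of the state it has produced.\<close>

lemma response_shift:
  assumes w: "w \<in> L2_plus_loc" and t: "t \<ge> 0"
  shows "proj {0..} (shift t (response x0 w)) =\<^sub>a proj {0..} (response (state x0 w t) (proj {0..} (shift t w)))"
proof -
  have wl: "w \<in> L2_left_loc" by (rule L2_plus_loc_imp_left[OF w])
  \<comment> \<open>\<open>w\<close> vanishes before time 0 only almost everywhere, so
    \<open>g\<close> and \<open>g'\<close> need not coincide as functions; \<open>B_cong\<close>
    identifies their states.\<close>
  define g where "g = proj {..<0} (shift t w)"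
  define g' where "g' = proj {..<0} (shift t (proj {0..t} w))"
  define v where "v = proj {0..} (shift t w)"
  have vl: "v \<in> L2_left_loc" unfolding v_def by (intro L2_left_loc_proj L2_left_loc_shift wl) simp
  have v: "v \<in> L2_plus_loc" using L2_left_loc_D(2)[OF vl] by (simp add: L2_plus_loc_def v_def)
  have g: "g \<in> L2_left {..<0}" unfolding g_def by (rule proj_shift_left[OF wl])
  have g': "g' \<in> L2_left {..<0}" unfolding g'_def by (intro proj_shift_left L2_left_loc_proj wl) simp
  have gv: "shift t w = (\<lambda>s. g s + v s)" unfolding g_def v_def by (rule past_future)
  have "proj {..<t} w =\<^sub>a proj ({..<t} \<inter> {0..}) w"
    using w by (intro supported_in_proj_Int) (simp add: L2_plus_loc_def)
  also have "{..<t} \<inter> {0..} = {..<t} \<inter> {0..t}" by auto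
  finally have "proj {..<t} w =\<^sub>a proj {..<t} (proj {0..t} w)" by (simp add: proj_proj)
  then have "g =\<^sub>a g'" unfolding g_def g'_def proj_shift_past
    by (intro ae_eq_shift measurable_proj L2_left_loc_D(1)[OF wl]) auto
  then have Bg: "B g = input_map_upto \<Sigma> t (proj {0..t} w)"
    unfolding input_map_upto_def g'_def[symmetric] by (rule B_cong[OF _ g g'])
  have "proj {0..} (shift t (D w)) =\<^sub>a proj {0..} (D (\<lambda>s. g s + v s))"
    unfolding gv[symmetric] by (rule ae_eq_proj[OF D_shift[OF wl]])
  also have "\<dots> =\<^sub>a proj {0..} (\<lambda>s. C (B g) s + D v s)" by (rule D_concat_future[OF g v])
  finally have 1: "proj {0..} (shift t (D w)) =\<^sub>a proj {0..} (\<lambda>s. C (B g) s + D v s)" .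
  have 2: "proj {0..} (shift t (C x0)) =\<^sub>a proj {0..} (C (blinfun_apply (A t) x0))"
    using ae_eq_proj[OF ae_eq_sym[OF C_A[OF t, of x0]], of "{0..}"] by (simp add: shift_plus_def proj_proj)
  have "(\<lambda>s. proj {0..} (shift t (C x0)) s + proj {0..} (shift t (D w)) s) =\<^sub>a
      (\<lambda>s. proj {0..} (C (blinfun_apply (A t) x0)) s + proj {0..} (\<lambda>s. C (B g) s + D v s) s)"
    by (rule ae_eq_add[OF 2 1])
  then have 3: "proj {0..} (shift t (response x0 w)) =\<^sub>a
      proj {0..} (\<lambda>s. (C (blinfun_apply (A t) x0) s + C (B g) s) + D v s)"
    by (simp only: proj_def shift_def scaleR_add_right add.assoc)
  have 4: "proj {0..} (\<lambda>s. (C (blinfun_apply (A t) x0) s + C (B g) s) + D v s) =\<^sub>a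
      proj {0..} (response (state x0 w t) v)"
    unfolding Bg by (rule ae_eq_proj[OF ae_eq_add[OF ae_eq_sym[OF C_add] ae_eq_refl]])
  show ?thesis using ae_eq_trans[OF 3 4] unfolding v_def .
qed

text \<open>Applying \<open>u\<close> up to time \<open>t\<close> and then \<open>v\<close> to the
  state reached is a single experiment on \<open>x0\<close>. Energies add because the single instant
  \<open>t\<close> has measure zero.\<close>

lemma concatenated_input:
  assumes u: "u \<in> L2_plus_loc" and v: "v \<in> L2_plus_loc" and t: "t > 0" and s: "s > 0"
  obtains w where "w \<in> L2_plus_loc"
    "L2_norm_sq (proj {0..t + s} w) = L2_norm_sq (proj {0..t} u) + L2_norm_sq (proj {0..s} v)"
    "L2_norm_sq (proj {0..t + s} (response x0 w)) =
      L2_norm_sq (proj {0..t} (response x0 u)) + L2_norm_sq (proj {0..s} (response (state x0 u t) v))"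
proof -
  have ul: "u \<in> L2_left_loc" and vl: "v \<in> L2_left_loc" using u v by (auto intro: L2_plus_loc_imp_left)
  \<comment> \<open>Projecting \<open>v\<close> first makes \<open>w\<close> agree with
    \<open>u\<close> everywhere before \<open>t\<close>, not only almost everywhere, so that the
    states at \<open>t\<close> are equal without further argument.\<close>
  define w where "w = (\<lambda>r. proj {..<t} u r + shift (- t) (proj {0..} v) r)"
  have wl: "w \<in> L2_left_loc" unfolding w_def
    by (intro L2_left_loc_add L2_left_loc_proj L2_left_loc_shift ul vl) auto
  have supp: "supported_in {0..} w"
    unfolding w_def
  proof (rule supported_in_add)
    show "supported_in {0..} (proj {..<t} u)" using u by (auto simp: L2_plus_loc_def intro: supported_in_proj')
    show "supported_in {0..} (shift (- t) (proj {0..} v))"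
      using t by (auto simp: supported_in_def shift_def proj_def indicator_def)
  qed
  have w: "w \<in> L2_plus_loc" using supp L2_left_loc_D(2)[OF wl] by (simp add: L2_plus_loc_def)
  have past: "proj {..<t} w = proj {..<t} u" by (auto simp: w_def proj_def shift_def indicator_def)
  have future: "proj {0..} (shift t w) = proj {0..} v" by (auto simp: w_def proj_def shift_def indicator_def)
  note [measurable] = response_measurable[OF wl] response_measurable[OF vl]
    L2_left_loc_D(1)[OF ul] L2_left_loc_D(1)[OF vl] L2_left_loc_D(1)[OF wl]
  have pv: "proj {0..} v \<in> L2_left_loc" by (rule L2_left_loc_proj[OF vl]) simp
  have "proj {0..t} w =\<^sub>a proj {0..t} u" by (rule ae_eq_proj_subset[of t]) (auto simp: past ae_eq_refl)
  then have 1: "L2_norm_sq (proj {0..t} w) = L2_norm_sq (proj {0..t} u)"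
    by (rule L2_norm_sq_cong[rotated 2]) measurable
  have inter: "proj {0..s} (proj {0..} h) = proj {0..s} h" for h :: "real \<Rightarrow> 'u" by (simp add: proj_proj Int_absorb2)
  have inter': "proj {0..s} (proj {0..} h) = proj {0..s} h" for h :: "real \<Rightarrow> 'y" by (simp add: proj_proj Int_absorb2)
  have "proj {0..s} (shift t w) = proj {0..s} v"
    using arg_cong[OF future, of "proj {0..s}"] by (simp only: inter)
  then have 2: "L2_norm_sq (proj {0..s} (shift t w)) = L2_norm_sq (proj {0..s} v)" by simp
  have 3: "L2_norm_sq (proj {0..t} (response x0 w)) = L2_norm_sq (proj {0..t} (response x0 u))"
    by (rule response_cong[OF wl ul]) (simp add: past)
  have st: "state x0 w t = state x0 u t" by (rule state_cong[OF past])
  have t0: "0 \<le> t" using t by simp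
  have "L2_norm_sq (proj {0..s} (shift t (response x0 w))) =
      L2_norm_sq (proj {0..s} (response (state x0 u t) (proj {0..} v)))"
  proof (rule L2_norm_sq_cong)
    show "proj {0..s} (shift t (response x0 w)) =\<^sub>a proj {0..s} (response (state x0 u t) (proj {0..} v))"
      using ae_eq_proj[OF response_shift[OF w t0, of x0], of "{0..s}"] unfolding inter' st future .
  qed (intro measurable_proj measurable_shift response_measurable wl pv; simp)+
  also have "\<dots> = L2_norm_sq (proj {0..s} (response (state x0 u t) v))"
  proof (rule response_cong[OF pv vl])
    have "proj {0..} v =\<^sub>a v" using v by (simp add: L2_plus_loc_def supported_in_proj_eq)
    then show "proj {..<s} (proj {0..} v) =\<^sub>a proj {..<s} v" by (rule ae_eq_proj)
  qed
  finally have 4: "L2_norm_sq (proj {0..s} (shift t (response x0 w))) =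
      L2_norm_sq (proj {0..s} (response (state x0 u t) v))" .
  have s0: "0 \<le> s" using s by simp
  show thesis
    using that[OF w] L2_norm_sq_split[OF L2_left_loc_D(2)[OF wl] t0 s0]
      L2_norm_sq_split[OF response_loc[OF wl] t0 s0, of x0]
    unfolding 1 2 3 4 by blast
qed

lemma available_storage_ge:
  "v \<in> L2_plus_loc \<Longrightarrow> t > 0 \<Longrightarrow>
    ereal (L2_norm_sq (proj {0..t} (response x0 v)) - L2_norm_sq (proj {0..t} v)) \<le> available_storage \<Sigma> x0"
  unfolding available_storage_def by (rule SUP_upper2[of "(v, t)"]) auto

lemma available_storage_leI:
  "(\<And>v t. v \<in> L2_plus_loc \<Longrightarrow> t > 0 \<Longrightarrow>
    ereal (L2_norm_sq (proj {0..t} (response x0 v)) - L2_norm_sq (proj {0..t} v)) \<le> c) \<Longrightarrow> available_storage \<Sigma> x0 \<le> c"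
  unfolding available_storage_def by (rule SUP_least) auto

lemma storage_function_available_storage: "storage_function \<Sigma> (available_storage \<Sigma>)"
proof (rule storage_functionI)
  show nonneg: "0 \<le> available_storage \<Sigma> x0" for x0
  proof -
    have "proj {0..1} (\<lambda>_. 0 :: 'u) = (\<lambda>_. 0)" by (simp add: proj_def)
    then have "L2_norm_sq (proj {0..1} (\<lambda>_. 0 :: 'u)) = 0" by (simp add: L2_norm_sq_def)
    moreover have "0 \<le> L2_norm_sq (proj {0..1} (response x0 (\<lambda>_. 0)))" by (simp add: L2_norm_sq_def)
    ultimately have "0 \<le> ereal (L2_norm_sq (proj {0..1} (response x0 (\<lambda>_. 0))) - L2_norm_sq (proj {0..1} (\<lambda>_. 0 :: 'u)))"
      by simp
    also have "\<dots> \<le> available_storage \<Sigma> x0" by (rule available_storage_ge[OF L2_plus_loc_zero]) simp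
    finally show ?thesis .
  qed
  have "available_storage \<Sigma> 0 \<le> 0"
  proof (rule available_storage_leI)
    fix v :: "real \<Rightarrow> 'u" and t :: real assume v: "v \<in> L2_plus_loc" and t: "t > 0"
    have vl: "v \<in> L2_left_loc" by (rule L2_plus_loc_imp_left[OF v])
    have "L2_norm_sq (proj {0..t} (response 0 v)) = L2_norm_sq (proj {0..t} (D v))"
    proof (rule L2_norm_sq_cong)
      show "proj {0..t} (response 0 v) =\<^sub>a proj {0..t} (D v)"
        using ae_eq_proj[OF ae_eq_add[OF C_zero ae_eq_refl]] by simp
    qed (intro measurable_proj response_measurable D_measurable vl; simp)+
    also have "\<dots> \<le> L2_norm_sq (proj {0..t} v)" using t by (intro passive_plus_loc v) simp
    finally show "ereal (L2_norm_sq (proj {0..t} (response 0 v)) - L2_norm_sq (proj {0..t} v)) \<le> 0" by simp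
  qed
  then show "available_storage \<Sigma> 0 = 0" using nonneg by (rule antisym)
  fix x0 and u :: "real \<Rightarrow> 'u" and t :: real assume u: "u \<in> L2_plus_loc" and t: "t > 0"
  define a where "a = L2_norm_sq (proj {0..t} u)"
  define b where "b = L2_norm_sq (proj {0..t} (response x0 u))"
  show "available_storage \<Sigma> (state x0 u t) \<le> available_storage \<Sigma> x0 +
      ereal (L2_norm_sq (proj {0..t} u) - L2_norm_sq (proj {0..t} (response x0 u)))"
    unfolding a_def[symmetric] b_def[symmetric]
  proof (rule available_storage_leI)
    fix v :: "real \<Rightarrow> 'u" and s :: real assume v: "v \<in> L2_plus_loc" and s: "s > 0"
    define p where "p = L2_norm_sq (proj {0..s} (response (state x0 u t) v))"
    define q where "q = L2_norm_sq (proj {0..s} v)"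
    \<comment> \<open>Dynamic programming: each competitor \<open>(v, s)\<close> at the later state
      extends to a competitor \<open>(w, t + s)\<close> at \<open>x0\<close>, whose value differs by
      the energy exchanged up to time \<open>t\<close>.\<close>
    obtain w where w: "w \<in> L2_plus_loc" "L2_norm_sq (proj {0..t + s} w) = a + q"
        "L2_norm_sq (proj {0..t + s} (response x0 w)) = b + p"
      using concatenated_input[OF u v t s, of x0] unfolding a_def b_def p_def q_def by blast
    have "ereal ((b + p) - (a + q)) \<le> available_storage \<Sigma> x0"
      using available_storage_ge[OF w(1), of "t + s" x0] t s unfolding w by simp
    then have "ereal ((b + p) - (a + q)) + ereal (a - b) \<le> available_storage \<Sigma> x0 + ereal (a - b)"
      by (rule add_right_mono)
    then show "ereal (p - q) \<le> available_storage \<Sigma> x0 + ereal (a - b)" by (simp add: algebra_simps)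
  qed
qed

end

section \<open>The required supply as a limit of energies of past inputs\<close>

lemma proj_shift_past_L2:
  assumes "f \<in> L2 {..<0}"
  shows "proj {..<0} (shift t f) \<in> L2 {..<0}"
  using L2_proj'[OF L2_shift[OF L2_UNIV[OF assms], of t], of "{..<0}"] by simp

context schur_system
begin

text \<open>On left-bounded inputs \<open>T_past\<close> is the past output, and the squared norm of
  the defect operator is input energy minus output energy. Contractivity makes both terms continuous
  in \<open>u\<close>.\<close>

lemma past_energy_tendsto:
  assumes f: "\<And>n. f n \<in> L2_left {..<0}" and u: "u \<in> L2 {..<0}"
    and lim: "(\<lambda>n. L2_norm_sq (\<lambda>t. f n t - u t)) \<longlonglongrightarrow> 0"
  shows "(\<lambda>n. L2_norm_sq (f n) - L2_norm_sq (proj {..<0} (D (f n)))) \<longlonglongrightarrow>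
    L2_norm_sq (defect_operator {..<0} {..<0} (T_past \<Sigma>) u)"
proof -
  have f2: "f n \<in> L2 {..<0}" for n using f[of n] by (simp add: L2_left_def)
  have T2: "T_past \<Sigma> g \<in> L2 {..<0}" if "g \<in> L2 {..<0}" for g
    using T_past_contraction that by (simp add: L2_contraction_def L2_linear_def)
  have "(\<lambda>n. L2_norm_sq (\<lambda>t. T_past \<Sigma> (f n) t - T_past \<Sigma> u t)) \<longlonglongrightarrow> 0"
  proof (rule tendsto_sandwich[OF _ _ tendsto_const lim])
    show "\<forall>\<^sub>F n in sequentially. 0 \<le> L2_norm_sq (\<lambda>t. T_past \<Sigma> (f n) t - T_past \<Sigma> u t)"
      by (simp add: L2_norm_sq_def)
    show "\<forall>\<^sub>F n in sequentially. L2_norm_sq (\<lambda>t. T_past \<Sigma> (f n) t - T_past \<Sigma> u t) \<le> L2_norm_sq (\<lambda>t. f n t - u t)"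
      by (intro always_eventually allI L2_contraction_diff_le[OF T_past_contraction f2 u])
  qed
  then have T: "(\<lambda>n. L2_norm_sq (T_past \<Sigma> (f n))) \<longlonglongrightarrow> L2_norm_sq (T_past \<Sigma> u)"
    by (rule L2_norm_sq_tendsto[OF L2_UNIV[OF T2[OF f2]] L2_UNIV[OF T2[OF u]]])
  have "L2_norm_sq (T_past \<Sigma> (f n)) = L2_norm_sq (proj {..<0} (D (f n)))" for n
    by (rule L2_norm_sq_cong[OF L2_D(1)[OF T2[OF f2]] _ T_past_eq[OF f]])
      (intro measurable_proj D_measurable L2_left_imp_loc[OF f]; simp)
  with T have "(\<lambda>n. L2_norm_sq (proj {..<0} (D (f n)))) \<longlonglongrightarrow> L2_norm_sq (T_past \<Sigma> u)" by simp
  moreover have "(\<lambda>n. L2_norm_sq (f n)) \<longlonglongrightarrow> L2_norm_sq u"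
    by (rule L2_norm_sq_tendsto[OF L2_UNIV[OF f2] L2_UNIV[OF u] lim])
  ultimately show ?thesis
    by (subst L2_norm_sq_defect_operator[OF T_past_contraction _ _ u]) (auto intro: tendsto_diff)
qed

text \<open>The input contributes equally to all these responses and cancels in the differences,
  which leaves the continuity of \<open>C\<close>.\<close>

lemma response_tendsto:
  assumes x: "x \<longlonglongrightarrow> x0" and v: "v \<in> L2_left_loc"
  shows "(\<lambda>n. L2_norm_sq (proj {0..t} (response (x n) v))) \<longlonglongrightarrow> L2_norm_sq (proj {0..t} (response x0 v))"
proof (rule L2_norm_sq_tendsto)
  have "(\<lambda>n. L2_norm_sq (proj {0..t} (\<lambda>s. C (x n) s - C x0 s))) \<longlonglongrightarrow> 0"
    by (rule converges_left_loc_proj[OF C_tendsto[OF x], of _ t])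
      (use C_plus_loc in \<open>auto simp: L2_plus_loc_def\<close>)
  then show "(\<lambda>n. L2_norm_sq (\<lambda>s. proj {0..t} (response (x n) v) s - proj {0..t} (response x0 v) s)) \<longlonglongrightarrow> 0"
    by (simp add: proj_def scaleR_diff_right scaleR_add_right)
qed (intro L2_loc_D(2) response_loc v)+

text \<open>\<open>g\<close> is the history as seen from time \<open>t\<close>. Its state is the
  state reached by then, and its past energies are those of \<open>f\<close> plus those exchanged on
  \<open>{0..t}\<close>.\<close>

lemma continued_input:
  assumes f: "f \<in> L2_left {..<0}" and v: "v \<in> L2_plus_loc" and t: "t \<ge> 0"
  defines "g \<equiv> proj {..<0} (shift t (\<lambda>s. f s + v s))"
  shows "g \<in> L2_left {..<0}"
    and "B g = state (B f) v t"
    and "L2_norm_sq g = L2_norm_sq f + L2_norm_sq (proj {0..t} v)"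
    and "L2_norm_sq (proj {..<0} (D g)) =
      L2_norm_sq (proj {..<0} (D f)) + L2_norm_sq (proj {0..t} (response (B f) v))"
proof -
  have fl: "f \<in> L2_left_loc" by (rule L2_left_imp_loc[OF f])
  have vl: "v \<in> L2_left_loc" by (rule L2_plus_loc_imp_left[OF v])
  define w where "w = (\<lambda>s. f s + v s)"
  have wl: "w \<in> L2_left_loc" unfolding w_def by (rule L2_left_loc_add[OF fl vl])
  have g_w: "g = proj {..<0} (shift t w)" by (simp add: g_def w_def)
  show g: "g \<in> L2_left {..<0}" unfolding g_w by (rule proj_shift_left[OF wl])
  have gl: "g \<in> L2_left_loc" by (rule L2_left_imp_loc[OF g])
  note [measurable] = L2_left_loc_D(1)[OF fl] L2_left_loc_D(1)[OF vl] L2_left_loc_D(1)[OF wl] D_measurable[OF wl]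
  have until: "L2_norm_sq (proj {..<0} (shift t h)) = L2_norm_sq (proj {..t} h)"
    if "h \<in> borel_measurable borel" for h :: "real \<Rightarrow> 'u"
    unfolding proj_shift_past L2_norm_sq_shift
    by (intro L2_norm_sq_cong ae_eq_proj_atMost measurable_proj that) auto
  show "L2_norm_sq g = L2_norm_sq f + L2_norm_sq (proj {0..t} v)"
    unfolding g_w until[OF L2_left_loc_D(1)[OF wl]] unfolding w_def by (rule concat_norm_sq[OF f v t])
  have "proj {..<0} (D g) =\<^sub>a proj {..<0} (D (shift t w))"
    by (rule D_causal_cong[OF gl L2_left_loc_shift[OF wl]]) (simp add: g_w proj_proj ae_eq_refl)
  from ae_eq_trans[OF this ae_eq_proj[OF ae_eq_sym[OF D_shift[OF wl]]]]
  have "proj {..<0} (D g) =\<^sub>a proj {..<0} (shift t (D w))" .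
  then have "L2_norm_sq (proj {..<0} (D g)) = L2_norm_sq (proj {..<0} (shift t (D w)))"
    by (rule L2_norm_sq_cong[rotated 2]) (intro measurable_proj measurable_shift D_measurable wl gl; simp)+
  also have "\<dots> = L2_norm_sq (proj {..<t} (D w))" unfolding proj_shift_past L2_norm_sq_shift ..
  also have "\<dots> = L2_norm_sq (proj {..t} (D w))"
    by (intro L2_norm_sq_cong ae_eq_proj_atMost measurable_proj D_measurable wl) auto
  finally show "L2_norm_sq (proj {..<0} (D g)) =
      L2_norm_sq (proj {..<0} (D f)) + L2_norm_sq (proj {0..t} (response (B f) v))"
    unfolding w_def concat_output_norm_sq[OF f v t] .
  have pf: "proj {..<0} f \<in> L2_left_loc" by (rule L2_left_loc_proj[OF fl]) simp
  have pv: "proj {0..t} v \<in> L2_left_loc" by (rule L2_left_loc_proj[OF vl]) simp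
  have past: "shift_minus t f \<in> L2_left {..<0}"
  proof -
    have eq: "shift_minus t f = proj {..<0} (shift t (proj {..<0} f))"
      unfolding proj_shift_past shift_minus_def using t by (simp add: proj_proj Int_absorb1)
    show ?thesis unfolding eq by (rule proj_shift_left[OF pf])
  qed
  have recent: "proj {..<0} (shift t (proj {0..t} v)) \<in> L2_left {..<0}" by (rule proj_shift_left[OF pv])
  have sum: "(\<lambda>s. shift_minus t f s + proj {..<0} (shift t (proj {0..t} v)) s) \<in> L2_left {..<0}"
    using past recent by (auto simp: L2_left_def intro: L2_add left_bounded_add)
  \<comment> \<open>Only almost everywhere, because \<open>f\<close> and \<open>v\<close> respect
    their half-lines only up to null sets.\<close>
  have "proj {..<t} w =\<^sub>a (\<lambda>s. proj {..<0} f s + proj {..<t} (proj {0..t} v) s)"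
  proof -
    have "AE s in lborel. s \<notin> {..<0} \<longrightarrow> f s = 0" "AE s in lborel. s \<notin> {0..} \<longrightarrow> v s = 0"
      using f v by (auto simp: L2_left_def L2_def L2_plus_loc_def supported_in_def)
    then show ?thesis unfolding ae_eq_def
      by eventually_elim (use t in \<open>auto simp: w_def proj_def indicator_def\<close>)
  qed
  then have "shift t (proj {..<t} w) =\<^sub>a shift t (\<lambda>s. proj {..<0} f s + proj {..<t} (proj {0..t} v) s)"
    by (rule ae_eq_shift[rotated 2]) measurable
  then have eq: "g =\<^sub>a (\<lambda>s. shift_minus t f s + proj {..<0} (shift t (proj {0..t} v)) s)"
    unfolding g_w proj_shift_past shift_minus_def by (simp only: shift_def)
  have "B g = B (\<lambda>s. shift_minus t f s + proj {..<0} (shift t (proj {0..t} v)) s)"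
    by (rule B_cong[OF eq g sum])
  also have "\<dots> = B (shift_minus t f) + B (proj {..<0} (shift t (proj {0..t} v)))"
    by (rule B_add[OF past recent])
  also have "\<dots> = state (B f) v t" by (simp add: A_B[OF t f] input_map_upto_def)
  finally show "B g = state (B f) v t" .
qed

end

context densely_defined_system
begin

text \<open>The energy inequality passes to the limit along left-bounded inputs whose states
  converge to the given one. The bound is finite, which yields regularity.\<close>

lemma available_storage_Wc_le:
  assumes u: "u \<in> Wc_dom \<Sigma>"
  shows "available_storage \<Sigma> (Wc \<Sigma> u) \<le> ereal (L2_norm_sq (defect_operator {..<0} {..<0} (T_past \<Sigma>) u))"
proof (rule available_storage_leI)
  fix v :: "real \<Rightarrow> 'u" and t :: real assume v: "v \<in> L2_plus_loc" and t: "t > 0"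
  have u2: "u \<in> L2 {..<0}" using u by (simp add: Wc_dom_def)
  obtain f where f: "\<And>n. f n \<in> L2_left {..<0}" "(\<lambda>n. L2_norm_sq (\<lambda>t. f n t - u t)) \<longlonglongrightarrow> 0"
    "(\<lambda>n. B (f n)) \<longlonglongrightarrow> Wc \<Sigma> u"
    using Wc_dom_approximation[OF u] by blast
  have "L2_norm_sq (proj {0..t} (response (Wc \<Sigma> u) v)) - L2_norm_sq (proj {0..t} v) \<le>
      L2_norm_sq (defect_operator {..<0} {..<0} (T_past \<Sigma>) u)"
  proof (rule LIMSEQ_le)
    show "(\<lambda>n. L2_norm_sq (proj {0..t} (response (B (f n)) v)) - L2_norm_sq (proj {0..t} v)) \<longlonglongrightarrow>
        L2_norm_sq (proj {0..t} (response (Wc \<Sigma> u) v)) - L2_norm_sq (proj {0..t} v)"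
      by (intro tendsto_diff tendsto_const response_tendsto f L2_plus_loc_imp_left v)
    show "(\<lambda>n. L2_norm_sq (f n) - L2_norm_sq (proj {..<0} (D (f n)))) \<longlonglongrightarrow>
        L2_norm_sq (defect_operator {..<0} {..<0} (T_past \<Sigma>) u)"
      by (rule past_energy_tendsto[OF f(1) u2 f(2)])
    have "L2_norm_sq (proj {0..t} (response (B (f n)) v)) - L2_norm_sq (proj {0..t} v) \<le>
        L2_norm_sq (f n) - L2_norm_sq (proj {..<0} (D (f n)))" for n
      using energy_inequality[OF f(1) v, of t n] t by simp
    then show "\<exists>N. \<forall>n\<ge>N. L2_norm_sq (proj {0..t} (response (B (f n)) v)) - L2_norm_sq (proj {0..t} v) \<le>
        L2_norm_sq (f n) - L2_norm_sq (proj {..<0} (D (f n)))" by blast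
  qed
  then show "ereal (L2_norm_sq (proj {0..t} (response (Wc \<Sigma> u) v)) - L2_norm_sq (proj {0..t} v)) \<le>
      ereal (L2_norm_sq (defect_operator {..<0} {..<0} (T_past \<Sigma>) u))" by simp
qed

lemma required_supply_le:
  "u \<in> Wc_dom \<Sigma> \<Longrightarrow> regularized_required_supply \<Sigma> (Wc \<Sigma> u) \<le>
    ereal (L2_norm_sq (defect_operator {..<0} {..<0} (T_past \<Sigma>) u))"
  unfolding regularized_required_supply_def by (rule INF_lower) simp

text \<open>The limit of \<open>continued_input\<close>. \<open>Wc\<close> being closed, the
  limiting history is again admissible, and the energy relation survives as an equality.\<close>

lemma Wc_continued_input:
  assumes u: "u \<in> Wc_dom \<Sigma>" and v: "v \<in> L2_plus_loc" and t: "t \<ge> 0"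
  obtains u' where "u' \<in> Wc_dom \<Sigma>" "Wc \<Sigma> u' = state (Wc \<Sigma> u) v t"
    "L2_norm_sq (defect_operator {..<0} {..<0} (T_past \<Sigma>) u') =
      L2_norm_sq (defect_operator {..<0} {..<0} (T_past \<Sigma>) u) +
      (L2_norm_sq (proj {0..t} v) - L2_norm_sq (proj {0..t} (response (Wc \<Sigma> u) v)))"
proof -
  have u2: "u \<in> L2 {..<0}" using u by (simp add: Wc_dom_def)
  have vl: "v \<in> L2_left_loc" by (rule L2_plus_loc_imp_left[OF v])
  obtain f where f: "\<And>n. f n \<in> L2_left {..<0}" "(\<lambda>n. L2_norm_sq (\<lambda>t. f n t - u t)) \<longlonglongrightarrow> 0"
    "(\<lambda>n. B (f n)) \<longlonglongrightarrow> Wc \<Sigma> u"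
    using Wc_dom_approximation[OF u] by blast
  define u' where "u' = proj {..<0} (shift t (\<lambda>s. u s + v s))"
  define g where "g n = proj {..<0} (shift t (\<lambda>s. f n s + v s))" for n
  note g = continued_input[OF f(1) v t, folded g_def]
  have u': "u' \<in> L2 {..<0}"
  proof -
    have "u' = (\<lambda>s. proj {..<0} (shift t u) s + proj {..<0} (shift t v) s)"
      by (simp only: u'_def proj_def shift_def scaleR_add_right)
    moreover have "proj {..<0} (shift t v) \<in> L2 {..<0}" using proj_shift_left[OF vl] by (simp add: L2_left_def)
    ultimately show ?thesis by (simp only: L2_add[OF proj_shift_past_L2[OF u2]])
  qed
  have lim: "(\<lambda>n. L2_norm_sq (\<lambda>s. g n s - u' s)) \<longlonglongrightarrow> 0"
  proof (rule tendsto_sandwich[OF _ _ tendsto_const f(2)])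
    have "L2_norm_sq (\<lambda>s. g n s - u' s) \<le> L2_norm_sq (\<lambda>t. f n t - u t)" for n
    proof -
      define d where "d = (\<lambda>s. f n s - u s)"
      have d: "d \<in> L2 {..<0}" unfolding d_def using f(1)[of n] by (intro L2_diff u2) (simp add: L2_left_def)
      have "(\<lambda>s. g n s - u' s) = proj {..<0} (shift t d)"
        by (auto simp: g_def u'_def d_def proj_def shift_def scaleR_diff_right[symmetric])
      then show ?thesis
        using L2_norm_sq_proj_le[OF L2_shift[OF L2_UNIV[OF d], of t], of "{..<0}"]
        by (simp add: L2_norm_sq_shift d_def[symmetric])
    qed
    then show "\<forall>\<^sub>F n in sequentially. L2_norm_sq (\<lambda>s. g n s - u' s) \<le> L2_norm_sq (\<lambda>t. f n t - u t)" by simp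
  qed (simp add: L2_norm_sq_def)
  have "(\<lambda>n. state (B (f n)) v t) \<longlonglongrightarrow> state (Wc \<Sigma> u) v t"
    by (intro tendsto_add tendsto_const bounded_linear.tendsto[OF blinfun.bounded_linear_right] f(3))
  then have "(\<lambda>n. B (g n)) \<longlonglongrightarrow> state (Wc \<Sigma> u) v t" by (simp only: g(2))
  note W = Wc_limit[OF g(1) u' lim this]
  have "(\<lambda>n. L2_norm_sq (g n) - L2_norm_sq (proj {..<0} (D (g n)))) \<longlonglongrightarrow>
      L2_norm_sq (defect_operator {..<0} {..<0} (T_past \<Sigma>) u')"
    by (rule past_energy_tendsto[OF g(1) u' lim])
  moreover have "(\<lambda>n. L2_norm_sq (g n) - L2_norm_sq (proj {..<0} (D (g n)))) =
      (\<lambda>n. (L2_norm_sq (f n) - L2_norm_sq (proj {..<0} (D (f n)))) +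
        (L2_norm_sq (proj {0..t} v) - L2_norm_sq (proj {0..t} (response (B (f n)) v))))"
    by (simp only: g(3,4)) (simp add: algebra_simps)
  ultimately have "(\<lambda>n. (L2_norm_sq (f n) - L2_norm_sq (proj {..<0} (D (f n)))) +
        (L2_norm_sq (proj {0..t} v) - L2_norm_sq (proj {0..t} (response (B (f n)) v)))) \<longlonglongrightarrow>
      L2_norm_sq (defect_operator {..<0} {..<0} (T_past \<Sigma>) u')" by (simp only:)
  moreover have "(\<lambda>n. (L2_norm_sq (f n) - L2_norm_sq (proj {..<0} (D (f n)))) +
        (L2_norm_sq (proj {0..t} v) - L2_norm_sq (proj {0..t} (response (B (f n)) v)))) \<longlonglongrightarrow>
      L2_norm_sq (defect_operator {..<0} {..<0} (T_past \<Sigma>) u) +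
        (L2_norm_sq (proj {0..t} v) - L2_norm_sq (proj {0..t} (response (Wc \<Sigma> u) v)))"
    by (intro tendsto_add tendsto_diff[OF tendsto_const] response_tendsto vl f(3) past_energy_tendsto[OF f(1) u2 f(2)])
  ultimately show thesis by (rule that[OF W LIMSEQ_unique])
qed

lemma Wc_zero: "(\<lambda>_. 0) \<in> Wc_dom \<Sigma>" "Wc \<Sigma> (\<lambda>_. 0) = 0"
  using Wc_limit[of "\<lambda>_ _. 0" "\<lambda>_. 0" 0] L2_left_zero[of "{..<0}"]
  by (auto simp: L2_norm_sq_def B_zero L2_left_def)

lemma storage_function_required_supply: "storage_function \<Sigma> (regularized_required_supply \<Sigma>)"
proof (rule storage_functionI)
  show nonneg: "0 \<le> regularized_required_supply \<Sigma> x0" for x0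
    unfolding regularized_required_supply_def by (rule INF_greatest) (simp add: L2_norm_sq_def)
  have z: "(\<lambda>_. 0) \<in> L2 {..<0}" using L2_left_zero[of "{..<0}"] by (simp add: L2_left_def)
  have "L2_norm_sq (defect_operator {..<0} {..<0} (T_past \<Sigma>) (\<lambda>_. 0)) \<le> 0"
    by (subst L2_norm_sq_defect_operator[OF T_past_contraction _ _ z]) (auto simp: L2_norm_sq_def)
  then have "regularized_required_supply \<Sigma> 0 \<le> 0"
    using required_supply_le[OF Wc_zero(1)] unfolding Wc_zero(2)
    by (metis ereal_less_eq(3) order_trans zero_ereal_def)
  then show "regularized_required_supply \<Sigma> 0 = 0" using nonneg by (rule antisym)
  fix x0 and v :: "real \<Rightarrow> 'u" and t :: real assume v: "v \<in> L2_plus_loc" and t: "t > 0"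
  define c where "c = L2_norm_sq (proj {0..t} v) - L2_norm_sq (proj {0..t} (response x0 v))"
  \<comment> \<open>With the exchanged energy moved to the left, the claim is a lower bound for an
    infimum and is checked for each \<open>u\<close> separately. If no \<open>u\<close> produces
    \<open>x0\<close>, the infimum is infinite and there is nothing to check.\<close>
  have "regularized_required_supply \<Sigma> (state x0 v t) - ereal c \<le> regularized_required_supply \<Sigma> x0"
    unfolding regularized_required_supply_def[of \<Sigma> x0]
  proof (rule INF_greatest)
    fix u assume "u \<in> {u \<in> Wc_dom \<Sigma>. Wc \<Sigma> u = x0}"
    then have u: "u \<in> Wc_dom \<Sigma>" "Wc \<Sigma> u = x0" by auto
    obtain u' where u': "u' \<in> Wc_dom \<Sigma>" "Wc \<Sigma> u' = state x0 v t"
      "L2_norm_sq (defect_operator {..<0} {..<0} (T_past \<Sigma>) u') =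
        L2_norm_sq (defect_operator {..<0} {..<0} (T_past \<Sigma>) u) + c"
      using Wc_continued_input[OF u(1) v less_imp_le[OF t]] unfolding u(2) c_def .
    have "regularized_required_supply \<Sigma> (state x0 v t) \<le>
        ereal (L2_norm_sq (defect_operator {..<0} {..<0} (T_past \<Sigma>) u)) + ereal c"
      using required_supply_le[OF u'(1)] unfolding u'(2,3) by simp
    then show "regularized_required_supply \<Sigma> (state x0 v t) - ereal c \<le>
        ereal (L2_norm_sq (defect_operator {..<0} {..<0} (T_past \<Sigma>) u))"
      by (simp add: ereal_minus_le)
  qed
  then show "regularized_required_supply \<Sigma> (state x0 v t) \<le> regularized_required_supply \<Sigma> x0 +
      ereal (L2_norm_sq (proj {0..t} v) - L2_norm_sq (proj {0..t} (response x0 v)))"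
    unfolding c_def[symmetric] by (simp add: ereal_minus_le)
qed

end

theorem proposition6p8:
  fixes \<Sigma> :: "('u::separable_hilbert_space, 'x::separable_hilbert_space, 'y::separable_hilbert_space) system"
    and G :: "complex \<Rightarrow> ('u \<Rightarrow>\<^sub>L 'y)"
  assumes "well_posed_system \<Sigma>"
    and "is_transfer_function \<Sigma> G"
    and "transfer_function_in_schur_class \<Sigma> G"
    and "Wc_star_densely_defined \<Sigma>"
  shows "L2_regular_storage_function \<Sigma> (available_storage \<Sigma>) \<and>
    L2_regular_storage_function \<Sigma> (regularized_required_supply \<Sigma>)"
proof -
  interpret densely_defined_system \<Sigma> G by unfold_locales (fact assms)+
  have "available_storage \<Sigma> (Wc \<Sigma> u) < \<infinity>" "regularized_required_supply \<Sigma> (Wc \<Sigma> u) < \<infinity>"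
    if "u \<in> Wc_dom \<Sigma>" for u
    using available_storage_Wc_le[OF that] required_supply_le[OF that] by (auto intro: le_less_trans)
  then show ?thesis
    unfolding L2_regular_storage_function_def
    using storage_function_available_storage storage_function_required_supply by blast
qed

end
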